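(* Let $k=\mathbb{F}_q$, $B=\mathbb{P}^1_k$, and let $\mathsf{Z}(\mathbf{t})$, $\mathbf{t}=(t_1,t_2,t_3,t_4)$, be the series $$\mathsf{Z}(\mathbf{t})=\sum_{k_1,\dots,k_4=0}^\infty q^{\sum_{i=1}^4k_i}\Big(\sum_{(w\le x)\in(U_{\mathbf{k}}\le Q^{JB})(k)}\mu_k(w,x)q^{-\gamma(x)}\Big)t_1^{k_1}t_2^{k_2}t_3^{k_3}t_4^{k_4}.$$ Then there is the Euler product $$\prod_{i=1}^4Z_{\mathbb{P}^1}(q^{-1}t_i)^{-1}\,\mathsf{Z}(\mathbf{t})=\prod_{c\in|B|}\Big(1+O(q^{-2|c|})\big(1+\textstyle\sum_it_i^{|c|}\big)+\sum_{\substack{\ell_1,\ell_2,\ell_3,\ell_4\in\{0,1\}\\ \ell_1+\ell_2+\ell_3+\ell_4>1}}O(q^{-(\ell_1+\ell_2+\ell_3+\ell_4)|c|})\,t_1^{|c|\ell_1}t_2^{|c|\ell_2}t_3^{|c|\ell_3}t_4^{|c|\ell_4}\Big),$$ where $Z_{\mathbb{P}^1}(t)$ is the Hasse–Weil zeta function of $\mathbb{P}^1$. In particular, if $0<\delta<1/2$ then this Euler product converges absolutely when $|t_i|\le q^\delta$ for $i=1,\dots,4$. Furthermore, $$\lim_{t_i\to1}\ \prod_{i=1}^4(1-t_i)\cdot\mathsf{Z}(\mathbf{t})=(1-q^{-1})^{-4}\prod_{c\in|B|}(1-q^{-|c|})^6(1+6q^{-|c|}+q^{-2|c|}).$$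
   Context: $|B|$ is the set of closed points of $B=\mathbb{P}^1_{\mathbb{F}_q}$ and $|c|$ the degree of $c$. $Z_{\mathbb{P}^1}(t)=\frac{1}{(1-t)(1-qt)}$. The implied constants in the $O$-terms are independent of $c$ and $\mathbf{t}$. **The poset $Q$.** $V_1,V_2$ are $2$-dimensional $k$-vector spaces, $V=V_1\oplus V_2$; for each $j=1,2$, $\ell_{1,j},\dots,\ell_{4,j}\subset V_j$ are four distinct $1$-dimensional subspaces. (They correspond to the blown-up points of a split quartic del Pezzo surface $S\to\mathbb{P}(V_1)\times\mathbb{P}(V_2)$.) $Q$ is the following set of subspaces of $V$, ordered by inclusion (closed under intersection): $$\{V,\ V_1\oplus0,\ 0\oplus V_2,\ 0\}\cup\{\ell_{i,1}\oplus\ell_{i,2},\ \ell_{i,1}\oplus0,\ 0\oplus\ell_{i,2}\}_{i=1,\dots,4}.$$ **Saturated elements.** $Q^{JB}(k)$ is the poset of order-preserving maps $x:q\mapsto x_q$ from $Q$ to closed subschemes of $B$ (defined over $k$), with $x_V=B$, $x_q$ of finite length for $q\ne V$, and $x_{q_1\cap q_2}=x_{q_1}\cap x_{q_2}$ for all $q_1,q_2\in Q$; the order is termwise inclusion. **$U_{\mathbf{k}}$.** For $\mathbf{k}=(k_1,\dots,k_4)\in\mathbb{N}^4$, $U_{\mathbf{k}}(k)$ is the set of tuples $w=(w_1,\dots,w_4)$ of effective divisors on $B$ over $k$ with pairwise disjoint supports and $\deg w_i=k_i$; $w$ is regarded as the element of $Q^{JB}(k)$ with value $w_i$ at $\ell_{i,1}\oplus\ell_{i,2}$,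 value $B$ at $V$, and $\emptyset$ at the other elements. $(U_{\mathbf{k}}\le Q^{JB})(k)$ is the set of pairs $w\le x$ with $w\in U_{\mathbf{k}}(k)$, $x\in Q^{JB}(k)$. **Möbius function.** $\mu_k(w,w)=1$ and $\mu_k(w,x)=-\sum_{w\le y<x,\ y\in Q^{JB}(k)}\mu_k(w,y)$ for $w<x$. **The function $\gamma$.** On $Q$: $\gamma(V)=0$, $\gamma(\ell_{i,1}\oplus\ell_{i,2})=2$, $\gamma(V_j)=2$, $\gamma(\ell_{i,j})=3$, $\gamma(0)=4$ (with $V_j,\ell_{i,j}$ viewed as subspaces of $V$). For $x\in Q^{JB}(k)$ and $c\in B(\overline{k})$ let $f_c(n)$ be the smallest $q\in Q$ such that the length of $x_q$ at $c$ is $\ge n$ ($x_V=B$ having infinite length); then $\gamma(x)=\sum_{c\in B(\overline{k})}\sum_{n\ge1}\gamma(f_c(n))$. *)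

theory Defs
  imports
    "HOL-Analysis.Analysis"
    "HOL-Algebra.Algebraic_Closure_Type"
    "HOL-Library.Multiset"
begin

section \<open>Closed points and closed subschemes of the projective line\<close>

datatype 'a P1 = Affine 'a | Infty

text \<open>
  The closed points of the projective line over \<open>k\<close>: the maximal ideals of the chart
  \<open>Spec k[T]\<close>, given by their monic irreducible generators, and the point at infinity.
  The points of the projective line over the algebraic closure are the elements of
  \<open>'k alg_closure P1\<close>.
\<close>

typedef (overloaded) ('k::field) closed_point =
  "{Infty} \<union> Affine ` {f :: 'k poly. Factorial_Ring.irreducible f \<and> Polynomial.lead_coeff f = 1}"
  by blast

definition deg_pt :: "'k::field closed_point \<Rightarrow> nat" where
  "deg_pt c = (case Rep_closed_point c of Affine f \<Rightarrow> Polynomial.degree f | Infty \<Rightarrow> 1)"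

definition deg_div :: "'k::field closed_point multiset \<Rightarrow> nat" where
  "deg_div D = (\<Sum>c\<in>#D. deg_pt c)"

text \<open>
  The projective line is an integral regular curve, so a closed subscheme is either the whole
  curve or of finite length, and those of finite length are the effective divisors, i.e. the
  finite multisets of closed points. Inclusion and scheme-theoretic intersection become
  inclusion and intersection of multisets.
\<close>

datatype 'p subscheme = Whole | Div "'p multiset"

instantiation subscheme :: (type) semilattice_inf
begin

fun less_eq_subscheme :: "'a subscheme \<Rightarrow> 'a subscheme \<Rightarrow> bool" where
  "less_eq_subscheme A Whole = True"
| "less_eq_subscheme Whole (Div E) = False"
| "less_eq_subscheme (Div D) (Div E) = (D \<subseteq># E)"

definition less_subscheme :: "'a subscheme \<Rightarrow> 'a subscheme \<Rightarrow> bool" where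
  "less_subscheme A B \<longleftrightarrow> A \<le> B \<and> \<not> B \<le> A"

fun inf_subscheme :: "'a subscheme \<Rightarrow> 'a subscheme \<Rightarrow> 'a subscheme" where
  "inf_subscheme A Whole = A"
| "inf_subscheme Whole (Div E) = Div E"
| "inf_subscheme (Div D) (Div E) = Div (D \<inter># E)"

instance
proof
  fix A B C :: "'a subscheme"
  show "A < B \<longleftrightarrow> A \<le> B \<and> \<not> B \<le> A" by (rule less_subscheme_def)
  show "A \<le> A" by (cases A) auto
  show "A \<le> B \<Longrightarrow> B \<le> C \<Longrightarrow> A \<le> C" by (cases A; cases B; cases C) auto
  show "A \<le> B \<Longrightarrow> B \<le> A \<Longrightarrow> A = B" by (cases A; cases B) auto
  show "inf A B \<le> A" by (cases A; cases B) auto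
  show "inf A B \<le> B" by (cases A; cases B) auto
  show "A \<le> B \<Longrightarrow> A \<le> C \<Longrightarrow> A \<le> inf B C" by (cases A; cases B; cases C) auto
qed

end

text \<open>
  The multiplicity at a geometric point \<open>a\<close> of the base change of the closed point \<open>c\<close> to the
  algebraic closure.
\<close>

definition geom_mult :: "'k::field closed_point \<Rightarrow> 'k alg_closure P1 \<Rightarrow> nat" where
  "geom_mult c a = (case (Rep_closed_point c, a) of
       (Affine f, Affine z) \<Rightarrow> Polynomial.order z (map_poly to_ac f)
     | (Infty, Infty) \<Rightarrow> 1
     | _ \<Rightarrow> 0)"

fun length_at :: "'k::field closed_point subscheme \<Rightarrow> 'k alg_closure P1 \<Rightarrow> enat" where
  "length_at Whole a = \<infinity>"
| "length_at (Div D) a = enat (\<Sum>c\<in>#D. geom_mult c a)"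

section \<open>The poset of subspaces\<close>

text \<open>
  The space \<open>V\<close> is the product type \<open>'v \<times> 'w\<close>, and the index set of the lines is the
  four-element type \<open>4\<close>.
\<close>

definition plane_with_four_lines ::
    "('k::field \<Rightarrow> 'v::ab_group_add \<Rightarrow> 'v) \<Rightarrow> (4 \<Rightarrow> 'v set) \<Rightarrow> bool" where
  "plane_with_four_lines sc L \<longleftrightarrow>
     vector_space sc \<and> vector_space.dim sc (UNIV :: 'v set) = 2 \<and>
     (\<forall>i. module.subspace sc (L i) \<and> vector_space.dim sc (L i) = 1) \<and> inj L"

definition Qposet ::
    "(4 \<Rightarrow> 'v::zero set) \<Rightarrow> (4 \<Rightarrow> 'w::zero set) \<Rightarrow> ('v \<times> 'w) set set" where
  "Qposet L1 L2 = {UNIV, UNIV \<times> {0}, {0} \<times> UNIV, {(0, 0)}} \<union>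
     (\<Union>i. {L1 i \<times> L2 i, L1 i \<times> {0}, {0} \<times> L2 i})"

definition gammaQ ::
    "(4 \<Rightarrow> 'v::zero set) \<Rightarrow> (4 \<Rightarrow> 'w::zero set) \<Rightarrow> ('v \<times> 'w) set \<Rightarrow> nat" where
  "gammaQ L1 L2 S =
     (if S = UNIV then 0
      else if \<exists>i. S = L1 i \<times> L2 i then 2
      else if S = UNIV \<times> {0} \<or> S = {0} \<times> UNIV then 2
      else if \<exists>i. S = L1 i \<times> {0} \<or> S = {0} \<times> L2 i then 3
      else 4)"

section \<open>Saturated elements\<close>

text \<open>
  Maps out of \<open>Q\<close> are encoded as extensional functions, so that the pointwise order on
  functions is the termwise inclusion on \<open>Q\<close>.
\<close>

definition QJB ::
    "(4 \<Rightarrow> 'v::zero set) \<Rightarrow> (4 \<Rightarrow> 'w::zero set) \<Rightarrow>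
      (('v \<times> 'w) set \<Rightarrow> 'k::field closed_point subscheme) set" where
  "QJB L1 L2 = {x \<in> Qposet L1 L2 \<rightarrow>\<^sub>E UNIV.
     mono_on (Qposet L1 L2) x \<and>
     x UNIV = Whole \<and>
     (\<forall>S\<in>Qposet L1 L2. S \<noteq> UNIV \<longrightarrow> x S \<noteq> Whole) \<and>
     (\<forall>S\<in>Qposet L1 L2. \<forall>T\<in>Qposet L1 L2. x (S \<inter> T) = inf (x S) (x T))}"

definition local_filtration ::
    "(4 \<Rightarrow> 'v::zero set) \<Rightarrow> (4 \<Rightarrow> 'w::zero set) \<Rightarrow>
      (('v \<times> 'w) set \<Rightarrow> 'k::field closed_point subscheme) \<Rightarrow>
      'k alg_closure P1 \<Rightarrow> nat \<Rightarrow> ('v \<times> 'w) set" where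
  "local_filtration L1 L2 x a n =
     (LEAST S. S \<in> Qposet L1 L2 \<and> enat n \<le> length_at (x S) a)"

definition gamma ::
    "(4 \<Rightarrow> 'v::zero set) \<Rightarrow> (4 \<Rightarrow> 'w::zero set) \<Rightarrow>
      (('v \<times> 'w) set \<Rightarrow> 'k::field closed_point subscheme) \<Rightarrow> nat" where
  "gamma L1 L2 x =
     (\<Sum>\<^sub>\<infinity>a. \<Sum>\<^sub>\<infinity>n\<in>{1..}. gammaQ L1 L2 (local_filtration L1 L2 x a n))"

definition Uk :: "(4 \<Rightarrow> nat) \<Rightarrow> (4 \<Rightarrow> 'k::field closed_point multiset) set" where
  "Uk k = {w. (\<forall>i j. i \<noteq> j \<longrightarrow> set_mset (w i) \<inter> set_mset (w j) = {}) \<and>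
              (\<forall>i. deg_div (w i) = k i)}"

definition to_QJB ::
    "(4 \<Rightarrow> 'v::zero set) \<Rightarrow> (4 \<Rightarrow> 'w::zero set) \<Rightarrow>
      (4 \<Rightarrow> 'k::field closed_point multiset) \<Rightarrow>
      ('v \<times> 'w) set \<Rightarrow> 'k closed_point subscheme" where
  "to_QJB L1 L2 w = (\<lambda>S\<in>Qposet L1 L2.
     if S = UNIV then Whole
     else if \<exists>i. S = L1 i \<times> L2 i then Div (w (THE i. S = L1 i \<times> L2 i))
     else Div {#})"

definition Uk_le_QJB ::
    "(4 \<Rightarrow> 'v::zero set) \<Rightarrow> (4 \<Rightarrow> 'w::zero set) \<Rightarrow> (4 \<Rightarrow> nat) \<Rightarrow>
      ((4 \<Rightarrow> 'k::field closed_point multiset) \<times>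
        (('v \<times> 'w) set \<Rightarrow> 'k closed_point subscheme)) set" where
  "Uk_le_QJB L1 L2 k = {(w, x). w \<in> Uk k \<and> x \<in> QJB L1 L2 \<and> to_QJB L1 L2 w \<le> x}"

section \<open>The Moebius function\<close>

text \<open>
  The finiteness guard only serves termination; it holds for \<open>QJB\<close>, see \<open>moebius_QJB\<close> below.
\<close>

function moebius :: "'p::order set \<Rightarrow> 'p \<Rightarrow> 'p \<Rightarrow> int" where
  "moebius P w x =
     (if w = x then 1
      else if w < x \<and> finite {y \<in> P. w \<le> y \<and> y < x}
      then - (\<Sum>y\<in>{y \<in> P. w \<le> y \<and> y < x}. moebius P w y)
      else 0)"
  by auto
termination
proof (relation "Wellfounded.measure (\<lambda>(P, w, x). card {y \<in> P. w \<le> y \<and> y < x})", goal_cases)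
  case 1
  show ?case by simp
next
  case (2 P w x y)
  then have "{z \<in> P. w \<le> z \<and> z < y} \<subset> {z \<in> P. w \<le> z \<and> z < x}"
    by (auto intro: less_trans)
  with 2 show ?case by (auto intro: psubset_card_mono)
qed

declare moebius.simps [simp del]

lemma finite_Qposet: "finite (Qposet L1 L2)"
  unfolding Qposet_def by auto

lemma finite_below_QJB:
  fixes x :: "('v::zero \<times> 'w::zero) set \<Rightarrow> 'k::field closed_point subscheme"
  assumes "x \<in> QJB L1 L2"
  shows "finite {y \<in> QJB L1 L2. w \<le> y \<and> y < x}"
proof (rule finite_subset)
  define F where "F S = (if x S = Whole then {Whole}
      else Div ` {D. D \<subseteq># (case x S of Div E \<Rightarrow> E | Whole \<Rightarrow> {#})})" for S
  have fin: "finite {D. D \<subseteq># E}" for E :: "'k closed_point multiset"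
  proof (rule finite_subset)
    show "{D. D \<subseteq># E} \<subseteq>
        (\<Union>n\<in>{..size E}. multisets_of_size (set_mset E) n)"
      by (auto simp: multisets_of_size_def dest: set_mset_mono size_mset_mono)
    show "finite (\<Union>n\<in>{..size E}. multisets_of_size (set_mset E) n)"
      by (intro finite_UN_I finite_multisets_of_size) auto
  qed
  show "finite (Pi\<^sub>E (Qposet L1 L2) F)"
    by (intro finite_PiE finite_Qposet) (auto simp: F_def fin)
  show "{y \<in> QJB L1 L2. w \<le> y \<and> y < x} \<subseteq> Pi\<^sub>E (Qposet L1 L2) F"
  proof (rule subsetI)
    fix y assume "y \<in> {y \<in> QJB L1 L2. w \<le> y \<and> y < x}"
    then have y: "y \<in> QJB L1 L2" "y < x" by auto
    show "y \<in> Pi\<^sub>E (Qposet L1 L2) F"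
    proof (rule PiE_I)
      fix S assume S: "S \<in> Qposet L1 L2"
      have le: "y S \<le> x S" using y(2) by (simp add: le_fun_def less_le)
      show "y S \<in> F S"
      proof (cases "S = UNIV")
        case True
        then show ?thesis using y(1) assms by (auto simp: F_def QJB_def)
      next
        case False
        then have "y S \<noteq> Whole" "x S \<noteq> Whole" using y(1) assms S by (auto simp: QJB_def)
        then show ?thesis using le by (cases "x S"; cases "y S") (auto simp: F_def)
      qed
    next
      fix S assume "S \<notin> Qposet L1 L2"
      then show "y S = undefined" using y(1) by (auto simp: QJB_def PiE_def extensional_def)
    qed
  qed
qed

lemma moebius_QJB:
  assumes "x \<in> QJB L1 L2" "w < x"
  shows "moebius (QJB L1 L2) w x =
    - (\<Sum>y\<in>{y \<in> QJB L1 L2. w \<le> y \<and> y < x}. moebius (QJB L1 L2) w y)"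
  using assms finite_below_QJB[OF assms(1), of w] by (subst moebius.simps) auto

section \<open>The series and the Euler product\<close>

definition Zterm ::
    "(4 \<Rightarrow> 'v::zero set) \<Rightarrow> (4 \<Rightarrow> 'w::zero set) \<Rightarrow>
      (4 \<Rightarrow> 'k::{field,finite} closed_point multiset) \<times>
        (('v \<times> 'w) set \<Rightarrow> 'k closed_point subscheme) \<Rightarrow> real" where
  "Zterm L1 L2 = (\<lambda>(w, x).
     of_int (moebius (QJB L1 L2) (to_QJB L1 L2 w) x) / real CARD('k) ^ gamma L1 L2 x)"

definition Zcoeff ::
    "'k::{field,finite} itself \<Rightarrow> (4 \<Rightarrow> 'v::zero set) \<Rightarrow> (4 \<Rightarrow> 'w::zero set) \<Rightarrow>
      (4 \<Rightarrow> nat) \<Rightarrow> real" where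
  "Zcoeff _ L1 L2 k = real CARD('k) ^ (\<Sum>i\<in>UNIV. k i) *
     (\<Sum>\<^sub>\<infinity>p\<in>(Uk_le_QJB L1 L2 k :: ((4 \<Rightarrow> 'k closed_point multiset) \<times> _) set).
        Zterm L1 L2 p)"

definition Zmonomial ::
    "'k::{field,finite} itself \<Rightarrow> (4 \<Rightarrow> 'v::zero set) \<Rightarrow> (4 \<Rightarrow> 'w::zero set) \<Rightarrow>
      complex ^ 4 \<Rightarrow> (4 \<Rightarrow> nat) \<Rightarrow> complex" where
  "Zmonomial K L1 L2 t k = of_real (Zcoeff K L1 L2 k) * (\<Prod>i\<in>UNIV. (t $ i) ^ k i)"

definition Zseries ::
    "'k::{field,finite} itself \<Rightarrow> (4 \<Rightarrow> 'v::zero set) \<Rightarrow> (4 \<Rightarrow> 'w::zero set) \<Rightarrow>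
      complex ^ 4 \<Rightarrow> complex" where
  "Zseries K L1 L2 t = (\<Sum>\<^sub>\<infinity>k. Zmonomial K L1 L2 t k)"

definition zeta_P1 :: "real \<Rightarrow> complex \<Rightarrow> complex" where
  "zeta_P1 q t = 1 / ((1 - t) * (1 - of_real q * t))"

text \<open>Unordered infinite products: the limit of the finite partial products.\<close>

definition infprod :: "('c \<Rightarrow> 'a::{comm_monoid_mult,t2_space}) \<Rightarrow> 'a" where
  "infprod f = Lim (finite_subsets_at_top UNIV) (\<lambda>A. \<Prod>c\<in>A. f c)"

definition abs_convergent_infprod :: "('c \<Rightarrow> 'a::{real_normed_field,banach}) \<Rightarrow> bool" where
  "abs_convergent_infprod f \<longleftrightarrow> (\<lambda>c. norm (f c - 1)) summable_on UNIV"

text \<open>Exponent vectors in \<open>{0,1}\<^sup>4\<close> of total degree at least two.\<close>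

definition higher_exponents :: "(4 \<Rightarrow> nat) set" where
  "higher_exponents = {l. range l \<subseteq> {0, 1} \<and> (\<Sum>i\<in>UNIV. l i) > 1}"

text \<open>
  The coefficient functions \<open>a\<close>, \<open>b\<close> and \<open>e\<close> are the respective O-terms of the Euler factor
  at a closed point \<open>c\<close>: of the constant term, of the terms linear in one \<open>t\<^sub>i\<^bsup>|c|\<^esup>\<close>,
  and of the remaining terms. They do not depend on \<open>t\<close>.
\<close>

definition euler_coeffs_bounded ::
    "real \<Rightarrow> ('k::{field,finite} closed_point \<Rightarrow> real) \<Rightarrow> ('k closed_point \<Rightarrow> 4 \<Rightarrow> real) \<Rightarrow>
      ('k closed_point \<Rightarrow> (4 \<Rightarrow> nat) \<Rightarrow> real) \<Rightarrow> bool" where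
  "euler_coeffs_bounded C a b e \<longleftrightarrow> (\<forall>c.
     \<bar>a c\<bar> \<le> C / real CARD('k) ^ (2 * deg_pt c) \<and>
     (\<forall>i. \<bar>b c i\<bar> \<le> C / real CARD('k) ^ (2 * deg_pt c)) \<and>
     (\<forall>l\<in>higher_exponents. \<bar>e c l\<bar> \<le> C / real CARD('k) ^ ((\<Sum>i\<in>UNIV. l i) * deg_pt c)))"

definition euler_factor ::
    "('k::{field,finite} closed_point \<Rightarrow> real) \<Rightarrow> ('k closed_point \<Rightarrow> 4 \<Rightarrow> real) \<Rightarrow>
      ('k closed_point \<Rightarrow> (4 \<Rightarrow> nat) \<Rightarrow> real) \<Rightarrow> complex ^ 4 \<Rightarrow> 'k closed_point \<Rightarrow> complex" where
  "euler_factor a b e t c =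
     1 + (of_real (a c) + (\<Sum>i\<in>UNIV. of_real (b c i) * (t $ i) ^ deg_pt c)) +
     (\<Sum>l\<in>higher_exponents. of_real (e c l) * (\<Prod>i\<in>UNIV. (t $ i) ^ (deg_pt c * l i)))"

definition limit_factor :: "'k::{field,finite} closed_point \<Rightarrow> complex" where
  "limit_factor c = (let u = 1 / of_nat CARD('k) ^ deg_pt c in
     (1 - u) ^ 6 * (1 + 6 * u + u ^ 2))"

end

theory Submission
  imports Defs
begin

text \<open>
  The poset of saturated elements is local. An element \<open>x\<close> amounts to giving, for every closed point
  \<open>c\<close>, the multiplicities of \<open>x\<close> at the six coatoms of \<open>Q\<close>; the compatibility with intersections
  becomes a condition on the six multiplicities at each point separately, and the order is
  componentwise (\<open>QJB_eq\<close>, \<open>of_jets_le_iff\<close>). Hence an interval of the poset is a finite product of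
  local intervals and the Moebius function is the product of the local ones (\<open>moebius_finsupp\<close>). Over
  a finite field irreducible polynomials are separable, so \<open>gamma\<close> is the sum over the closed points of
  the degree times a local \<open>gamma\<close> (\<open>gamma_of_jets\<close>). The series is therefore a sum, over finitely
  supported families of local pairs, of products of local weights, and such a sum is the unordered
  product of the local sums (\<open>euler_product\<close>).

  Write \<open>u = q^{-|c|}\<close> and \<open>T\<^sub>i = t\<^sub>i^{|c|}\<close>. The local Moebius function vanishes outside an explicit
  list. Above \<open>0\<close> it lives on the jets of the elements of \<open>Q\<close>, with values \<open>1\<close>, \<open>-1\<close>, \<open>1\<close>, \<open>-3\<close>
  (\<open>moebius_jets_zero\<close>). Above \<open>k\<close> times the point at the \<open>i\<close>-th line, \<open>k > 0\<close>, three independent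
  moves are possible and it lives on the resulting Boolean cube, with alternating signs
  (\<open>moebius_jets_diag\<close>). The local sum is therefore
    \<open>(1 - u)^3 (1 + 3 u) + (1 - u)^3 (1 + u) \<Sum>\<^sub>i u T\<^sub>i / (1 - u T\<^sub>i)\<close>.
  The inverse zeta factors multiply it by \<open>\<Prod>\<^sub>i (1 - u T\<^sub>i)\<close>, by the Euler product of the zeta function
  of the projective line (\<open>zeta_euler_product\<close>, which is unique factorisation of monic polynomials).
  The product is multilinear in the \<open>T\<^sub>i\<close>, and the coefficient of a monomial of degree \<open>n\<close> is
    \<open>(-u)^n (1 - u)^3 ((1 + 3 u) - n (1 + u))\<close>,
  which gives the required bounds: the terms of order \<open>u\<close> cancel for \<open>n = 0\<close> and \<open>n = 1\<close>. At \<open>T\<^sub>i = 1\<close>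
  the factor is \<open>(1 - u)^6 (1 + 6 u + u^2)\<close>. The bounds are uniform for \<open>|t\<^sub>i| \<le> M\<close> with \<open>M^2 < q\<close>, so
  the Euler product is continuous at \<open>t = 1\<close>, which yields the limits.
\<close>

section \<open>Absolutely convergent products over arbitrary index sets\<close>

text \<open>
  Two notions in the libraries share an infix notation; below it always means absolute summability
  in the sense of \<open>Infinite_Sum\<close>.
\<close>

no_notation Infinite_Set_Sum.abs_summable_on (infix "abs'_summable'_on" 50)

lemma filterlim_Pow_finite_subsets:
  "filterlim Pow (finite_subsets_at_top {D :: 'c set. finite D}) (finite_subsets_at_top UNIV)"
proof -
  have "\<forall>\<^sub>F A in finite_subsets_at_top UNIV. P (Pow A)"
    if "eventually P (finite_subsets_at_top {D :: 'c set. finite D})" for P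
  proof -
    from that obtain Y where Y: "finite Y" "Y \<subseteq> {D. finite D}"
      and P: "\<forall>W. finite W \<and> Y \<subseteq> W \<and> W \<subseteq> {D. finite D} \<longrightarrow> P W"
      unfolding eventually_finite_subsets_at_top by blast
    define U where "U = \<Union> Y"
    have "finite U" using Y by (auto simp: U_def)
    moreover have "P (Pow A)" if "finite A" "U \<subseteq> A" for A
    proof -
      have "finite (Pow A)" "Y \<subseteq> Pow A" using that by (auto simp: U_def)
      moreover have "Pow A \<subseteq> {D. finite D}" using that(1) by (auto dest: finite_subset)
      ultimately show ?thesis using P by simp
    qed
    ultimately show ?thesis
      unfolding eventually_finite_subsets_at_top by blast
  qed
  then show ?thesis unfolding filterlim_iff by blast
qed

lemma prod_one_add:
  fixes h :: "'c \<Rightarrow> 'a::comm_semiring_1"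
  assumes "finite A"
  shows "(\<Prod>c\<in>A. 1 + h c) = (\<Sum>D\<in>Pow A. \<Prod>c\<in>D. h c)"
proof -
  have "(\<Prod>c\<in>A. 1 + h c) = (\<Prod>c\<in>A. h c + 1)" by (simp only: add.commute)
  also have "\<dots> = (\<Sum>D\<in>Pow A. \<Prod>c\<in>D. h c)" by (subst prod_add[OF assms]) simp
  finally show ?thesis .
qed

lemma abs_summable_prod_finite_sets:
  fixes h :: "'c \<Rightarrow> 'a::{real_normed_field,banach}"
  assumes "h abs_summable_on UNIV"
  shows "(\<lambda>D. \<Prod>c\<in>D. h c) abs_summable_on {D. finite D}"
  unfolding abs_summable_iff_bdd_above
proof (rule bdd_aboveI2)
  fix F assume "F \<in> {F. F \<subseteq> {D :: 'c set. finite D} \<and> finite F}"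
  then have fin: "finite F" "finite (\<Union>F)" by auto
  have "(\<Sum>D\<in>F. norm (\<Prod>c\<in>D. h c)) \<le> (\<Sum>D\<in>Pow (\<Union>F). norm (\<Prod>c\<in>D. h c))"
    using fin by (intro sum_mono2) auto
  also have "\<dots> = (\<Prod>c\<in>\<Union>F. norm (h c) + 1)"
    using fin by (subst prod_add) (auto simp: prod_norm)
  also have "\<dots> = (\<Prod>c\<in>\<Union>F. 1 + norm (h c))" by (simp add: add.commute)
  also have "\<dots> \<le> exp (\<Sum>c\<in>\<Union>F. norm (h c))" by (rule prod_le_exp_sum) auto
  also have "\<dots> \<le> exp (\<Sum>\<^sub>\<infinity>c. norm (h c))"
    using fin assms by (simp add: finite_sum_le_infsum)
  finally show "(\<Sum>D\<in>F. norm (\<Prod>c\<in>D. h c)) \<le> exp (\<Sum>\<^sub>\<infinity>c. norm (h c))" .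
qed

text \<open>
  An absolutely convergent infinite product is the sum of its expansion over the finite sets of
  indices; in particular it converges.
\<close>

lemma tendsto_prod_expansion:
  fixes h :: "'c \<Rightarrow> 'a::{real_normed_field,banach}"
  assumes "h abs_summable_on UNIV"
  shows "((\<lambda>A. \<Prod>c\<in>A. 1 + h c) \<longlongrightarrow> (\<Sum>\<^sub>\<infinity>D\<in>{D. finite D}. \<Prod>c\<in>D. h c)) (finite_subsets_at_top UNIV)"
proof -
  have "(sum (\<lambda>D. \<Prod>c\<in>D. h c) \<longlongrightarrow> (\<Sum>\<^sub>\<infinity>D\<in>{D. finite D}. \<Prod>c\<in>D. h c))
      (finite_subsets_at_top {D. finite D})"
    by (rule infsum_tendsto[OF abs_summable_summable[OF abs_summable_prod_finite_sets[OF assms]]])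
  then have "((\<lambda>A. \<Sum>D\<in>Pow A. \<Prod>c\<in>D. h c) \<longlongrightarrow> (\<Sum>\<^sub>\<infinity>D\<in>{D. finite D}. \<Prod>c\<in>D. h c)) (finite_subsets_at_top UNIV)"
    by (rule filterlim_compose[OF _ filterlim_Pow_finite_subsets])
  moreover have "\<forall>\<^sub>F A in finite_subsets_at_top UNIV. (\<Sum>D\<in>Pow A. \<Prod>c\<in>D. h c) = (\<Prod>c\<in>A. 1 + h c)"
    by (rule eventually_finite_subsets_at_top_weakI) (rule prod_one_add[symmetric])
  ultimately show ?thesis by (rule Lim_transform_eventually)
qed

lemma infprod_eqI:
  "(prod f \<longlongrightarrow> p) (finite_subsets_at_top UNIV) \<Longrightarrow> infprod f = p"
  unfolding infprod_def by (rule tendsto_Lim) auto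

lemma tendsto_infprod:
  fixes f :: "'c \<Rightarrow> 'a::{real_normed_field,banach}"
  assumes "abs_convergent_infprod f"
  shows "(prod f \<longlongrightarrow> infprod f) (finite_subsets_at_top UNIV)"
  using tendsto_prod_expansion[of "\<lambda>c. f c - 1"] infprod_eqI[of f] assms
  by (simp add: abs_convergent_infprod_def)

lemma infprod_eq_expansion:
  fixes f :: "'c \<Rightarrow> 'a::{real_normed_field,banach}"
  assumes "abs_convergent_infprod f"
  shows "infprod f = (\<Sum>\<^sub>\<infinity>D\<in>{D. finite D}. \<Prod>c\<in>D. f c - 1)"
  using tendsto_prod_expansion[of "\<lambda>c. f c - 1"] assms
  by (intro infprod_eqI) (simp add: abs_convergent_infprod_def)

text \<open>
  Dominated convergence for infinite products: a summable bound for the distance of the factors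
  from 1 makes the expansion over finite sets converge uniformly.
\<close>

lemma tendsto_infprod_dominated:
  fixes f :: "'t::topological_space \<Rightarrow> 'c \<Rightarrow> 'a::{real_normed_field,banach}"
  assumes K: "K summable_on UNIV" and S: "t0 \<in> S"
    and bound: "\<And>t c. t \<in> S \<Longrightarrow> norm (f t c - 1) \<le> K c"
    and cont: "\<And>c. continuous_on S (\<lambda>t. f t c)"
  shows "((\<lambda>t. infprod (f t)) \<longlongrightarrow> infprod (f t0)) (at t0 within S)"
proof -
  let ?h = "\<lambda>t D. \<Prod>c\<in>D. f t c - 1" and ?F = "{D :: 'c set. finite D}"
  have K0: "K c \<ge> 0" for c using bound[OF S, of c] norm_ge_zero order_trans by blast
  have Kabs: "K abs_summable_on UNIV" using K K0 by (simp add: abs_of_nonneg)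
  have conv: "abs_convergent_infprod (f t)" if "t \<in> S" for t
    unfolding abs_convergent_infprod_def
    by (rule Infinite_Sum.abs_summable_on_comparison_test'[OF K]) (use bound that in auto)
  have "uniform_limit S (\<lambda>F t. \<Sum>D\<in>F. ?h t D) (\<lambda>t. \<Sum>\<^sub>\<infinity>D\<in>?F. ?h t D) (finite_subsets_at_top ?F)"
  proof (rule Weierstrass_m_test_general)
    show "(\<lambda>D. \<Prod>c\<in>D. K c) summable_on ?F"
      using abs_summable_prod_finite_sets[OF Kabs] K0 by (simp add: prod_nonneg)
    show "norm (?h t D) \<le> (\<Prod>c\<in>D. K c)" if "D \<in> ?F" "t \<in> S" for D t
      unfolding prod_norm[symmetric] using bound that by (intro prod_mono) auto
  qed
  then have "continuous_on S (\<lambda>t. \<Sum>\<^sub>\<infinity>D\<in>?F. ?h t D)"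
    by (rule uniform_limit_theorem[rotated])
       (auto intro!: always_eventually continuous_intros cont)
  then have "continuous_on S (\<lambda>t. infprod (f t))"
    by (rule continuous_on_eq) (simp add: infprod_eq_expansion conv)
  then show ?thesis using S by (simp add: continuous_on_def)
qed

lemma abs_summable_prod_PiE:
  fixes f :: "'a \<Rightarrow> 'b \<Rightarrow> 'c::{real_normed_field,banach}"
  assumes fin: "finite A" and f: "\<And>x. x \<in> A \<Longrightarrow> f x abs_summable_on B x"
  shows "(\<lambda>g. \<Prod>x\<in>A. f x (g x)) abs_summable_on PiE A B"
  unfolding abs_summable_iff_bdd_above
proof (rule bdd_aboveI2)
  fix F assume F: "F \<in> {F. F \<subseteq> PiE A B \<and> finite F}"
  define C where "C x = (\<lambda>g. g x) ` F" for x
  have C: "finite (C x)" for x using F by (auto simp: C_def)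
  have CB: "C x \<subseteq> B x" if "x \<in> A" for x using F that by (auto simp: C_def)
  have "F \<subseteq> PiE A C" using F by (auto simp: C_def PiE_def extensional_def)
  then have "(\<Sum>g\<in>F. norm (\<Prod>x\<in>A. f x (g x))) \<le> (\<Sum>g\<in>PiE A C. norm (\<Prod>x\<in>A. f x (g x)))"
    using C fin by (intro sum_mono2 finite_PiE) auto
  also have "\<dots> = (\<Prod>x\<in>A. \<Sum>y\<in>C x. norm (f x y))"
    using C fin by (subst prod_sum_PiE) (auto simp: prod_norm)
  also have "\<dots> \<le> (\<Prod>x\<in>A. \<Sum>\<^sub>\<infinity>y\<in>B x. norm (f x y))"
    using C CB f by (intro prod_mono conjI sum_nonneg finite_sum_le_infsum) auto
  finally show "(\<Sum>g\<in>F. norm (\<Prod>x\<in>A. f x (g x))) \<le> (\<Prod>x\<in>A. \<Sum>\<^sub>\<infinity>y\<in>B x. norm (f x y))" .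
qed

text \<open>
  Functions with values in \<open>S\<close> that take the value \<open>d\<close> almost everywhere.
\<close>

definition finsupp :: "'s set \<Rightarrow> 's \<Rightarrow> ('c \<Rightarrow> 's) set" where
  "finsupp S d = {\<sigma>. range \<sigma> \<subseteq> S \<and> finite {c. \<sigma> c \<noteq> d}}"

text \<open>
  The sum over finitely supported families of local data \<open>\<sigma> c\<close> of the products of their weights is the
  infinite product of the local sums. The trivial datum \<open>d\<close> has weight 1, so only the support of \<open>\<sigma>\<close>
  contributes. A family is the same as a finite set \<open>D\<close> and a choice of nontrivial data over \<open>D\<close>;
  summing over the choices first leaves the expansion of the product.
\<close>

theorem euler_product:
  fixes g :: "'c \<Rightarrow> 's \<Rightarrow> 'a::{real_normed_field,banach}"
  assumes d: "d \<in> S" "\<And>c. g c d = 1"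
    and g: "\<And>c. g c abs_summable_on S"
    and sum: "(\<lambda>c. \<Sum>\<^sub>\<infinity>s\<in>S - {d}. norm (g c s)) summable_on UNIV"
  defines "F \<equiv> \<lambda>c. \<Sum>\<^sub>\<infinity>s\<in>S. g c s"
  shows "(\<lambda>\<sigma>. \<Prod>c | \<sigma> c \<noteq> d. g c (\<sigma> c)) abs_summable_on finsupp S d"
    and "abs_convergent_infprod F"
    and "(\<Sum>\<^sub>\<infinity>\<sigma>\<in>finsupp S d. \<Prod>c | \<sigma> c \<noteq> d. g c (\<sigma> c)) = infprod F"
proof -
  let ?S = "S - {d}"
  let ?X = "SIGMA D:{D :: 'c set. finite D}. PiE D (\<lambda>_. ?S)"
  define \<phi> where "\<phi> = (\<lambda>(D, f) c :: 'c. if c \<in> D then f c else d :: 's)"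
  define \<psi> where "\<psi> = (\<lambda>\<sigma> :: 'c \<Rightarrow> 's. ({c. \<sigma> c \<noteq> d}, restrict \<sigma> {c. \<sigma> c \<noteq> d}))"
  define P where "P = (\<lambda>(D :: 'c set, f). \<Prod>c\<in>D. g c (f c))"
  have gS: "g c abs_summable_on ?S" for c
    by (rule summable_on_subset_banach[OF g[of c]]) auto
  have bij: "bij_betw \<phi> ?X (finsupp S d)"
  proof (rule bij_betw_byWitness[where f' = \<psi>])
    show "\<forall>a\<in>?X. \<psi> (\<phi> a) = a"
    proof
      fix a assume "a \<in> ?X"
      then obtain D f where a: "a = (D, f)" "finite D" "f \<in> PiE D (\<lambda>_. ?S)" by auto
      then have "{c. \<phi> a c \<noteq> d} = D" by (auto simp: \<phi>_def dest: PiE_mem)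
      moreover have "restrict (\<phi> a) D = f" using a by (auto simp: \<phi>_def fun_eq_iff PiE_def extensional_def)
      ultimately show "\<psi> (\<phi> a) = a" using a by (simp add: \<psi>_def)
    qed
    show "\<forall>\<sigma>\<in>finsupp S d. \<phi> (\<psi> \<sigma>) = \<sigma>" by (auto simp: \<phi>_def \<psi>_def)
    show "\<phi> ` ?X \<subseteq> finsupp S d"
    proof safe
      fix D :: "'c set" and f assume Df: "finite D" "f \<in> PiE D (\<lambda>_. ?S)"
      then have "{c. \<phi> (D, f) c \<noteq> d} = D" by (auto simp: \<phi>_def dest: PiE_mem)
      then show "\<phi> (D, f) \<in> finsupp S d" using Df d by (auto simp: finsupp_def \<phi>_def dest: PiE_mem)
    qed
    show "\<psi> ` finsupp S d \<subseteq> ?X" by (auto simp: finsupp_def \<psi>_def)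
  qed
  have P_eq: "P a = (\<Prod>c | \<phi> a c \<noteq> d. g c (\<phi> a c))" if "a \<in> ?X" for a
  proof -
    obtain D f where a: "a = (D, f)" "finite D" "f \<in> PiE D (\<lambda>_. ?S)" using \<open>a \<in> ?X\<close> by auto
    then have "{c. \<phi> a c \<noteq> d} = D" by (auto simp: \<phi>_def dest: PiE_mem)
    then show ?thesis using a by (auto simp: P_def \<phi>_def intro!: prod.cong)
  qed
  define H where "H c = (\<Sum>\<^sub>\<infinity>s\<in>?S. norm (g c s))" for c
  have H0: "H c \<ge> 0" for c by (auto simp: H_def intro: infsum_nonneg)
  have Habs: "H abs_summable_on UNIV" using sum H0 by (simp add: H_def[symmetric] abs_of_nonneg)
  define h where "h c = (\<Sum>\<^sub>\<infinity>s\<in>?S. g c s)" for c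
  have F_eq: "F c = 1 + h c" for c
  proof -
    have "F c = infsum (g c) (insert d ?S)" unfolding F_def using d by (simp add: insert_absorb)
    also have "\<dots> = 1 + h c"
      unfolding h_def using abs_summable_summable[OF gS[of c]] d by (subst infsum_insert) auto
    finally show ?thesis .
  qed
  have h_le: "norm (h c) \<le> H c" for c
    unfolding h_def H_def using norm_infsum_bound gS by blast
  have habs: "h abs_summable_on UNIV"
    by (rule Infinite_Sum.abs_summable_on_comparison_test[OF Habs]) (use h_le H0 in auto)
  show conv: "abs_convergent_infprod F"
    using habs by (simp add: abs_convergent_infprod_def F_eq)
  have "(\<lambda>a. norm (P a)) summable_on ?X"
  proof (rule summable_on_SigmaI)
    fix D :: "'c set" assume D: "D \<in> {D. finite D}"
    have "(\<lambda>f. \<Prod>c\<in>D. g c (f c)) abs_summable_on PiE D (\<lambda>_. ?S)"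
      by (rule abs_summable_prod_PiE) (use D gS in auto)
    then have *: "(\<lambda>f. norm (P (D, f))) summable_on PiE D (\<lambda>_. ?S)" by (simp add: P_def)
    moreover have "infsum (\<lambda>f. norm (P (D, f))) (PiE D (\<lambda>_. ?S)) = (\<Prod>c\<in>D. H c)"
      unfolding P_def H_def prod.case prod_norm[symmetric]
      by (rule infsum_prod_PiE_abs) (use D gS in auto)
    ultimately show "((\<lambda>f. norm (P (D, f))) has_sum (\<Prod>c\<in>D. H c)) (PiE D (\<lambda>_. ?S))"
      by (metis has_sum_infsum)
  next
    show "(\<lambda>D. \<Prod>c\<in>D. H c) summable_on {D. finite D}"
      using abs_summable_prod_finite_sets[OF Habs] H0 by (simp add: prod_nonneg)
  qed auto
  then have Pabs: "P abs_summable_on ?X" .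
  show "(\<lambda>\<sigma>. \<Prod>c | \<sigma> c \<noteq> d. g c (\<sigma> c)) abs_summable_on finsupp S d"
  proof -
    have "(\<lambda>a. norm (\<Prod>c | \<phi> a c \<noteq> d. g c (\<phi> a c))) summable_on ?X"
      using Pabs by (rule summable_on_cong[THEN iffD1, rotated]) (simp add: P_eq)
    then show ?thesis by (subst (asm) summable_on_reindex_bij_betw[OF bij])
  qed
  have "(\<Sum>\<^sub>\<infinity>\<sigma>\<in>finsupp S d. \<Prod>c | \<sigma> c \<noteq> d. g c (\<sigma> c)) = infsum P ?X"
    by (subst infsum_reindex_bij_betw[OF bij, symmetric]) (auto intro!: infsum_cong simp: P_eq)
  also have "\<dots> = (\<Sum>\<^sub>\<infinity>D\<in>{D. finite D}. \<Sum>\<^sub>\<infinity>f\<in>PiE D (\<lambda>_. ?S). P (D, f))"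
    by (rule infsum_Sigma_banach[symmetric]) (rule abs_summable_summable[OF Pabs])
  also have "\<dots> = (\<Sum>\<^sub>\<infinity>D\<in>{D. finite D}. \<Prod>c\<in>D. F c - 1)"
  proof (rule infsum_cong)
    fix D :: "'c set" assume "D \<in> {D. finite D}"
    then show "(\<Sum>\<^sub>\<infinity>f\<in>PiE D (\<lambda>_. ?S). P (D, f)) = (\<Prod>c\<in>D. F c - 1)"
      using gS by (simp add: P_def infsum_prod_PiE_abs F_eq h_def)
  qed
  also have "\<dots> = infprod F" by (rule infprod_eq_expansion[OF conv, symmetric])
  finally show "(\<Sum>\<^sub>\<infinity>\<sigma>\<in>finsupp S d. \<Prod>c | \<sigma> c \<noteq> d. g c (\<sigma> c)) = infprod F" .
qed

section \<open>Moebius functions\<close>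

lemma moebius_refl [simp]: "moebius P w w = 1"
  by (subst moebius.simps) simp

text \<open>
  The Moebius function is characterised by the vanishing of its sums over closed intervals. The point
  \<open>w\<close> need not be assumed to lie in \<open>P\<close>.
\<close>

lemma moebius_eqI:
  fixes P :: "'p::order set"
  assumes fin: "\<And>x. x \<in> P \<Longrightarrow> finite {y \<in> P. w \<le> y \<and> y \<le> x}"
    and refl: "M w = 1"
    and sum: "\<And>x. x \<in> P \<Longrightarrow> w < x \<Longrightarrow> (\<Sum>y\<in>{y \<in> P. w \<le> y \<and> y \<le> x}. M y) = 0"
    and x: "x \<in> P" "w \<le> x"
  shows "moebius P w x = M x"
  using x
proof (induction "card {y \<in> P. w \<le> y \<and> y \<le> x}" arbitrary: x rule: less_induct)
  case less
  show ?case
  proof (cases "w = x")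
    case True
    then show ?thesis using refl by simp
  next
    case False
    then have wx: "w < x" using less.prems by simp
    let ?I = "{y \<in> P. w \<le> y \<and> y < x}"
    have I: "{y \<in> P. w \<le> y \<and> y \<le> x} = insert x ?I" using less.prems by auto
    have finI: "finite ?I" by (rule finite_subset[OF _ fin[OF less.prems(1)]]) auto
    have IH: "moebius P w y = M y" if "y \<in> ?I" for y
    proof (rule less.hyps)
      have "{z \<in> P. w \<le> z \<and> z \<le> y} \<subset> {z \<in> P. w \<le> z \<and> z \<le> x}"
        using that less.prems by (auto dest: less_le_trans le_less_trans)
      then show "card {z \<in> P. w \<le> z \<and> z \<le> y} < card {z \<in> P. w \<le> z \<and> z \<le> x}"
        using fin[OF less.prems(1)] by (rule psubset_card_mono[rotated])
    qed (use that in auto)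
    have "moebius P w x = - (\<Sum>y\<in>?I. moebius P w y)"
      using wx finI by (subst moebius.simps) simp
    also have "\<dots> = - (\<Sum>y\<in>?I. M y)" using IH by simp
    also have "\<dots> = M x" using sum[OF less.prems(1) wx] finI by (simp add: I)
    finally show ?thesis .
  qed
qed

lemma sum_moebius_interval:
  fixes P :: "'p::order set"
  assumes "x \<in> P" "w < x" "finite {y \<in> P. w \<le> y \<and> y \<le> x}"
  shows "(\<Sum>y\<in>{y \<in> P. w \<le> y \<and> y \<le> x}. moebius P w y) = 0"
proof -
  let ?I = "{y \<in> P. w \<le> y \<and> y < x}"
  have I: "{y \<in> P. w \<le> y \<and> y \<le> x} = insert x ?I" using assms by auto
  have "finite ?I" by (rule finite_subset[OF _ assms(3)]) auto
  then show ?thesis using assms(2) by (subst I) (simp, subst moebius.simps, simp)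
qed

text \<open>
  The Moebius function is invariant under isomorphisms of posets.
\<close>

lemma moebius_image:
  fixes P :: "'p::order set" and \<Phi> :: "'p \<Rightarrow> 'r::order"
  assumes iso: "\<And>x y. x \<in> P \<Longrightarrow> y \<in> P \<Longrightarrow> \<Phi> x \<le> \<Phi> y \<longleftrightarrow> x \<le> y"
    and fin: "\<And>x. x \<in> P \<Longrightarrow> finite {y \<in> P. w \<le> y \<and> y \<le> x}"
    and w: "w \<in> P" and x: "x \<in> P" "w \<le> x"
  shows "moebius (\<Phi> ` P) (\<Phi> w) (\<Phi> x) = moebius P w x"
proof -
  have inj: "inj_on \<Phi> P"
  proof (rule inj_onI)
    fix a b assume "a \<in> P" "b \<in> P" "\<Phi> a = \<Phi> b"
    then have "a \<le> b" "b \<le> a" using iso[of a b] iso[of b a] by simp_all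
    then show "a = b" by (rule order_antisym)
  qed
  have I: "{z \<in> \<Phi> ` P. \<Phi> w \<le> z \<and> z \<le> \<Phi> y} = \<Phi> ` {u \<in> P. w \<le> u \<and> u \<le> y}" if "y \<in> P" for y
    by (auto simp: iso w that)
  have "moebius (\<Phi> ` P) (\<Phi> w) (\<Phi> x) = moebius P w (the_inv_into P \<Phi> (\<Phi> x))"
  proof (rule moebius_eqI)
    show "moebius P w (the_inv_into P \<Phi> (\<Phi> w)) = 1"
      using inj w by (simp add: the_inv_into_f_f)
    show "finite {z \<in> \<Phi> ` P. \<Phi> w \<le> z \<and> z \<le> y}" if "y \<in> \<Phi> ` P" for y
      using that by (auto simp: I fin)
    show "(\<Sum>z\<in>{z \<in> \<Phi> ` P. \<Phi> w \<le> z \<and> z \<le> y}. moebius P w (the_inv_into P \<Phi> z)) = 0"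
      if "y \<in> \<Phi> ` P" "\<Phi> w < y" for y
    proof -
      obtain y' where y': "y' \<in> P" "y = \<Phi> y'" using \<open>y \<in> \<Phi> ` P\<close> by auto
      have wy: "w < y'" using that(2) iso[OF w y'(1)] iso[OF y'(1) w] unfolding y'(2) by (simp add: less_le_not_le)
      have "(\<Sum>z\<in>{z \<in> \<Phi> ` P. \<Phi> w \<le> z \<and> z \<le> y}. moebius P w (the_inv_into P \<Phi> z)) =
          (\<Sum>u\<in>{u \<in> P. w \<le> u \<and> u \<le> y'}. moebius P w (the_inv_into P \<Phi> (\<Phi> u)))"
        unfolding y'(2) I[OF y'(1)] by (rule sum.reindex_cong[OF inj_on_subset[OF inj]]) auto
      also have "\<dots> = (\<Sum>u\<in>{u \<in> P. w \<le> u \<and> u \<le> y'}. moebius P w u)"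
        using inj by (intro sum.cong) (auto simp: the_inv_into_f_f)
      also have "\<dots> = 0" by (rule sum_moebius_interval[OF y'(1) wy fin[OF y'(1)]])
      finally show ?thesis .
    qed
    show "\<Phi> x \<in> \<Phi> ` P" using x by simp
    show "\<Phi> w \<le> \<Phi> x" using iso[OF w x(1)] x by simp
  qed
  then show ?thesis using inj x by (simp add: the_inv_into_f_f)
qed

lemma finsupp_memD: "\<sigma> \<in> finsupp S d \<Longrightarrow> \<sigma> c \<in> S" "\<sigma> \<in> finsupp S d \<Longrightarrow> finite {c. \<sigma> c \<noteq> d}"
  by (auto simp: finsupp_def)

text \<open>
  An interval in a restricted power of \<open>P\<close>, with base point the least element \<open>d\<close>, is the product of the
  intervals at the points where the upper end is not \<open>d\<close>.
\<close>

lemma finsupp_interval_bij: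
  fixes P :: "'l::order set"
  assumes least: "\<And>l. l \<in> P \<Longrightarrow> d \<le> l" and w: "w \<in> finsupp P d" and x: "x \<in> finsupp P d"
    and d: "d \<in> P" and wx: "w \<le> x"
  defines "A \<equiv> {c. x c \<noteq> d}"
  shows "bij_betw (\<lambda>f c. if c \<in> A then f c else d) (PiE A (\<lambda>c. {y \<in> P. w c \<le> y \<and> y \<le> x c}))
           {y \<in> finsupp P d. w \<le> y \<and> y \<le> x}"
proof (rule bij_betw_byWitness[where f' = "\<lambda>y. restrict y A"])
  have out: "w c = d" "x c = d" if "c \<notin> A" for c
    using that finsupp_memD(1)[OF w, of c] least[of "w c"] le_funD[OF wx, of c] by (auto simp: A_def)
  have fin: "finite A" using x by (auto simp: A_def finsupp_def)
  show "\<forall>f\<in>PiE A (\<lambda>c. {y \<in> P. w c \<le> y \<and> y \<le> x c}). restrict (\<lambda>c. if c \<in> A then f c else d) A = f"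
    by (auto simp: fun_eq_iff PiE_def extensional_def)
  show "\<forall>y\<in>{y \<in> finsupp P d. w \<le> y \<and> y \<le> x}. (\<lambda>c. if c \<in> A then restrict y A c else d) = y"
  proof safe
    fix y assume y: "y \<in> finsupp P d" "y \<le> x"
    have "y c = d" if "c \<notin> A" for c
      using finsupp_memD(1)[OF y(1), of c] least[of "y c"] le_funD[OF y(2), of c] out(2)[OF that] by auto
    then show "(\<lambda>c. if c \<in> A then restrict y A c else d) = y" by auto
  qed
  show "(\<lambda>f c. if c \<in> A then f c else d) ` PiE A (\<lambda>c. {y \<in> P. w c \<le> y \<and> y \<le> x c})
      \<subseteq> {y \<in> finsupp P d. w \<le> y \<and> y \<le> x}"
  proof safe
    fix f assume f: "f \<in> PiE A (\<lambda>c. {y \<in> P. w c \<le> y \<and> y \<le> x c})"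
    show "(\<lambda>c. if c \<in> A then f c else d) \<in> finsupp P d"
      unfolding finsupp_def
    proof (intro CollectI conjI)
      show "range (\<lambda>c. if c \<in> A then f c else d) \<subseteq> P" using f d by (auto dest: PiE_mem)
      show "finite {c. (if c \<in> A then f c else d) \<noteq> d}" by (rule finite_subset[OF _ fin]) auto
    qed
    show "w \<le> (\<lambda>c. if c \<in> A then f c else d)" using f out by (auto simp: le_fun_def dest: PiE_mem)
    show "(\<lambda>c. if c \<in> A then f c else d) \<le> x" using f out by (auto simp: le_fun_def dest: PiE_mem)
  qed
  show "(\<lambda>y. restrict y A) ` {y \<in> finsupp P d. w \<le> y \<and> y \<le> x} \<subseteq> PiE A (\<lambda>c. {y \<in> P. w c \<le> y \<and> y \<le> x c})"
    by (auto simp: le_fun_def finsupp_def)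
qed

text \<open>
  Multiplicativity of the Moebius function: it is the product of the local Moebius functions.
\<close>

lemma moebius_finsupp:
  fixes P :: "'l::order set"
  assumes least: "\<And>l. l \<in> P \<Longrightarrow> d \<le> l" and d: "d \<in> P"
    and fin: "\<And>l. l \<in> P \<Longrightarrow> finite {y \<in> P. y \<le> l}"
    and w: "w \<in> finsupp P d" and x: "x \<in> finsupp P d" and wx: "w \<le> x"
  shows "moebius (finsupp P d) w x = (\<Prod>c | x c \<noteq> d. moebius P (w c) (x c))"
    and "finite {y \<in> finsupp P d. w \<le> y \<and> y \<le> x}"
proof -
  have finI: "finite {y \<in> P. v \<le> y \<and> y \<le> l}" if "l \<in> P" for v l
    by (rule finite_subset[OF _ fin[OF that]]) auto
  have F: "finite {y \<in> finsupp P d. w \<le> y \<and> y \<le> x}" if x: "x \<in> finsupp P d" for x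
  proof (cases "w \<le> x")
    case True
    show ?thesis
    proof -
      have "finite (PiE {c. x c \<noteq> d} (\<lambda>c. {y \<in> P. w c \<le> y \<and> y \<le> x c}))"
        by (rule finite_PiE) (use finsupp_memD[OF x] finI in blast)+
      then show ?thesis using bij_betw_finite[OF finsupp_interval_bij[OF least w x d True]] by simp
    qed
  next
    case False
    then have "{y \<in> finsupp P d. w \<le> y \<and> y \<le> x} = {}" using order_trans by blast
    then show ?thesis by (simp only: finite.emptyI)
  qed
  show "finite {y \<in> finsupp P d. w \<le> y \<and> y \<le> x}" by (rule F[OF x])
  have supp: "(\<Prod>c | y c \<noteq> d. moebius P (w c) (y c)) = (\<Prod>c | x c \<noteq> d. moebius P (w c) (y c))"
    if x: "x \<in> finsupp P d" and y: "y \<in> finsupp P d" "w \<le> y" "y \<le> x" for x y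
  proof (rule prod.mono_neutral_left)
    show "finite {c. x c \<noteq> d}" using x by (simp add: finsupp_def)
    show "{c. y c \<noteq> d} \<subseteq> {c. x c \<noteq> d}"
    proof (rule subsetI, rule ccontr)
      fix c assume "c \<in> {c. y c \<noteq> d}" "c \<notin> {c. x c \<noteq> d}"
      then show False using least[of "y c"] finsupp_memD(1)[OF y(1), of c] le_funD[OF y(3), of c] by auto
    qed
    show "\<forall>c\<in>{c. x c \<noteq> d} - {c. y c \<noteq> d}. moebius P (w c) (y c) = 1"
    proof
      fix c assume "c \<in> {c. x c \<noteq> d} - {c. y c \<noteq> d}"
      then have yc: "y c = d" by simp
      then have "w c = d"
        using least[of "w c"] finsupp_memD(1)[OF w, of c] le_funD[OF y(2), of c] by auto
      then show "moebius P (w c) (y c) = 1" using yc by simp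
    qed
  qed
  show "moebius (finsupp P d) w x = (\<Prod>c | x c \<noteq> d. moebius P (w c) (x c))"
  proof (rule moebius_eqI[OF _ _ _ x wx])
    show "finite {y \<in> finsupp P d. w \<le> y \<and> y \<le> x}" if "x \<in> finsupp P d" for x by (rule F[OF that])
    show "(\<Prod>c | w c \<noteq> d. moebius P (w c) (w c)) = 1" by simp
    fix x assume x: "x \<in> finsupp P d" and wx: "w < x"
    let ?A = "{c. x c \<noteq> d}" and ?I = "\<lambda>c. {y \<in> P. w c \<le> y \<and> y \<le> x c}"
    have wle: "w \<le> x" using wx by simp
    obtain c where c: "w c \<noteq> x c" using wx by (metis ext less_irrefl)
    have cA: "c \<in> ?A"
      using c least[of "w c"] finsupp_memD(1)[OF w, of c] le_funD[OF wle, of c] by auto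
    have A: "finite ?A" using x by (simp add: finsupp_def)
    have "(\<Sum>y\<in>{y \<in> finsupp P d. w \<le> y \<and> y \<le> x}. \<Prod>c | y c \<noteq> d. moebius P (w c) (y c)) =
        (\<Sum>y\<in>{y \<in> finsupp P d. w \<le> y \<and> y \<le> x}. \<Prod>c\<in>?A. moebius P (w c) (y c))"
      using supp[OF x] by (intro sum.cong) auto
    also have "\<dots> = (\<Sum>f\<in>PiE ?A ?I. \<Prod>c\<in>?A. moebius P (w c) (if c \<in> ?A then f c else d))"
      by (rule sum.reindex_bij_betw[OF finsupp_interval_bij[OF least w x d wle], symmetric])
    also have "\<dots> = (\<Sum>f\<in>PiE ?A ?I. \<Prod>c\<in>?A. moebius P (w c) (f c))"
      by (intro sum.cong prod.cong) auto
    also have "\<dots> = (\<Prod>c\<in>?A. \<Sum>y\<in>?I c. moebius P (w c) y)"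
      using A finI finsupp_memD(1)[OF x] by (intro prod_sum_PiE[symmetric]) auto
    also have "\<dots> = 0"
    proof (rule prod_zero[OF A], rule bexI[OF _ cA], rule sum_moebius_interval)
      show "w c < x c" using c le_funD[OF wle, of c] by simp
    qed (use finsupp_memD(1)[OF x] finI in auto)
    finally show "(\<Sum>y\<in>{y \<in> finsupp P d. w \<le> y \<and> y \<le> x}. \<Prod>c | y c \<noteq> d. moebius P (w c) (y c)) = 0" .
  qed
qed

section \<open>Jets: the local saturated elements\<close>

text \<open>
  The maximal elements of \<open>Q - {V}\<close>: \<open>Fst\<close> stands for the first plane, \<open>Snd\<close> for the second and
  \<open>Diag i\<close> for the sum of the two lines with index \<open>i\<close>. Every element of \<open>Q\<close> is the intersection of the
  coatoms above it.
\<close>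

datatype coatom = Fst | Snd | Diag 4

lemma UNIV_coatom: "UNIV = insert Fst (insert Snd (range Diag))"
  by (auto, metis coatom.exhaust rangeI)

instance coatom :: finite
  by standard (simp add: UNIV_coatom)

lemma card_coatom: "card (UNIV :: coatom set) = 6"
proof -
  have "card (range Diag) = 4"
    by (subst card_image) (auto simp: inj_def)
  moreover have "Fst \<notin> range Diag" "Snd \<notin> range Diag" by auto
  ultimately show ?thesis by (simp add: UNIV_coatom)
qed

lemma UNIV_coatom_not_subset:
  "\<not> UNIV \<subseteq> {s, t :: coatom}" "\<not> UNIV \<subseteq> {s :: coatom}"
proof -
  show *: "\<not> UNIV \<subseteq> {s, t :: coatom}" for t
  proof
    assume "UNIV \<subseteq> {s, t}"
    then have "card (UNIV :: coatom set) \<le> card {s, t}" by (intro card_mono) auto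
    also have "\<dots> \<le> 2" by (simp add: card_insert_if)
    finally show False by (simp add: card_coatom)
  qed
  show "\<not> UNIV \<subseteq> {s}" using *[of s] by simp
qed

text \<open>
  The multiplicities at a point of a saturated element, at the six coatoms. Any two diagonal coatoms
  meet in 0, as do \<open>Fst\<close> and \<open>Snd\<close>; compatibility with all other intersections in \<open>Q\<close> follows.
\<close>

definition jets :: "(coatom \<Rightarrow> nat) set" where
  "jets = {m. \<forall>i j. i \<noteq> j \<longrightarrow> min (m (Diag i)) (m (Diag j)) = min (m Fst) (m Snd)}"

text \<open>
  The sets of coatoms above the elements of \<open>Q\<close>. They are encoded as the supports of the jets with
  values 0 and 1; the explicit list of all sixteen is \<open>flags_eq\<close>.
\<close>

definition flags :: "coatom set set" where
  "flags = {S. (\<lambda>s. of_bool (s \<in> S)) \<in> jets}"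

lemma flags_iff: "S \<in> flags \<longleftrightarrow> (\<forall>i j. i \<noteq> j \<longrightarrow> (Diag i \<in> S \<and> Diag j \<in> S \<longleftrightarrow> Fst \<in> S \<and> Snd \<in> S))"
  by (auto simp: flags_def jets_def min_def split: if_splits)

lemma ex_neq_4: "\<exists>j :: 4. j \<noteq> i" 
  by (cases "i = 1") (auto intro: exI[of _ 1] exI[of _ 2])

lemma flags_eq:
  "flags = insert {} (insert UNIV (range (\<lambda>s. {s}) \<union> ((\<lambda>i. {Diag i, Fst}) ` UNIV \<union> (\<lambda>i. {Diag i, Snd}) ` UNIV)))"
  (is "_ = ?R")
proof (intro equalityI subsetI)
  fix S assume "S \<in> flags"
  then have S: "Diag i \<in> S \<and> Diag j \<in> S \<longleftrightarrow> Fst \<in> S \<and> Snd \<in> S" if "i \<noteq> j" for i j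
    using that by (auto simp: flags_iff)
  show "S \<in> ?R"
  proof (cases "Fst \<in> S \<and> Snd \<in> S")
    case True
    then have "Diag i \<in> S" for i using S ex_neq_4[of i] by blast
    with True have "S = UNIV" by (metis (full_types) UNIV_eq_I coatom.exhaust)
    then show ?thesis by blast
  next
    case False
    then have uniq: "i = j" if "Diag i \<in> S" "Diag j \<in> S" for i j using S that by blast
    show ?thesis
    proof (cases "\<exists>i. Diag i \<in> S")
      case True
      then obtain i where i: "Diag i \<in> S" by blast
      have S_eq: "S = insert (Diag i) (S \<inter> {Fst, Snd})"
      proof (intro equalityI subsetI)
        fix s assume "s \<in> S"
        then show "s \<in> insert (Diag i) (S \<inter> {Fst, Snd})" using uniq i by (cases s) auto
      qed (use i in auto)
      have "S \<inter> {Fst, Snd} = {} \<or> S \<inter> {Fst, Snd} = {Fst} \<or> S \<inter> {Fst, Snd} = {Snd}" using False by blast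
      then have "S = {Diag i} \<or> S = {Diag i, Fst} \<or> S = {Diag i, Snd}"
        using S_eq by (elim disjE) simp_all
      then show ?thesis by (metis UnI1 UnI2 insertI2 rangeI)
    next
      case False': False
      then have "S \<subseteq> {Fst, Snd}" by (metis coatom.exhaust insertCI subsetI)
      then have "S = {} \<or> S = {Fst} \<or> S = {Snd}" using False by blast
      then show ?thesis by blast
    qed
  qed
next
  fix S assume "S \<in> ?R"
  then show "S \<in> flags" by (auto simp: flags_iff)
qed

lemma sum_flags:
  fixes f :: "coatom set \<Rightarrow> 'a::comm_monoid_add"
  shows "(\<Sum>S\<in>flags. f S) = f {} + f UNIV + (f {Fst} + f {Snd} + (\<Sum>i\<in>UNIV. f {Diag i})) +
     ((\<Sum>i\<in>UNIV. f {Diag i, Fst}) + (\<Sum>i\<in>UNIV. f {Diag i, Snd}))"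
proof -
  let ?A = "range (\<lambda>s. {s}) :: coatom set set" and ?B = "(\<lambda>i. {Diag i, Fst}) ` UNIV" and ?C = "(\<lambda>i. {Diag i, Snd}) ` UNIV"
  have U: "UNIV \<noteq> {s, t}" "UNIV \<noteq> {s}" for s t :: coatom
    using UNIV_coatom_not_subset(1)[of s t] UNIV_coatom_not_subset(2)[of s] by auto
  have "(\<Sum>S\<in>flags. f S) = f {} + (f UNIV + (sum f ?A + (sum f ?B + sum f ?C)))"
    unfolding flags_eq
    by (subst sum.insert, simp, force, subst sum.insert, simp, use U in blast,
        subst sum.union_disjoint, simp, simp, (auto simp: doubleton_eq_iff)[1], 
        subst sum.union_disjoint) (auto simp: doubleton_eq_iff)
  moreover have "sum f ?A = (\<Sum>s\<in>UNIV. f {s})"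
    by (subst sum.reindex) (auto simp: inj_def)
  moreover have "(\<Sum>s\<in>UNIV. f {s}) = f {Fst} + (f {Snd} + (\<Sum>i\<in>UNIV. f {Diag i}))"
    by (simp add: UNIV_coatom sum.reindex inj_def image_iff)
  moreover have "sum f ?B = (\<Sum>i\<in>UNIV. f {Diag i, Fst})"
    by (subst sum.reindex) (auto simp: inj_def doubleton_eq_iff)
  moreover have "sum f ?C = (\<Sum>i\<in>UNIV. f {Diag i, Snd})"
    by (subst sum.reindex) (auto simp: inj_def doubleton_eq_iff)
  ultimately show ?thesis by (simp add: ac_simps)
qed

text \<open>
  The jet of an element of \<open>Q\<close>: its filtration has one step at this element, followed by \<open>V\<close>.
\<close>

definition flag_jet :: "coatom set \<Rightarrow> coatom \<Rightarrow> nat" where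
  "flag_jet S s = of_bool (s \<in> S)"

text \<open>
  The Moebius function of \<open>Q\<close> between \<open>V\<close> and an element with the coatoms \<open>S\<close> above it; these are
  0, 1, 2 or 6 in number.
\<close>

definition flag_moebius :: "coatom set \<Rightarrow> int" where
  "flag_moebius S = (if S = {} then 1 else if card S = 1 then - 1 else if card S = 2 then 1 else - 3)"

lemma inj_flag_jet: "inj flag_jet"
  by (auto simp: inj_def flag_jet_def fun_eq_iff)

lemma flag_jet_in_jets: "S \<in> flags \<Longrightarrow> flag_jet S \<in> jets"
  by (simp add: flags_def flag_jet_def[abs_def])

lemma finite_coatom_below: "finite {y. y \<le> (m :: coatom \<Rightarrow> nat)}"
proof (rule finite_subset)
  show "{y. y \<le> m} \<subseteq> PiE UNIV (\<lambda>s. {..m s})" by (auto simp: le_fun_def)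
qed (auto intro!: finite_PiE)

lemma finite_jets_below: "finite {y \<in> jets. P y \<and> y \<le> m}"
  by (rule finite_subset[OF _ finite_coatom_below[of m]]) auto

text \<open>
  The filtration attached to a jet: each superlevel set is an element of \<open>Q\<close>.
\<close>

lemma supp_flags:
  assumes "m \<in> jets" shows "{s. n < m s} \<in> flags"
proof -
  have "(n < m (Diag i) \<and> n < m (Diag j)) = (n < m Fst \<and> n < m Snd)" if "i \<noteq> j" for i j
  proof -
    have "min (m (Diag i)) (m (Diag j)) = min (m Fst) (m Snd)" using assms that by (auto simp: jets_def)
    then have "(n < min (m (Diag i)) (m (Diag j))) = (n < min (m Fst) (m Snd))" by simp
    then show ?thesis by simp
  qed
  then show ?thesis by (auto simp: flags_iff)
qed

lemma flag_moebius_simps [simp]: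
  "flag_moebius {} = 1" "flag_moebius {s} = - 1" "flag_moebius UNIV = - 3"
  "flag_moebius {Diag i, Fst} = 1" "flag_moebius {Diag i, Snd} = 1"
proof -
  have "card {Diag i, Fst} = 2" "card {Diag i, Snd} = 2" by auto
  then show "flag_moebius {Diag i, Fst} = 1" "flag_moebius {Diag i, Snd} = 1"
    by (simp_all add: flag_moebius_def)
qed (simp_all add: flag_moebius_def card_coatom)

lemma sum_flag_moebius:
  assumes "T \<in> flags" "T \<noteq> {}"
  shows "(\<Sum>S\<in>flags. if S \<subseteq> T then flag_moebius S else 0) = 0"
proof -
  consider "T = UNIV" | s where "T = {s}" | i where "T = {Diag i, Fst}" | i where "T = {Diag i, Snd}"
    using assms unfolding flags_eq by blast
  then show ?thesis
  proof cases
    case 1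
    then show ?thesis by (simp add: sum_flags)
  next
    case (2 s)
    then show ?thesis by (cases s) (simp_all add: sum_flags UNIV_coatom_not_subset)
  qed (simp_all add: sum_flags UNIV_coatom_not_subset)
qed

lemma sum_delta_swap:
  fixes a :: "'b \<Rightarrow> int"
  assumes "finite B" "finite Y"
  shows "(\<Sum>y\<in>Y. \<Sum>b\<in>B. if y = f b then a b else 0) = (\<Sum>b\<in>B. if f b \<in> Y then a b else 0)"
  by (subst sum.swap) (simp add: assms)

text \<open>
  Summing over the jets below \<open>m\<close> reduces to the flags contained in the support of \<open>m\<close>, so the local
  Moebius function at 0 is that of \<open>Q\<close>.
\<close>

lemma moebius_jets_zero:
  assumes "m \<in> jets"
  shows "moebius jets (\<lambda>_. 0) m = (\<Sum>S\<in>flags. if m = flag_jet S then flag_moebius S else 0)"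
proof (rule moebius_eqI[OF finite_jets_below _ _ assms])
  have "(\<lambda>_. 0) = flag_jet {}" by (simp add: flag_jet_def fun_eq_iff)
  then have "(\<Sum>S\<in>flags. if (\<lambda>_. 0) = flag_jet S then flag_moebius S else 0) =
      (\<Sum>S\<in>flags. if S = {} then flag_moebius S else 0)"
    using inj_flag_jet by (intro sum.cong) (auto simp: inj_def)
  also have "\<dots> = 1" by (simp add: sum.delta flags_eq flag_moebius_def)
  finally show "(\<Sum>S\<in>flags. if (\<lambda>_. 0) = flag_jet S then flag_moebius S else 0) = 1" .
next
  fix x :: "coatom \<Rightarrow> nat" assume x: "x \<in> jets" "(\<lambda>_. 0) < x"
  let ?T = "{s. 0 < x s}"
  have T: "?T \<noteq> {}" using x(2) by (auto simp: less_fun_def le_fun_def)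
  have le: "flag_jet S \<le> x \<longleftrightarrow> S \<subseteq> ?T" for S by (auto simp: le_fun_def flag_jet_def of_bool_def Suc_le_eq)
  have "(\<Sum>y\<in>{y \<in> jets. (\<lambda>_. 0) \<le> y \<and> y \<le> x}. \<Sum>S\<in>flags. if y = flag_jet S then flag_moebius S else 0) =
      (\<Sum>S\<in>flags. if flag_jet S \<in> {y \<in> jets. (\<lambda>_. 0) \<le> y \<and> y \<le> x} then flag_moebius S else 0)"
    by (rule sum_delta_swap) (auto simp: finite_jets_below)
  also have "\<dots> = (\<Sum>S\<in>flags. if S \<subseteq> ?T then flag_moebius S else 0)"
    by (intro sum.cong) (auto simp: flag_jet_in_jets le, auto simp: le_fun_def)
  also have "\<dots> = 0" using supp_flags[OF x(1)] T by (rule sum_flag_moebius)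
  finally show "(\<Sum>y\<in>{y \<in> jets. (\<lambda>_. 0) \<le> y \<and> y \<le> x}. \<Sum>S\<in>flags. if y = flag_jet S then flag_moebius S else 0) = 0" .
qed (auto simp: le_fun_def)

text \<open>
  The local component of an element of \<open>U\<close>: \<open>k\<close> times the point at the coatom \<open>Diag i\<close>.
\<close>

definition diag_jet :: "4 \<Rightarrow> nat \<Rightarrow> coatom \<Rightarrow> nat" where
  "diag_jet i k s = (if s = Diag i then k else 0)"

text \<open>
  The joins of the minimal jets above \<open>diag_jet i k\<close>, for \<open>k > 0\<close>. These raise the multiplicity at \<open>Fst\<close>
  (\<open>b1\<close>), at \<open>Snd\<close> (\<open>b2\<close>) or at \<open>Diag i\<close> (\<open>b3\<close>) by one. Raising both \<open>Fst\<close> and \<open>Snd\<close> puts the first step of the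
  filtration at 0, which raises the other diagonal coatoms as well.
\<close>

definition cube_jet :: "4 \<Rightarrow> nat \<Rightarrow> bool \<times> bool \<times> bool \<Rightarrow> coatom \<Rightarrow> nat" where
  "cube_jet i k = (\<lambda>(b1, b2, b3) s. case s of Fst \<Rightarrow> of_bool b1 | Snd \<Rightarrow> of_bool b2
      | Diag j \<Rightarrow> if j = i then k + of_bool b3 else of_bool (b1 \<and> b2))"

text \<open>
  The Moebius function of the Boolean cube.
\<close>

definition cube_sign :: "bool \<times> bool \<times> bool \<Rightarrow> int" where
  "cube_sign = (\<lambda>(b1, b2, b3). (- 1) ^ (of_bool b1 + of_bool b2 + of_bool b3))"

lemma cube_jet_in_jets: "0 < k \<Longrightarrow> cube_jet i k b \<in> jets"
  by (cases b) (auto simp: jets_def cube_jet_def min_def of_bool_def)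

lemma sum_bool: "(\<Sum>b\<in>UNIV. f b) = f False + f True"
  by (simp add: UNIV_bool ac_simps)

lemma sum_bool3:
  fixes f :: "bool \<times> bool \<times> bool \<Rightarrow> 'a::comm_monoid_add"
  shows "(\<Sum>b\<in>UNIV. f b) = (\<Sum>b1\<in>UNIV. \<Sum>b2\<in>UNIV. \<Sum>b3\<in>UNIV. f (b1, b2, b3))"
  by (simp add: sum.cartesian_product UNIV_Times_UNIV[symmetric] del: UNIV_Times_UNIV)

text \<open>
  The elements of the cube below \<open>x\<close> form a subcube, which is a single point only if \<open>x\<close> is
  \<open>diag_jet i k\<close> itself. For \<open>k = 0\<close> there would be other minimal jets, at the diagonal coatoms other
  than \<open>i\<close>.
\<close>

lemma moebius_jets_diag:
  assumes k: "0 < k" and m: "m \<in> jets" "diag_jet i k \<le> m"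
  shows "moebius jets (diag_jet i k) m = (\<Sum>b\<in>UNIV. if m = cube_jet i k b then cube_sign b else 0)"
proof (rule moebius_eqI[OF finite_jets_below _ _ m])
  have "(diag_jet i k = cube_jet i k b) = (b = (False, False, False))" for b
  proof (cases b)
    case (fields b1 b2 b3)
    have "diag_jet i k = cube_jet i k b \<longleftrightarrow> (\<forall>s. diag_jet i k s = cube_jet i k b s)" by (simp add: fun_eq_iff)
    also have "\<dots> \<longleftrightarrow> \<not> b1 \<and> \<not> b2 \<and> \<not> b3"
    proof
      assume *: "\<forall>s. diag_jet i k s = cube_jet i k b s"
      show "\<not> b1 \<and> \<not> b2 \<and> \<not> b3" using *[rule_format, of Fst] *[rule_format, of Snd] *[rule_format, of "Diag i"]
        by (auto simp: diag_jet_def cube_jet_def fields)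
    qed (auto simp: diag_jet_def cube_jet_def fields split: coatom.splits)
    finally show ?thesis by (simp add: fields)
  qed
  then show "(\<Sum>b\<in>UNIV. if diag_jet i k = cube_jet i k b then cube_sign b else 0) = 1"
    by (simp add: cube_sign_def)
next
  fix x :: "coatom \<Rightarrow> nat" assume x: "x \<in> jets" "diag_jet i k < x"
  then have le: "diag_jet i k \<le> x" by simp
  define h1 h2 h3 where "h1 = (0 < x Fst)" and "h2 = (0 < x Snd)" and "h3 = (k < x (Diag i))"
  have xi: "k \<le> x (Diag i)" using le_funD[OF le, of "Diag i"] by (simp add: diag_jet_def)
  have xj: "min (x Fst) (x Snd) \<le> x (Diag j)" for j
    using x(1) ex_neq_4[of j] unfolding jets_def by (metis (mono_tags, lifting) mem_Collect_eq min.cobounded1)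
  have ne: "h1 \<or> h2 \<or> h3"
  proof (rule ccontr)
    assume n: "\<not> (h1 \<or> h2 \<or> h3)"
    have "x s = diag_jet i k s" for s
    proof (cases s)
      case (Diag j)
      show ?thesis
      proof (cases "j = i")
        case False
        then have "min (x (Diag j)) (x (Diag i)) = min (x Fst) (x Snd)" using x(1) by (auto simp: jets_def)
        then show ?thesis using n k xi False by (auto simp: h1_def h2_def h3_def diag_jet_def Diag min_def split: if_splits)
      qed (use n xi in \<open>auto simp: h3_def diag_jet_def Diag\<close>)
    qed (use n in \<open>auto simp: h1_def h2_def diag_jet_def\<close>)
    then have "x = diag_jet i k" by blast
    then show False using x(2) by simp
  qed
  have mem: "cube_jet i k (b1, b2, b3) \<in> {y \<in> jets. diag_jet i k \<le> y \<and> y \<le> x} \<longleftrightarrow>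
      (b1 \<longrightarrow> h1) \<and> (b2 \<longrightarrow> h2) \<and> (b3 \<longrightarrow> h3)" (is "?L \<longleftrightarrow> ?R") for b1 b2 b3
  proof
    assume ?L
    then have *: "cube_jet i k (b1, b2, b3) s \<le> x s" for s by (auto simp: le_fun_def)
    show ?R using *[of Fst] *[of Snd] *[of "Diag i"] by (auto simp: cube_jet_def h1_def h2_def h3_def)
  next
    assume R: ?R
    have "diag_jet i k s \<le> cube_jet i k (b1, b2, b3) s" for s
      by (cases s) (auto simp: diag_jet_def cube_jet_def)
    moreover have "cube_jet i k (b1, b2, b3) s \<le> x s" for s
    proof (cases s)
      case (Diag j)
      show ?thesis using R xi xj[of j] 
        by (auto simp: cube_jet_def Diag h1_def h2_def h3_def of_bool_def min_def Suc_le_eq split: if_splits)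
    qed (use R in \<open>auto simp: cube_jet_def h1_def h2_def of_bool_def Suc_le_eq\<close>)
    ultimately show ?L using cube_jet_in_jets[OF k] by (auto simp: le_fun_def)
  qed
  have "(\<Sum>y\<in>{y \<in> jets. diag_jet i k \<le> y \<and> y \<le> x}. \<Sum>b\<in>UNIV. if y = cube_jet i k b then cube_sign b else 0) =
      (\<Sum>b\<in>UNIV. if cube_jet i k b \<in> {y \<in> jets. diag_jet i k \<le> y \<and> y \<le> x} then cube_sign b else 0)"
    by (rule sum_delta_swap) (auto simp: finite_jets_below)
  also have "\<dots> = (\<Sum>b1\<in>UNIV. \<Sum>b2\<in>UNIV. \<Sum>b3\<in>UNIV.
      if (b1 \<longrightarrow> h1) \<and> (b2 \<longrightarrow> h2) \<and> (b3 \<longrightarrow> h3) then cube_sign (b1, b2, b3) else 0)"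
    by (simp only: sum_bool3 mem)
  also have "\<dots> = 0" using ne by (cases h1; cases h2; cases h3) (simp_all add: sum_bool cube_sign_def) 
  finally show "(\<Sum>y\<in>{y \<in> jets. diag_jet i k \<le> y \<and> y \<le> x}. \<Sum>b\<in>UNIV. if y = cube_jet i k b then cube_sign b else 0) = 0" .
qed

section \<open>The poset of subspaces and the saturated elements\<close>

text \<open>
  All that is used of the two planes with four lines each: the lines are proper, nonzero and meet
  pairwise in 0.
\<close>

locale two_pencils =
  fixes L1 :: "4 \<Rightarrow> 'v::zero set" and L2 :: "4 \<Rightarrow> 'w::zero set"
  assumes zero1: "0 \<in> L1 i" and zero2: "0 \<in> L2 i"
    and nonzero1: "L1 i \<noteq> {0}" and nonzero2: "L2 i \<noteq> {0}"
    and proper1: "L1 i \<noteq> UNIV" and proper2: "L2 i \<noteq> UNIV"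
    and disjoint1: "i \<noteq> j \<Longrightarrow> L1 i \<inter> L1 j = {0}" and disjoint2: "i \<noteq> j \<Longrightarrow> L2 i \<inter> L2 j = {0}"
begin

text \<open>
  The passage between \<open>Q\<close> and the flags: \<open>flag_space\<close> intersects a set of coatoms and \<open>coatoms_above\<close>
  is its inverse on \<open>flags\<close>.
\<close>

fun coatom_space :: "coatom \<Rightarrow> ('v \<times> 'w) set" where
  "coatom_space Fst = UNIV \<times> {0}"
| "coatom_space Snd = {0} \<times> UNIV"
| "coatom_space (Diag i) = L1 i \<times> L2 i"

definition flag_space :: "coatom set \<Rightarrow> ('v \<times> 'w) set" where
  "flag_space T = (\<Inter>s\<in>T. coatom_space s)"

definition coatoms_above :: "('v \<times> 'w) set \<Rightarrow> coatom set" where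
  "coatoms_above S = {s. S \<subseteq> coatom_space s}"

lemma ex_nonzero1: "\<exists>a\<in>L1 i. a \<noteq> 0" using zero1[of i] nonzero1[of i] by blast
lemma ex_nonzero2: "\<exists>a\<in>L2 i. a \<noteq> 0" using zero2[of i] nonzero2[of i] by blast

lemma flag_space_simps:
  "flag_space {} = UNIV" "flag_space {s} = coatom_space s"
  "flag_space {Diag i, Fst} = L1 i \<times> {0}" "flag_space {Diag i, Snd} = {0} \<times> L2 i"
  using zero1 zero2 by (auto simp: flag_space_def)

lemma flag_space_zero:
  assumes "{Fst, Snd} \<subseteq> T \<or> (\<exists>i j. i \<noteq> j \<and> {Diag i, Diag j} \<subseteq> T)"
  shows "flag_space T = {(0, 0)}"
proof
  have sub: "flag_space T \<subseteq> coatom_space s \<inter> coatom_space t" if "{s, t} \<subseteq> T" for s t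
    using that by (auto simp: flag_space_def)
  have "coatom_space (Diag i) \<inter> coatom_space (Diag j) = {(0, 0)}" if "i \<noteq> j" for i j
    using disjoint1[OF that] disjoint2[OF that] by (simp add: Times_Int_Times)
  moreover have "coatom_space Fst \<inter> coatom_space Snd = {(0, 0)}" by auto
  ultimately show "flag_space T \<subseteq> {(0, 0)}" using assms sub by metis
  have "(0, 0) \<in> coatom_space s" for s by (cases s) (use zero1 zero2 in auto)
  then show "{(0, 0)} \<subseteq> flag_space T" by (auto simp: flag_space_def)
qed

lemma flag_space_pair: "flag_space {s, t} = coatom_space s \<inter> coatom_space t"
  by (auto simp: flag_space_def)

lemma flag_space_UNIV: "flag_space UNIV = {(0, 0)}"
  by (rule flag_space_zero) auto

lemma Qposet_eq: "Qposet L1 L2 = flag_space ` flags"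
proof -
  have "flag_space ` flags = {UNIV, {(0, 0)}} \<union> (coatom_space ` UNIV \<union>
      ((\<lambda>i. L1 i \<times> {0}) ` UNIV \<union> (\<lambda>i. {0} \<times> L2 i) ` UNIV))"
    unfolding flags_eq image_insert image_Un image_image flag_space_simps flag_space_UNIV by auto
  also have "\<dots> = Qposet L1 L2"
  proof -
    have reorder: "{a, b} \<union> (insert c (insert d E) \<union> (F \<union> G)) = {a, c, d, b} \<union> (E \<union> (F \<union> G))"
      for a b c d and E F G :: "('v \<times> 'w) set set" by blast
    have union: "(\<Union>i. {f i, g i, h i}) = range f \<union> (range g \<union> range h)"
      for f g h :: "4 \<Rightarrow> ('v \<times> 'w) set" by blast
    show ?thesis
      unfolding UNIV_coatom image_insert image_image coatom_space.simps Qposet_def union by (rule reorder)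
  qed
  finally show ?thesis by simp
qed

lemma flag_space_Int: "flag_space T \<inter> flag_space T' = flag_space (T \<union> T')"
  by (auto simp: flag_space_def)

lemma Qposet_Int:
  assumes "S \<in> Qposet L1 L2" "S' \<in> Qposet L1 L2" shows "S \<inter> S' \<in> Qposet L1 L2"
proof -
  obtain T T' where T: "T \<in> flags" "T' \<in> flags" "S = flag_space T" "S' = flag_space T'"
    using assms by (auto simp: Qposet_eq)
  show ?thesis
  proof (cases "{Fst, Snd} \<subseteq> T \<union> T' \<or> (\<exists>i j. i \<noteq> j \<and> {Diag i, Diag j} \<subseteq> T \<union> T')")
    case True
    from flag_space_zero[OF this] show ?thesis by (simp add: T flag_space_Int Qposet_def)
  next
    case False
    then have "T \<union> T' \<in> flags" by (auto simp: flags_iff)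
    then show ?thesis by (simp add: T flag_space_Int Qposet_eq)
  qed
qed

lemma coatoms_above_flag_space:
  assumes "T \<in> flags" shows "coatoms_above (flag_space T) = T"
proof -
  have L: "L1 i \<times> L2 i \<subseteq> L1 j \<times> L2 j \<longleftrightarrow> i = j"
       "L1 i \<times> {0} \<subseteq> L1 j \<times> L2 j \<longleftrightarrow> i = j" "{0} \<times> L2 i \<subseteq> L1 j \<times> L2 j \<longleftrightarrow> i = j" for i j
    using ex_nonzero1[of i] ex_nonzero2[of i] disjoint1[of i j] disjoint2[of i j] zero1 zero2 by blast+
  have U: "\<not> UNIV \<times> {0} \<subseteq> L1 i \<times> L2 i" "\<not> {0} \<times> UNIV \<subseteq> L1 i \<times> L2 i" for i
    using proper1[of i] proper2[of i] by blast+
  have V: "\<not> UNIV \<times> {0::'w} \<subseteq> {0::'v} \<times> UNIV" "\<not> {0::'v} \<times> UNIV \<subseteq> UNIV \<times> {0::'w}"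
    using ex_nonzero1 ex_nonzero2 by blast+
  have W: "\<not> L1 i \<times> L2 i \<subseteq> {0} \<times> UNIV" "\<not> L1 i \<times> L2 i \<subseteq> UNIV \<times> {0}"
     "\<not> L1 i \<times> {0::'w} \<subseteq> {0} \<times> UNIV" "\<not> {0::'v} \<times> L2 i \<subseteq> UNIV \<times> {0}" for i
    using ex_nonzero1[of i] ex_nonzero2[of i] zero1[of i] zero2[of i] by blast+
  have N: "\<not> UNIV \<subseteq> L1 i \<times> L2 i" "\<not> UNIV \<subseteq> UNIV \<times> {0::'w}" "\<not> UNIV \<subseteq> {0::'v} \<times> UNIV" for i
    using U V by blast+
  have "s \<in> coatoms_above (flag_space T) \<longleftrightarrow> s \<in> T" for s
  proof -
    consider "T = {}" | "T = UNIV" | t where "T = {t}" | i where "T = {Diag i, Fst}" | i where "T = {Diag i, Snd}"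
      using assms unfolding flags_eq by blast
    then show ?thesis
    proof cases
      case 1
      then show ?thesis by (cases s) (auto simp: coatoms_above_def flag_space_simps N)
    next
      case 2
      then show ?thesis by (cases s) (auto simp: coatoms_above_def flag_space_UNIV zero1 zero2)
    next
      case (3 t)
      then show ?thesis by (cases s; cases t) (simp_all add: coatoms_above_def flag_space_simps L U V W eq_commute)
    next
      case (4 i)
      then show ?thesis by (cases s) (auto simp: coatoms_above_def flag_space_simps L W)
    next
      case (5 i)
      then show ?thesis by (cases s) (auto simp: coatoms_above_def flag_space_simps L W)
    qed
  qed
  then show ?thesis by blast
qed

lemma flag_space_coatoms_above: "S \<in> Qposet L1 L2 \<Longrightarrow> flag_space (coatoms_above S) = S"
  by (auto simp: Qposet_eq coatoms_above_flag_space)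

lemma coatoms_above_in_flags: "S \<in> Qposet L1 L2 \<Longrightarrow> coatoms_above S \<in> flags"
  by (auto simp: Qposet_eq coatoms_above_flag_space)

text \<open>
  The Galois connection between elements of \<open>Q\<close> and sets of coatoms.
\<close>

lemma flag_space_le_iff:
  assumes "S \<in> Qposet L1 L2" "T \<in> flags"
  shows "flag_space T \<subseteq> S \<longleftrightarrow> coatoms_above S \<subseteq> T"
proof
  assume "flag_space T \<subseteq> S"
  then have "coatoms_above S \<subseteq> coatoms_above (flag_space T)" by (auto simp: coatoms_above_def)
  then show "coatoms_above S \<subseteq> T" by (simp add: coatoms_above_flag_space assms)
next
  assume "coatoms_above S \<subseteq> T"
  then have "flag_space T \<subseteq> flag_space (coatoms_above S)" by (auto simp: flag_space_def)
  then show "flag_space T \<subseteq> S" by (simp add: flag_space_coatoms_above assms)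
qed

lemma coatoms_above_empty: "S \<in> Qposet L1 L2 \<Longrightarrow> coatoms_above S = {} \<longleftrightarrow> S = UNIV"
  using flag_space_coatoms_above[of S] coatoms_above_flag_space[of "{}"]
  by (auto simp: flag_space_simps flags_eq)

lemma coatom_space_in_Q: "coatom_space s \<in> Qposet L1 L2"
  by (cases s) (auto simp: Qposet_def)

lemma coatoms_above_coatom: "coatoms_above (coatom_space s) = {s}"
  using coatoms_above_flag_space[of "{s}"] by (auto simp: flag_space_simps flags_eq)

lemma coatom_space_neq_UNIV: "coatom_space s \<noteq> UNIV"
  using coatoms_above_empty[OF coatom_space_in_Q, of s] by (simp add: coatoms_above_coatom)

lemma UNIV_in_Q: "UNIV \<in> Qposet L1 L2" by (simp add: Qposet_def)

text \<open>
  The multiplicity at \<open>S\<close> is the minimum over the coatoms above \<open>S\<close>. It exceeds \<open>n\<close> if and only if \<open>S\<close>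
  contains the step of the filtration given by the superlevel set of \<open>n\<close>. This turns the compatibility
  with intersections into a triviality.
\<close>

lemma le_Min_coatoms:
  assumes "S \<in> Qposet L1 L2" "S \<noteq> UNIV" "m \<in> jets"
  shows "n < Min (m ` coatoms_above S) \<longleftrightarrow> flag_space {s. n < m s} \<subseteq> S"
proof -
  have "n < Min (m ` coatoms_above S) \<longleftrightarrow> coatoms_above S \<subseteq> {s. n < m s}"
    using coatoms_above_empty[OF assms(1)] assms(2) by (subst Min_gr_iff) auto
  also have "\<dots> \<longleftrightarrow> flag_space {s. n < m s} \<subseteq> S"
    using flag_space_le_iff[OF assms(1) supp_flags[OF assms(3)]] by simp
  finally show ?thesis .
qed

text \<open>
  A saturated element is a finitely supported family of jets.
\<close>

abbreviation saturated :: "('c \<Rightarrow> coatom \<Rightarrow> nat) set" where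
  "saturated \<equiv> finsupp jets (\<lambda>_. 0)"

text \<open>
  The divisor at \<open>S\<close> of the saturated element with the jets \<open>m\<close>, for \<open>S \<noteq> V\<close>, and the saturated element.
\<close>

definition jet_div :: "('c \<Rightarrow> coatom \<Rightarrow> nat) \<Rightarrow> ('v \<times> 'w) set \<Rightarrow> 'c multiset" where
  "jet_div m S = Abs_multiset (\<lambda>c. Min (m c ` coatoms_above S))"

definition of_jets :: "('c \<Rightarrow> coatom \<Rightarrow> nat) \<Rightarrow> ('v \<times> 'w) set \<Rightarrow> 'c subscheme" where
  "of_jets m = (\<lambda>S\<in>Qposet L1 L2. if S = UNIV then Whole else Div (jet_div m S))"

lemma saturatedD: "m \<in> saturated \<Longrightarrow> m c \<in> jets" "m \<in> saturated \<Longrightarrow> finite {c. m c \<noteq> (\<lambda>_. 0)}"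
  by (auto simp: finsupp_def)

lemma count_jet_div:
  assumes m: "m \<in> saturated" and S: "S \<in> Qposet L1 L2" "S \<noteq> UNIV"
  shows "count (jet_div m S) c = Min (m c ` coatoms_above S)"
proof -
  have "{c. 0 < Min (m c ` coatoms_above S)} \<subseteq> {c. m c \<noteq> (\<lambda>_. 0)}"
  proof
    fix c assume c: "c \<in> {c. 0 < Min (m c ` coatoms_above S)}"
    obtain s where "s \<in> coatoms_above S" using coatoms_above_empty[OF S(1)] S(2) by blast
    then have "Min (m c ` coatoms_above S) \<le> m c s" by (intro Min_le) auto
    with c show "c \<in> {c. m c \<noteq> (\<lambda>_. 0)}" by auto
  qed
  then have "finite {c. 0 < Min (m c ` coatoms_above S)}" using saturatedD(2)[OF m] finite_subset by blast
  then show ?thesis by (simp add: jet_div_def count_Abs_multiset)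
qed

lemma of_jets_UNIV: "of_jets m UNIV = Whole"
  by (simp add: of_jets_def UNIV_in_Q)

lemma of_jets_eq_Div: "S \<in> Qposet L1 L2 \<Longrightarrow> S \<noteq> UNIV \<Longrightarrow> of_jets m S = Div (jet_div m S)"
  by (simp add: of_jets_def)

lemma count_jet_div_coatom:
  "m \<in> saturated \<Longrightarrow> count (jet_div m (coatom_space s)) c = m c s"
  using count_jet_div[OF _ coatom_space_in_Q coatom_space_neq_UNIV, of m s c] by (simp add: coatoms_above_coatom)

lemma of_jets_le_iff:
  assumes "m \<in> saturated" "m' \<in> saturated"
  shows "of_jets m \<le> of_jets m' \<longleftrightarrow> m \<le> m'"
proof
  assume le: "of_jets m \<le> of_jets m'"
  have "m c s \<le> m' c s" for c s
  proof -
    have "jet_div m (coatom_space s) \<subseteq># jet_div m' (coatom_space s)"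
      using le_funD[OF le, of "coatom_space s"] coatom_space_in_Q[of s] coatom_space_neq_UNIV[of s]
      by (simp add: of_jets_eq_Div)
    then show ?thesis using count_jet_div_coatom assms by (metis mset_subset_eq_count)
  qed
  then show "m \<le> m'" by (auto simp: le_fun_def)
next
  assume le: "m \<le> m'"
  show "of_jets m \<le> of_jets m'"
  proof (rule le_funI)
    fix S
    consider "S \<notin> Qposet L1 L2" | "S = UNIV" | "S \<in> Qposet L1 L2" "S \<noteq> UNIV" by blast
    then show "of_jets m S \<le> of_jets m' S"
    proof cases
      case 3
      have "jet_div m S \<subseteq># jet_div m' S"
        unfolding subseteq_mset_def count_jet_div[OF assms(1) 3] count_jet_div[OF assms(2) 3]
      proof
        fix c
        have ne: "coatoms_above S \<noteq> {}" using coatoms_above_empty[OF 3(1)] 3(2) by simp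
        show "Min (m c ` coatoms_above S) \<le> Min (m' c ` coatoms_above S)"
        proof (rule Min.boundedI)
          fix a assume "a \<in> m' c ` coatoms_above S"
          then obtain s where s: "s \<in> coatoms_above S" "a = m' c s" by auto
          have "Min (m c ` coatoms_above S) \<le> m c s" using s by (intro Min_le) auto
          also have "\<dots> \<le> a" using le by (simp add: s le_fun_def)
          finally show "Min (m c ` coatoms_above S) \<le> a" .
        qed (use ne in auto)
      qed
      then show ?thesis using 3 by (simp add: of_jets_eq_Div)
    qed (auto simp: of_jets_UNIV of_jets_def)
  qed
qed

lemma of_jets_in_QJB:
  fixes m :: "'k::field closed_point \<Rightarrow> coatom \<Rightarrow> nat"
  assumes m: "m \<in> saturated"
  shows "of_jets m \<in> QJB L1 L2"
proof -
  have Int: "of_jets m (S \<inter> T) = inf (of_jets m S) (of_jets m T)"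
    if S: "S \<in> Qposet L1 L2" and T: "T \<in> Qposet L1 L2" for S T
  proof (cases "S = UNIV \<or> T = UNIV")
    case True
    then show ?thesis by (cases "of_jets m S"; cases "of_jets m T") (auto simp: of_jets_UNIV)
  next
    case False
    then have ST: "S \<inter> T \<noteq> UNIV" by blast
    have "count (jet_div m (S \<inter> T)) c = count (jet_div m S \<inter># jet_div m T) c" for c
    proof -
      have "n < count (jet_div m (S \<inter> T)) c \<longleftrightarrow> n < count (jet_div m S \<inter># jet_div m T) c" for n
        using False by (simp add: count_jet_div[OF m] le_Min_coatoms S T Qposet_Int ST saturatedD(1)[OF m])
      then show ?thesis by (metis linorder_neqE_nat less_irrefl)
    qed
    then have "jet_div m (S \<inter> T) = jet_div m S \<inter># jet_div m T" by (rule multiset_eqI)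
    then show ?thesis using False ST by (simp add: of_jets_eq_Div S T Qposet_Int)
  qed
  have mono: "mono_on (Qposet L1 L2) (of_jets m)"
  proof (rule mono_onI)
    fix S T assume *: "S \<in> Qposet L1 L2" "T \<in> Qposet L1 L2" "S \<le> T"
    then have "of_jets m S = inf (of_jets m S) (of_jets m T)" using Int[of S T] by (simp add: Int_absorb2)
    then show "of_jets m S \<le> of_jets m T" by (metis inf.cobounded2)
  qed
  have "of_jets m S \<noteq> Whole" if "S \<in> Qposet L1 L2" "S \<noteq> UNIV" for S
    using that by (simp add: of_jets_def)
  moreover have "of_jets m \<in> Qposet L1 L2 \<rightarrow>\<^sub>E UNIV" by (simp add: of_jets_def)
  ultimately show ?thesis using Int mono by (auto simp: QJB_def of_jets_UNIV)
qed

lemma Min_jet_UNIV: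
  assumes "m \<in> jets" shows "Min (range m) = min (m Fst) (m Snd)"
proof (rule Min_eqI)
  fix y assume "y \<in> range m"
  then obtain s where s: "y = m s" by auto
  show "min (m Fst) (m Snd) \<le> y"
  proof (cases s)
    case (Diag i)
    obtain j where "j \<noteq> i" using ex_neq_4 by blast
    then have "min (m (Diag i)) (m (Diag j)) = min (m Fst) (m Snd)" using assms by (auto simp: jets_def)
    then show ?thesis using s Diag by (metis min.cobounded1)
  qed (simp_all add: s)
qed (auto simp: min_def)

text \<open>
  Together with \<open>of_jets_le_iff\<close>, this identifies the poset of saturated elements with the finitely
  supported families of jets.
\<close>

lemma QJB_eq: "(QJB L1 L2 :: (_ \<Rightarrow> 'k::field closed_point subscheme) set) = of_jets ` saturated"
proof (intro equalityI subsetI)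
  fix x :: "('v \<times> 'w) set \<Rightarrow> 'k closed_point subscheme" assume x: "x \<in> QJB L1 L2"
  have "\<exists>D. x (coatom_space s) = Div D" for s
    using x coatom_space_in_Q coatom_space_neq_UNIV unfolding QJB_def by (cases "x (coatom_space s)") auto
  then obtain E where E: "\<And>s. x (coatom_space s) = Div (E s)" by metis
  have Int: "x (coatom_space s \<inter> coatom_space t) = Div (E s \<inter># E t)" for s t
    using x coatom_space_in_Q E by (auto simp: QJB_def)
  define m where "m c s = count (E s) c" for c s
  have mj: "m c \<in> jets" for c
  proof -
    have "E (Diag i) \<inter># E (Diag j) = E Fst \<inter># E Snd" if "i \<noteq> j" for i j
    proof -
      have "flag_space {Diag i, Diag j} = {(0, 0)}" using that by (intro flag_space_zero) blast
      moreover have "flag_space {Fst, Snd} = {(0, 0)}" by (intro flag_space_zero) blast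
      ultimately have "Div (E (Diag i) \<inter># E (Diag j)) = Div (E Fst \<inter># E Snd)"
        using Int[of "Diag i" "Diag j"] Int[of Fst Snd] by (simp only: flag_space_pair)
      then show ?thesis by simp
    qed
    then have "count (E (Diag i) \<inter># E (Diag j)) c = count (E Fst \<inter># E Snd) c" if "i \<noteq> j" for i j
      using that by simp
    then show ?thesis by (auto simp: jets_def m_def)
  qed
  have "{c. m c \<noteq> (\<lambda>_. 0)} \<subseteq> (\<Union>s. set_mset (E s))"
    by (auto simp: m_def fun_eq_iff)
  then have m: "m \<in> saturated" using mj by (auto simp: finsupp_def intro: finite_subset)
  have "x S = of_jets m S" for S
  proof -
    consider "S \<notin> Qposet L1 L2" | "S = UNIV" | "S \<in> Qposet L1 L2" "S \<noteq> UNIV" by blast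
    then show ?thesis
    proof cases
      case 1
      then show ?thesis using x by (auto simp: QJB_def of_jets_def PiE_def extensional_def)
    next
      case 2
      then show ?thesis using x by (auto simp: QJB_def of_jets_UNIV)
    next
      case 3
      define D where "D = jet_div m S"
      have D: "of_jets m S = Div D" "count D c = Min (m c ` coatoms_above S)" for c
        using 3 by (simp_all add: D_def of_jets_eq_Div count_jet_div[OF m])
      obtain T where T: "T \<in> flags" "S = flag_space T" using 3(1) by (auto simp: Qposet_eq)
      have "coatoms_above S = T" using T by (simp add: coatoms_above_flag_space)
      have pair: "x S = Div D" if "T = {s, t}" for s t
      proof -
        have "x S = Div (E s \<inter># E t)" using that Int[of s t] by (simp only: T(2) flag_space_pair)
        moreover have "E s \<inter># E t = D"
          using that \<open>coatoms_above S = T\<close> by (intro multiset_eqI) (simp add: D m_def)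
        ultimately show ?thesis by simp
      qed
      consider "T = {}" | "T = UNIV" | t where "T = {t}" | i where "T = {Diag i, Fst}" | i where "T = {Diag i, Snd}"
        using T(1) unfolding flags_eq by blast
      then have "x S = Div D"
      proof cases
        case 1
        then show ?thesis using T 3 by (simp add: flag_space_simps)
      next
        case 2
        have "flag_space {Fst, Snd} = {(0, 0)}" by (intro flag_space_zero) blast
        then have "x S = Div (E Fst \<inter># E Snd)"
          using Int[of Fst Snd] by (simp only: T(2) 2 flag_space_UNIV flag_space_pair)
        moreover have "E Fst \<inter># E Snd = D"
          using 2 \<open>coatoms_above S = T\<close> Min_jet_UNIV[OF mj] by (intro multiset_eqI) (simp add: D, simp add: m_def)
        ultimately show ?thesis by simp
      next
        case (3 t)
        then show ?thesis by (intro pair[of t t]) simp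
      qed (use pair in auto)
      then show ?thesis by (simp add: D)
    qed
  qed
  then have "x = of_jets m" by blast
  then show "x \<in> of_jets ` saturated" using m by blast
next
  fix x :: "('v \<times> 'w) set \<Rightarrow> 'k closed_point subscheme" assume "x \<in> of_jets ` saturated"
  then show "x \<in> QJB L1 L2" using of_jets_in_QJB by blast
qed

text \<open>
  The jets of an element of \<open>U\<close>.
\<close>

definition diag_jets :: "(4 \<Rightarrow> 'c multiset) \<Rightarrow> 'c \<Rightarrow> coatom \<Rightarrow> nat" where
  "diag_jets w c s = (case s of Diag i \<Rightarrow> count (w i) c | _ \<Rightarrow> 0)"

lemma to_QJB_eq: "to_QJB L1 L2 w = of_jets (diag_jets w)"
proof
  fix S
  have THE: "(THE i. L1 j \<times> L2 j = L1 i \<times> L2 i) = j" for j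
  proof (rule the_equality)
    fix i assume "L1 j \<times> L2 j = L1 i \<times> L2 i"
    then have "coatom_space (Diag j) = coatom_space (Diag i)" by simp
    then have "{Diag j} = {Diag i}" using coatoms_above_coatom by metis
    then show "i = j" by simp
  qed simp
  show "to_QJB L1 L2 w S = of_jets (diag_jets w) S"
  proof (cases "S \<in> Qposet L1 L2 \<and> S \<noteq> UNIV")
    case False
    then show ?thesis by (auto simp: to_QJB_def of_jets_def UNIV_in_Q)
  next
    case True
    then have S: "S \<in> Qposet L1 L2" "S \<noteq> UNIV" by auto
    show ?thesis
    proof (cases "\<exists>i. S = L1 i \<times> L2 i")
      case True
      then obtain i where i: "S = L1 i \<times> L2 i" by blast
      then have ca: "coatoms_above S = {Diag i}" using coatoms_above_coatom[of "Diag i"] by simp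
      have eq: "jet_div (diag_jets w) S = w i"
        by (simp add: jet_div_def ca) (simp add: diag_jets_def count_inverse)
      have "to_QJB L1 L2 w S = Div (w (THE j. S = L1 j \<times> L2 j))" using S True by (simp add: to_QJB_def)
      then have "to_QJB L1 L2 w S = Div (w i)" by (simp only: i THE)
      then show ?thesis using S eq by (simp add: of_jets_eq_Div)
    next
      case False
      have "Min (diag_jets w c ` coatoms_above S) = 0" for c
      proof -
        have "\<exists>s\<in>coatoms_above S. s = Fst \<or> s = Snd"
        proof (rule ccontr)
          assume n: "\<not> ?thesis"
          have "coatoms_above S \<in> flags" by (rule coatoms_above_in_flags[OF S(1)])
          moreover have "coatoms_above S \<noteq> {}" using coatoms_above_empty[OF S(1)] S(2) by simp
          ultimately obtain i where "coatoms_above S = {Diag i}"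
            using n unfolding flags_eq by (elim insertE UnE imageE) (auto, metis coatom.exhaust)
          then have "S = coatom_space (Diag i)" using flag_space_coatoms_above[OF S(1)] by (simp only: flag_space_simps)
          then have "S = L1 i \<times> L2 i" by simp
          then show False using False by blast
        qed
        then have "0 \<in> diag_jets w c ` coatoms_above S" by (force simp: diag_jets_def)
        then have "Min (diag_jets w c ` coatoms_above S) \<le> 0" by (intro Min_le) simp_all
        then show ?thesis by simp
      qed
      moreover have "Abs_multiset (\<lambda>_. 0) = {#}" by (simp add: zero_multiset_def)
      moreover have "to_QJB L1 L2 w S = Div {#}" using S False by (simp add: to_QJB_def)
      ultimately show ?thesis using S by (simp add: of_jets_eq_Div jet_div_def)
    qed
  qed
qed

end


section \<open>Closed points and geometric points\<close>

text \<open>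
  Evaluation of a polynomial over \<open>k\<close> at an element of the algebraic closure; a ring homomorphism.
\<close>

definition ac_eval :: "'k::field poly \<Rightarrow> 'k alg_closure \<Rightarrow> 'k alg_closure" where
  "ac_eval p z = poly (map_poly to_ac p) z"

lemma coeff_map_poly_ac [simp]: "Polynomial.coeff (map_poly to_ac p) n = to_ac (Polynomial.coeff p n)"
  by (simp add: coeff_map_poly)

lemma ac_eval_pCons [simp]: "ac_eval (pCons a p) z = to_ac a + z * ac_eval p z"
  by (simp add: ac_eval_def map_poly_pCons)

lemma ac_eval_0 [simp]: "ac_eval 0 z = 0" by (simp add: ac_eval_def)

lemma ac_eval_add [simp]: "ac_eval (p + q) z = ac_eval p z + ac_eval q z"
  by (induction p q rule: poly_induct2) (simp_all add: algebra_simps)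

lemma ac_eval_smult [simp]: "ac_eval (Polynomial.smult a p) z = to_ac a * ac_eval p z"
  by (induction p) (simp_all add: algebra_simps)

lemma ac_eval_mult [simp]: "ac_eval (p * q) z = ac_eval p z * ac_eval q z"
  by (induction p) (simp_all add: algebra_simps)

lemma map_poly_ac_pderiv: "pderiv (map_poly to_ac p) = map_poly to_ac (pderiv p)"
  by (rule poly_eqI) (simp add: coeff_pderiv)

lemma degree_map_poly_ac: "Polynomial.degree (map_poly to_ac p) = Polynomial.degree p"
  by (rule degree_map_poly) simp

lemma map_poly_ac_eq_0_iff: "map_poly to_ac p = 0 \<longleftrightarrow> p = 0"
  by (metis coeff_map_poly_ac leading_coeff_0_iff poly_eqI coeff_0 to_ac_eq_0_iff)

lemma min_degree_dvd_of_root: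
  fixes p g :: "'k::field poly"
  assumes p: "p \<noteq> 0" "ac_eval p z = 0"
    and min: "\<And>h. h \<noteq> 0 \<Longrightarrow> ac_eval h z = 0 \<Longrightarrow> Polynomial.degree p \<le> Polynomial.degree h"
    and g: "ac_eval g z = 0"
  shows "p dvd g"
proof (rule ccontr)
  assume "\<not> p dvd g"
  then have m: "g mod p \<noteq> 0" by (simp add: mod_eq_0_iff_dvd)
  have "ac_eval g z = ac_eval (g div p * p + g mod p) z" by (simp only: div_mult_mod_eq)
  then have "ac_eval g z = ac_eval (g div p) z * ac_eval p z + ac_eval (g mod p) z"
    by (simp only: ac_eval_add ac_eval_mult)
  then have "ac_eval (g mod p) z = 0" using g p by simp
  from min[OF m this] degree_mod_less'[OF p(1) m] show False by simp
qed

lemma ex_min_degree: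
  fixes g :: "'k::field poly"
  assumes "g \<noteq> 0" "ac_eval g z = 0"
  obtains p :: "'k poly" where "p \<noteq> 0" "ac_eval p z = 0"
    "\<forall>h. h \<noteq> 0 \<longrightarrow> ac_eval h z = 0 \<longrightarrow> Polynomial.degree p \<le> Polynomial.degree h"
proof -
  have "\<exists>p. (p \<noteq> 0 \<and> ac_eval p z = 0) \<and>
      (\<forall>h. h \<noteq> 0 \<and> ac_eval h z = 0 \<longrightarrow> Polynomial.degree p \<le> Polynomial.degree h)"
    using ex_has_least_nat[of "\<lambda>p. p \<noteq> 0 \<and> ac_eval p z = 0" g Polynomial.degree] assms by blast
  then show ?thesis using that by blast
qed

lemma not_unit_of_root:
  assumes "(p :: 'k::field poly) \<noteq> 0" "ac_eval p z = 0"
  shows "\<not> is_unit p"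
proof
  assume "is_unit p"
  then obtain r where r: "p * r = 1" by (metis dvdE)
  have "ac_eval (p * r) z = ac_eval 1 z" by (simp only: r)
  moreover have "ac_eval 1 z = 1" by (simp add: one_pCons)
  ultimately show False using assms by simp
qed

text \<open>
  An irreducible polynomial is, up to a unit, the minimal polynomial of each of its roots.
\<close>

lemma irreducible_dvd_of_root:
  fixes f g :: "'k::field poly"
  assumes f: "Factorial_Ring.irreducible f" "ac_eval f z = 0" and g: "ac_eval g z = 0"
  shows "f dvd g"
proof -
  have "f \<noteq> 0" using f(1) by auto
  then obtain p where p: "p \<noteq> 0" "ac_eval p z = 0"
      "\<forall>h. h \<noteq> 0 \<longrightarrow> ac_eval h z = 0 \<longrightarrow> Polynomial.degree p \<le> Polynomial.degree h"
    using ex_min_degree f(2) by blast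
  have "p dvd f" "p dvd g" using p min_degree_dvd_of_root f(2) g by blast+
  moreover have "\<not> is_unit p" using not_unit_of_root p by blast
  ultimately have "f dvd p" using f(1) by (metis Factorial_Ring.irreducible_altdef)
  then show ?thesis using \<open>p dvd g\<close> dvd_trans by blast
qed

lemma monic_dvd_antisym:
  fixes f g :: "'k::field poly"
  assumes "Polynomial.lead_coeff f = 1" "Polynomial.lead_coeff g = 1" "f dvd g" "g dvd f"
  shows "f = g"
proof -
  have nz: "f \<noteq> 0" "g \<noteq> 0" using assms by auto
  obtain h where h: "g = f * h" using assms(3) by (elim dvdE)
  have "h \<noteq> 0" using h nz by auto
  moreover have "Polynomial.degree f = Polynomial.degree g"
    using assms(3,4) nz by (intro antisym dvd_imp_degree_le)
  ultimately have "Polynomial.degree h = 0" using nz by (simp add: h degree_mult_eq)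
  then obtain a where a: "h = [:a:]" by (rule degree_eq_zeroE)
  then show ?thesis using assms(1,2) h by (cases "a = 0") auto
qed

lemma irreducible_smult:
  fixes f :: "'k::field poly"
  assumes "a \<noteq> 0" "Factorial_Ring.irreducible f"
  shows "Factorial_Ring.irreducible (Polynomial.smult a f)"
proof (rule Factorial_Ring.irreducibleI)
  show "Polynomial.smult a f \<noteq> 0" using assms by auto
  show "\<not> is_unit (Polynomial.smult a f)" using assms by (metis Factorial_Ring.irreducible_not_unit dvd_smult_cancel dvd_trans smult_dvd_cancel)
  fix b c assume "Polynomial.smult a f = b * c"
  then have "f = Polynomial.smult (inverse a) b * c" using assms(1) by (metis smult_smult mult_smult_left left_inverse smult_1_left)
  then have "is_unit (Polynomial.smult (inverse a) b) \<or> is_unit c" using assms(2) Factorial_Ring.irreducibleD by blast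
  then show "is_unit b \<or> is_unit c" using smult_dvd_cancel by blast
qed

lemma ex_irreducible_root:
  fixes z :: "'k::field alg_closure"
  obtains f :: "'k poly" where "Factorial_Ring.irreducible f" "Polynomial.lead_coeff f = 1" "ac_eval f z = 0"
proof -
  obtain g :: "'k poly" where g: "g \<noteq> 0" "poly (map_poly to_ac g) z = 0" by (rule alg_closure_algebraic)
  then have "ac_eval g z = 0" by (simp add: ac_eval_def)
  then obtain p :: "'k poly" where p: "p \<noteq> 0" "ac_eval p z = 0"
      "\<forall>h. h \<noteq> 0 \<longrightarrow> ac_eval h z = 0 \<longrightarrow> Polynomial.degree p \<le> Polynomial.degree h"
    using ex_min_degree g(1) by blast
  have "Factorial_Ring.irreducible p"
  proof (rule Factorial_Ring.irreducibleI)
    show "\<not> is_unit p" using not_unit_of_root p by blast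
    fix a b assume ab: "p = a * b"
    then have nz: "a \<noteq> 0" "b \<noteq> 0" using p(1) by auto
    have deg: "Polynomial.degree p = Polynomial.degree a + Polynomial.degree b"
      using nz by (simp add: ab degree_mult_eq)
    have "ac_eval a z = 0 \<or> ac_eval b z = 0" using p(2) by (simp add: ab)
    then show "is_unit a \<or> is_unit b"
      using p(3) nz deg by (auto simp: is_unit_iff_degree)
  qed (use p in auto)
  then have "Factorial_Ring.irreducible (Polynomial.smult (inverse (Polynomial.lead_coeff p)) p)"
    by (intro irreducible_smult) (use p in auto)
  then show ?thesis by (rule that) (use p in auto)
qed

lemma finite_field_root_CHAR:
  fixes c :: "'k::{field,finite}"
  shows "\<exists>d. d ^ CHAR('k) = c"
proof -
  have pr: "Factorial_Ring.prime CHAR('k)" using prime_CHAR_semidom[where ?'a = 'k] finite_imp_CHAR_pos[where ?'a = 'k] by simp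
  have "inj (\<lambda>d :: 'k. d ^ CHAR('k))"
  proof (rule injI)
    fix a b :: 'k assume ab: "a ^ CHAR('k) = b ^ CHAR('k)"
    have "(a - b) ^ CHAR('k) + b ^ CHAR('k) = ((a - b) + b) ^ CHAR('k)"
      by (rule freshmans_dream[symmetric]) (use pr in auto)
    then have "(a - b) ^ CHAR('k) = 0" using ab by simp
    then show "a = b" by simp
  qed
  then have "surj (\<lambda>d :: 'k. d ^ CHAR('k))" by (rule finite_UNIV_inj_surj[OF finite])
  then show ?thesis by (metis surjD)
qed

text \<open>
  Separability. If the derivative vanished, \<open>f\<close> would be a polynomial in the \<open>p\<close>-th power of the variable
  and, since every coefficient is a \<open>p\<close>-th power, \<open>f\<close> would itself be a \<open>p\<close>-th power.
\<close>

lemma irreducible_pderiv_neq_0: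
  fixes f :: "'k::{field,finite} poly"
  assumes f: "Factorial_Ring.irreducible f"
  shows "pderiv f \<noteq> 0"
proof
  assume d0: "pderiv f = 0"
  define p where "p = CHAR('k)"
  have pr: "Factorial_Ring.prime p"
    using prime_CHAR_semidom[where ?'a = 'k] finite_imp_CHAR_pos[where ?'a = 'k] by (simp add: p_def)
  have p2: "p \<ge> 2" using pr by (rule prime_ge_2_nat)
  have dvd: "p dvd i" if "Polynomial.coeff f i \<noteq> 0" for i
  proof (cases i)
    case (Suc n)
    have "Polynomial.coeff (pderiv f) n = 0" using d0 by simp
    then have "of_nat i = (0 :: 'k)" using that by (simp add: coeff_pderiv Suc del: of_nat_Suc)
    then show ?thesis by (simp add: of_nat_eq_0_iff_char_dvd p_def)
  qed simp
  obtain r :: "'k \<Rightarrow> 'k" where r: "\<And>c. r c ^ p = c"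
    using finite_field_root_CHAR[where ?'k = 'k] unfolding p_def by metis
  define n where "n = Polynomial.degree f"
  define g where "g = (\<Sum>j\<le>n. Polynomial.monom (r (Polynomial.coeff f (p * j))) j)"
  have "g ^ p = (\<Sum>j\<le>n. Polynomial.monom (r (Polynomial.coeff f (p * j))) j ^ p)"
    unfolding g_def by (rule freshmans_dream_sum) (use pr in \<open>simp_all add: p_def\<close>)
  also have "\<dots> = (\<Sum>j\<le>n. Polynomial.monom (Polynomial.coeff f (p * j)) (p * j))"
    by (simp add: monom_power r mult.commute)
  also have "\<dots> = f"
  proof (rule poly_eqI)
    fix i
    have "Polynomial.coeff (\<Sum>j\<le>n. Polynomial.monom (Polynomial.coeff f (p * j)) (p * j)) i =
        (\<Sum>j\<le>n. if p * j = i then Polynomial.coeff f i else 0)"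
      unfolding coeff_sum by (intro sum.cong) (auto simp: coeff_monom)
    also have "\<dots> = Polynomial.coeff f i"
    proof (cases "Polynomial.coeff f i = 0")
      case False
      then obtain j where j: "i = p * j" using dvd by blast
      have "i \<le> n" using False unfolding n_def by (rule le_degree)
      moreover have "j \<le> p * j" using p2 by simp
      ultimately have "j \<le> n" using j by linarith
      have "(\<Sum>j'\<le>n. if p * j' = i then Polynomial.coeff f i else 0) = (\<Sum>j'\<le>n. if j' = j then Polynomial.coeff f i else 0)"
        using p2 by (intro sum.cong) (auto simp: j)
      then show ?thesis using \<open>j \<le> n\<close> by simp
    qed (auto intro!: sum.neutral)
    finally show "Polynomial.coeff (\<Sum>j\<le>n. Polynomial.monom (Polynomial.coeff f (p * j)) (p * j)) i = Polynomial.coeff f i" .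
  qed
  finally have gp: "g ^ p = f" .
  obtain m where m: "p = Suc (Suc m)" using p2 by (metis add_2_eq_Suc le_Suc_ex)
  have "f = g * g ^ Suc m" using gp by (simp add: m)
  then have "is_unit g \<or> is_unit (g ^ Suc m)" using f Factorial_Ring.irreducibleD by blast
  then have "is_unit g" using dvd_mult_left[of g "g ^ m" 1] by auto
  then have "is_unit f" using gp by (metis is_unit_power_iff)
  then show False using f by (simp add: Factorial_Ring.irreducible_def)
qed

lemma irreducible_order_root:
  fixes f :: "'k::{field,finite} poly"
  assumes f: "Factorial_Ring.irreducible f" and z: "ac_eval f z = 0"
  shows "Polynomial.order z (map_poly to_ac f) = 1"
proof -
  let ?F = "map_poly to_ac f"
  have f0: "f \<noteq> 0" using f by auto
  then have F0: "?F \<noteq> 0" by (simp add: map_poly_ac_eq_0_iff)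
  have "Polynomial.order z ?F \<noteq> 0" using z F0 by (simp add: order_root[symmetric] ac_eval_def order_eq_0_iff)
  moreover have "\<not> 2 \<le> Polynomial.order z ?F"
  proof
    assume "2 \<le> Polynomial.order z ?F"
    then have "[:-z, 1:] ^ 2 dvd ?F" by (simp add: order_divides)
    then obtain h where h: "?F = [:-z, 1:] ^ Suc 1 * h" by (auto simp: numeral_2_eq_2)
    have "poly (pderiv ?F) z = 0" unfolding h lemma_order_pderiv1 by simp
    then have "ac_eval (pderiv f) z = 0" by (simp add: ac_eval_def map_poly_ac_pderiv)
    then have "f dvd pderiv f" using irreducible_dvd_of_root[OF f z] by blast
    then have "Polynomial.degree f \<le> Polynomial.degree (pderiv f)"
      using irreducible_pderiv_neq_0[OF f] by (rule dvd_imp_degree_le)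
    moreover have "Polynomial.degree f \<noteq> 0" using f f0 by (auto simp: Factorial_Ring.irreducible_def is_unit_iff_degree)
    moreover have "Polynomial.degree (pderiv f) \<le> Polynomial.degree f - 1" 
      by (rule degree_le) (auto simp: coeff_pderiv coeff_eq_0)
    ultimately show False by simp
  qed
  ultimately show ?thesis by simp
qed

lemma card_roots_irreducible:
  fixes f :: "'k::{field,finite} poly"
  assumes f: "Factorial_Ring.irreducible f"
  shows "card {z. ac_eval f z = 0} = Polynomial.degree f" and "finite {z. ac_eval f z = 0}"
proof -
  let ?F = "map_poly to_ac f"
  have F0: "?F \<noteq> 0" using f by (auto simp: map_poly_ac_eq_0_iff)
  have set: "set_mset (proots ?F) = {z. ac_eval f z = 0}" using F0 by (simp add: ac_eval_def)
  then show "finite {z. ac_eval f z = 0}" by (metis finite_set_mset)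
  obtain A where A: "size A = Polynomial.degree ?F" "?F = Polynomial.smult (Polynomial.lead_coeff ?F) (\<Prod>x\<in>#A. [:-x, 1:])"
    using alg_closed_imp_factorization[OF F0] by blast
  have "proots ?F = proots (\<Prod>x\<in>#A. [:-x, 1:])"
    using F0 by (subst A(2)) (simp del: coeff_map_poly_ac)
  also have "\<dots> = (\<Sum>x\<in>#A. proots [:-x, 1:])"
  proof -
    have "0 \<notin># image_mset (\<lambda>x. [:-x, 1:]) A" by auto
    from proots_prod_mset[OF this] show ?thesis by (simp add: image_mset.compositionality comp_def)
  qed
  also have "\<dots> = A" by (induction A) auto
  finally have "size (proots ?F) = Polynomial.degree f" using A(1) by (simp add: degree_map_poly_ac)
  moreover have "size (proots ?F) = (\<Sum>z\<in>set_mset (proots ?F). 1)"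
    unfolding size_multiset_overloaded_eq
    using F0 irreducible_order_root[OF f] by (intro sum.cong) (auto simp: ac_eval_def)
  ultimately show "card {z. ac_eval f z = 0} = Polynomial.degree f" by (simp add: set)
qed

text \<open>
  The closed points with a given monic irreducible polynomial, and the point at infinity.
\<close>

definition affine_pt :: "'k::field poly \<Rightarrow> 'k closed_point" where
  "affine_pt f = Abs_closed_point (Affine f)"

definition infty_pt :: "'k::field closed_point" where
  "infty_pt = Abs_closed_point Infty"

definition monic_irreducible :: "'k::field poly \<Rightarrow> bool" where
  "monic_irreducible f \<longleftrightarrow> Factorial_Ring.irreducible f \<and> Polynomial.lead_coeff f = 1"

lemma Rep_infty_pt [simp]: "Rep_closed_point infty_pt = Infty"
  by (simp add: infty_pt_def Abs_closed_point_inverse)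

lemma Rep_affine_pt [simp]: "monic_irreducible f \<Longrightarrow> Rep_closed_point (affine_pt f) = Affine f"
  by (simp add: affine_pt_def Abs_closed_point_inverse monic_irreducible_def)

lemma closed_point_cases [case_names infty affine]:
  obtains "c = infty_pt" | f where "monic_irreducible f" "c = affine_pt f"
proof -
  have "Rep_closed_point c \<in> {Infty} \<union> Affine ` {f. Factorial_Ring.irreducible f \<and> Polynomial.lead_coeff f = 1}"
    by (rule Rep_closed_point)
  then show ?thesis
    using that unfolding infty_pt_def affine_pt_def monic_irreducible_def
    by (auto, metis Rep_closed_point_inverse, metis Rep_closed_point_inverse)
qed

lemma affine_pt_eq_iff: "monic_irreducible f \<Longrightarrow> monic_irreducible g \<Longrightarrow> affine_pt f = affine_pt g \<longleftrightarrow> f = g"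
  by (metis Rep_affine_pt P1.inject)

lemma affine_neq_infty: "monic_irreducible f \<Longrightarrow> affine_pt f \<noteq> infty_pt"
  by (metis Rep_affine_pt Rep_infty_pt P1.distinct(1))

lemma deg_infty_pt [simp]: "deg_pt infty_pt = 1" by (simp add: deg_pt_def)

lemma deg_affine_pt [simp]: "monic_irreducible f \<Longrightarrow> deg_pt (affine_pt f) = Polynomial.degree f"
  by (simp add: deg_pt_def)

lemma degree_monic_irreducible_pos: "monic_irreducible (f :: 'k::field poly) \<Longrightarrow> 0 < Polynomial.degree f"
  unfolding monic_irreducible_def Factorial_Ring.irreducible_def by (auto simp: is_unit_iff_degree)

lemma deg_pt_pos: "0 < deg_pt c"
  by (cases c rule: closed_point_cases) (auto simp: degree_monic_irreducible_pos)

text \<open>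
  The closed point below a geometric point.
\<close>

definition pt_below :: "'k::field alg_closure P1 \<Rightarrow> 'k closed_point" where
  "pt_below a = (case a of Infty \<Rightarrow> infty_pt | Affine z \<Rightarrow> affine_pt (THE f. monic_irreducible f \<and> ac_eval f z = 0))"

lemma pt_below_affine:
  assumes "monic_irreducible f" "ac_eval f z = 0"
  shows "pt_below (Affine z) = affine_pt f"
proof -
  have "(THE f. monic_irreducible f \<and> ac_eval f z = 0) = f"
  proof (rule the_equality)
    fix g assume "monic_irreducible g \<and> ac_eval g z = 0"
    then show "g = f" using assms irreducible_dvd_of_root monic_dvd_antisym unfolding monic_irreducible_def by metis
  qed (use assms in auto)
  then show ?thesis by (simp add: pt_below_def)
qed

lemma pt_below_Infty [simp]: "pt_below Infty = infty_pt" by (simp add: pt_below_def)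

lemma affine_pt_below_iff:
  assumes "monic_irreducible f" shows "pt_below (Affine z) = affine_pt f \<longleftrightarrow> ac_eval f z = 0"
proof
  assume *: "pt_below (Affine z) = affine_pt f"
  obtain g where g: "monic_irreducible g" "ac_eval g z = 0"
    using ex_irreducible_root[of z] unfolding monic_irreducible_def by metis
  then have "affine_pt g = affine_pt f" using * pt_below_affine by metis
  then show "ac_eval f z = 0" using g assms by (simp add: affine_pt_eq_iff)
qed (rule pt_below_affine[OF assms])

lemma infty_pt_below_iff: "pt_below a = infty_pt \<longleftrightarrow> a = Infty"
proof (cases a)
  case (Affine z)
  obtain g where g: "monic_irreducible g" "ac_eval g z = 0"
    using ex_irreducible_root[of z] unfolding monic_irreducible_def by metis
  then show ?thesis using pt_below_affine[OF g] affine_neq_infty[OF g(1)] by (simp add: Affine)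
qed simp

text \<open>
  By separability the base change of a closed point is reduced.
\<close>

lemma geom_mult_eq:
  fixes c :: "'k::{field,finite} closed_point"
  shows "geom_mult c a = of_bool (pt_below a = c)"
proof (cases c rule: closed_point_cases)
  case infty
  then show ?thesis by (cases a) (auto simp: geom_mult_def infty_pt_below_iff)
next
  case (affine f)
  have f0: "map_poly to_ac f \<noteq> 0" using affine by (auto simp: map_poly_ac_eq_0_iff monic_irreducible_def)
  show ?thesis
  proof (cases a)
    case (Affine z)
    show ?thesis
    proof (cases "ac_eval f z = 0")
      case True
      then show ?thesis using affine irreducible_order_root[of f z]
        by (simp add: geom_mult_def Affine affine_pt_below_iff monic_irreducible_def)
    next
      case False
      then show ?thesis using affine f0
        by (simp add: geom_mult_def Affine affine_pt_below_iff ac_eval_def order_eq_0_iff)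
    qed
  next
    case Infty
    then show ?thesis using affine affine_neq_infty[OF affine(1)] by (simp add: geom_mult_def eq_commute[of infty_pt])
  qed
qed

lemma card_fibre:
  fixes c :: "'k::{field,finite} closed_point"
  shows "card {a. pt_below a = c} = deg_pt c" and "finite {a. pt_below a = c}"
proof -
  have "card {a. pt_below a = c} = deg_pt c \<and> finite {a. pt_below a = c}"
  proof (cases c rule: closed_point_cases)
    case infty
    then show ?thesis by (simp add: infty_pt_below_iff)
  next
    case (affine f)
    have "{a. pt_below a = c} = Affine ` {z. ac_eval f z = 0}"
    proof (rule Set.set_eqI)
      fix a show "a \<in> {a. pt_below a = c} \<longleftrightarrow> a \<in> Affine ` {z. ac_eval f z = 0}"
        using affine affine_neq_infty[OF affine(1)] by (cases a) (auto simp: affine_pt_below_iff)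
    qed
    moreover have "inj_on Affine {z. ac_eval f z = 0}" by (simp add: inj_on_def)
    ultimately show ?thesis using affine card_roots_irreducible[of f]
      by (simp add: card_image monic_irreducible_def)
  qed
  then show "card {a. pt_below a = c} = deg_pt c" "finite {a. pt_below a = c}" by auto
qed

lemma sum_geom_mult:
  fixes D :: "'k::{field,finite} closed_point multiset"
  shows "(\<Sum>c\<in>#D. geom_mult c a) = count D (pt_below a)"
  by (induction D) (auto simp: geom_mult_eq)

section \<open>The function gamma\<close>

text \<open>
  The function \<open>gammaQ\<close> in terms of the number of coatoms above an element, and its sum over the steps of
  the filtration of a jet. The index \<open>n\<close> is shifted by one: the set \<open>{s. n < m s}\<close> is step \<open>n + 1\<close>.
\<close>

definition flag_gamma :: "coatom set \<Rightarrow> nat" where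
  "flag_gamma T = (if T = {} then 0 else if card T = 1 then 2 else if card T = 2 then 3 else 4)"

definition jet_gamma :: "(coatom \<Rightarrow> nat) \<Rightarrow> nat" where
  "jet_gamma m = (\<Sum>n | \<exists>s. n < m s. flag_gamma {s. n < m s})"

lemma flag_gamma_simps [simp]:
  "flag_gamma {} = 0" "flag_gamma {s} = 2" "flag_gamma UNIV = 4"
  "flag_gamma {Diag i, Fst} = 3" "flag_gamma {Diag i, Snd} = 3"
proof -
  have "card {Diag i, Fst} = 2" "card {Diag i, Snd} = 2" by auto
  then show "flag_gamma {Diag i, Fst} = 3" "flag_gamma {Diag i, Snd} = 3"
    by (simp_all add: flag_gamma_def)
qed (simp_all add: flag_gamma_def card_coatom)

lemma finite_levels: "finite {n. \<exists>s. n < (m :: coatom \<Rightarrow> nat) s}"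
proof (rule finite_subset)
  show "{n. \<exists>s. n < m s} \<subseteq> (\<Union>s. {..<m s})" by auto
qed auto

lemma jet_gamma_zero [simp]: "jet_gamma (\<lambda>_. 0) = 0"
  by (simp add: jet_gamma_def)

lemma jet_gamma_flag_jet: "jet_gamma (flag_jet S) = flag_gamma S"
proof (cases "S = {}")
  case True
  then show ?thesis by (simp add: jet_gamma_def flag_jet_def)
next
  case False
  then have "{n. \<exists>s. n < flag_jet S s} = {0}" by (auto simp: flag_jet_def of_bool_def split: if_splits)
  moreover have "{s. 0 < flag_jet S s} = S" by (auto simp: flag_jet_def)
  ultimately show ?thesis by (simp add: jet_gamma_def)
qed

text \<open>
  The first step of the filtration has \<open>gamma\<close> equal to 2, plus 1 for each of \<open>b1\<close> and \<open>b2\<close>; all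
  later steps, \<open>k - 1\<close> or \<open>k\<close> in number according to \<open>b3\<close>, are at \<open>Diag i\<close>.
\<close>

lemma jet_gamma_cube_jet:
  assumes "0 < k"
  shows "jet_gamma (cube_jet i k (b1, b2, b3)) = 2 * k + of_bool b1 + of_bool b2 + 2 * of_bool b3"
proof -
  let ?m = "cube_jet i k (b1, b2, b3)"
  obtain l where l: "k + of_bool b3 = Suc l" using assms by (cases "k + of_bool b3") auto
  have mi: "?m (Diag i) = Suc l" using l by (simp add: cube_jet_def)
  have le: "?m s \<le> 1" if "s \<noteq> Diag i" for s
    using that by (cases s) (auto simp: cube_jet_def)
  have lev: "{n. \<exists>s. n < ?m s} = {..<Suc l}"
  proof (intro equalityI subsetI)
    fix n assume "n \<in> {n. \<exists>s. n < ?m s}"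
    then obtain s where s: "n < ?m s" by auto
    show "n \<in> {..<Suc l}"
    proof (cases "s = Diag i")
      case True
      then show ?thesis using s mi by simp
    next
      case False
      then show ?thesis using s le[of s] by simp
    qed
  qed (use mi in \<open>auto intro!: exI[of _ "Diag i"]\<close>)
  have hi: "{s. Suc n < ?m s} = {Diag i}" if "n < l" for n
  proof (intro equalityI subsetI)
    fix s assume "s \<in> {s. Suc n < ?m s}"
    then show "s \<in> {Diag i}" using le[of s] by (cases "s = Diag i") auto
  qed (use that mi in auto)
  have lo: "flag_gamma {s. 0 < ?m s} = 2 + of_bool b1 + of_bool b2"
  proof -
    have eq: "{s. 0 < ?m s} = (if b1 \<and> b2 then UNIV else if b1 then {Diag i, Fst} else if b2 then {Diag i, Snd} else {Diag i})"
    proof (rule Set.set_eqI)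
      fix s show "s \<in> {s. 0 < ?m s} \<longleftrightarrow> s \<in> (if b1 \<and> b2 then UNIV else if b1 then {Diag i, Fst} else if b2 then {Diag i, Snd} else {Diag i})"
        using assms by (cases s) (auto simp: cube_jet_def)
    qed
    show ?thesis unfolding eq by simp
  qed
  have "jet_gamma ?m = (\<Sum>n<Suc l. flag_gamma {s. n < ?m s})" by (simp only: jet_gamma_def lev)
  also have "\<dots> = flag_gamma {s. 0 < ?m s} + (\<Sum>n<l. flag_gamma {s. Suc n < ?m s})"
    by (rule sum.lessThan_Suc_shift)
  also have "(\<Sum>n<l. flag_gamma {s. Suc n < ?m s}) = 2 * l" using hi by simp
  also have "flag_gamma {s. 0 < ?m s} + 2 * l = 2 * k + of_bool b1 + of_bool b2 + 2 * of_bool b3"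
    using l by (simp add: lo)
  finally show ?thesis .
qed

context two_pencils
begin

lemma flag_space_eq_iff: "T \<in> flags \<Longrightarrow> T' \<in> flags \<Longrightarrow> flag_space T = flag_space T' \<longleftrightarrow> T = T'"
  by (metis coatoms_above_flag_space)

lemma flags_intros: "{} \<in> flags" "UNIV \<in> flags" "{s} \<in> flags" "{Diag i, Fst} \<in> flags" "{Diag i, Snd} \<in> flags"
  by (auto simp: flags_eq)

lemma gammaQ_flag_space:
  assumes "T \<in> flags" shows "gammaQ L1 L2 (flag_space T) = flag_gamma T"
proof -
  have e: "flag_space T = UNIV \<longleftrightarrow> T = {}" "flag_space T = L1 i \<times> L2 i \<longleftrightarrow> T = {Diag i}"
    "flag_space T = UNIV \<times> {0} \<longleftrightarrow> T = {Fst}" "flag_space T = {0} \<times> UNIV \<longleftrightarrow> T = {Snd}"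
    "flag_space T = L1 i \<times> {0} \<longleftrightarrow> T = {Diag i, Fst}" "flag_space T = {0} \<times> L2 i \<longleftrightarrow> T = {Diag i, Snd}" for i
    using flag_space_eq_iff[OF assms flags_intros(1)] flag_space_eq_iff[OF assms flags_intros(3)[of "Diag i"]]
      flag_space_eq_iff[OF assms flags_intros(3)[of Fst]] flag_space_eq_iff[OF assms flags_intros(3)[of Snd]]
      flag_space_eq_iff[OF assms flags_intros(4)[of i]] flag_space_eq_iff[OF assms flags_intros(5)[of i]]
    by (simp_all add: flag_space_simps)
  consider "T = {}" | "T = UNIV" | t where "T = {t}" | i where "T = {Diag i, Fst}" | i where "T = {Diag i, Snd}"
    using assms unfolding flags_eq by blast
  then show ?thesis
  proof cases
    case 2
    have "UNIV \<noteq> {s}" "UNIV \<noteq> {s, t}" for s t :: coatom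
      using UNIV_coatom_not_subset(1)[of s t] UNIV_coatom_not_subset(2)[of s] by auto
    then show ?thesis unfolding gammaQ_def e using 2 by simp
  next
    case (3 t)
    then show ?thesis unfolding gammaQ_def e by (cases t) auto
  qed (unfold gammaQ_def e, auto simp: doubleton_eq_iff)
qed

lemma local_filtration_of_jets:
  fixes m :: "'k::{field,finite} closed_point \<Rightarrow> coatom \<Rightarrow> nat"
  assumes m: "m \<in> saturated"
  shows "local_filtration L1 L2 (of_jets m) a (Suc n) = flag_space {s. n < m (pt_below a) s}"
proof -
  let ?T = "{s. n < m (pt_below a) s}"
  have T: "?T \<in> flags" by (rule supp_flags[OF saturatedD(1)[OF m]])
  have key: "enat (Suc n) \<le> length_at (of_jets m S) a \<longleftrightarrow> flag_space ?T \<subseteq> S" if S: "S \<in> Qposet L1 L2" for S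
  proof (cases "S = UNIV")
    case True
    then show ?thesis by (simp add: of_jets_UNIV)
  next
    case False
    then show ?thesis
      using le_Min_coatoms[OF S False saturatedD(1)[OF m, of "pt_below a"], of n]
      by (simp add: of_jets_eq_Div[OF S] sum_geom_mult count_jet_div[OF m S] Suc_le_eq)
  qed
  show ?thesis
    unfolding local_filtration_def
    by (rule Least_equality) (use key T in \<open>auto simp: Qposet_eq\<close>)
qed

text \<open>
  A closed point \<open>c\<close> has \<open>deg_pt c\<close> geometric points above it, all with the same filtration.
\<close>

lemma gamma_of_jets:
  fixes m :: "'k::{field,finite} closed_point \<Rightarrow> coatom \<Rightarrow> nat"
  assumes m: "m \<in> saturated"
  shows "gamma L1 L2 (of_jets m) = (\<Sum>c | m c \<noteq> (\<lambda>_. 0). deg_pt c * jet_gamma (m c))"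
proof -
  let ?N = "\<lambda>m :: coatom \<Rightarrow> nat. {n. \<exists>s. n < m s}" and ?A = "{c. m c \<noteq> (\<lambda>_. 0)}"
  have A: "finite ?A" by (rule saturatedD(2)[OF m])
  have inner: "(\<Sum>\<^sub>\<infinity>n\<in>{1..}. gammaQ L1 L2 (local_filtration L1 L2 (of_jets m) a n)) = jet_gamma (m (pt_below a))" for a
  proof -
    let ?f = "\<lambda>n. gammaQ L1 L2 (local_filtration L1 L2 (of_jets m) a n)"
    have f: "?f (Suc n) = flag_gamma {s. n < m (pt_below a) s}" for n
      by (simp add: local_filtration_of_jets[OF m] gammaQ_flag_space supp_flags saturatedD(1)[OF m])
    have "infsum ?f {1..} = infsum ?f (Suc ` ?N (m (pt_below a)))"
    proof (rule infsum_cong_neutral)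
      fix x assume x: "x \<in> {1..} - Suc ` ?N (m (pt_below a))"
      then obtain n where n: "x = Suc n" by (cases x) auto
      then have "{s. n < m (pt_below a) s} = {}" using x by auto
      then show "?f x = 0" by (simp add: n f)
    qed auto
    also have "\<dots> = sum ?f (Suc ` ?N (m (pt_below a)))"
      by (rule infsum_finite) (simp add: finite_levels)
    also have "\<dots> = (\<Sum>n\<in>?N (m (pt_below a)). ?f (Suc n))" by (simp add: sum.reindex)
    also have "\<dots> = jet_gamma (m (pt_below a))" by (simp add: f jet_gamma_def)
    finally show ?thesis .
  qed
  have fin: "finite (\<Union>c\<in>?A. {a. pt_below a = c})" using A card_fibre(2) by auto
  have "gamma L1 L2 (of_jets m) = (\<Sum>\<^sub>\<infinity>a. jet_gamma (m (pt_below a)))"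
    unfolding gamma_def by (simp only: inner)
  also have "\<dots> = (\<Sum>\<^sub>\<infinity>a\<in>(\<Union>c\<in>?A. {a. pt_below a = c}). jet_gamma (m (pt_below a)))"
    by (rule infsum_cong_neutral) auto
  also have "\<dots> = (\<Sum>a\<in>(\<Union>c\<in>?A. {a. pt_below a = c}). jet_gamma (m (pt_below a)))"
    by (rule infsum_finite[OF fin])
  also have "\<dots> = (\<Sum>c\<in>?A. \<Sum>a\<in>{a. pt_below a = c}. jet_gamma (m (pt_below a)))"
    by (rule sum.UNION_disjoint) (use A card_fibre(2) in auto)
  also have "\<dots> = (\<Sum>c\<in>?A. deg_pt c * jet_gamma (m c))"
    by (intro sum.cong) (simp_all add: card_fibre(1)[symmetric])
  finally show ?thesis .
qed

end


section \<open>The zeta function of the projective line\<close>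

text \<open>
  The monic polynomials of degree \<open>n\<close>.
\<close>

definition monic_polys :: "nat \<Rightarrow> 'k::field poly set" where
  "monic_polys n = {f. Polynomial.lead_coeff f = 1 \<and> Polynomial.degree f = n}"

lemma card_monic_polys:
  fixes n :: nat
  shows "card (monic_polys n :: 'k::{field,finite} poly set) = CARD('k) ^ n"
    and "finite (monic_polys n :: 'k poly set)"
proof -
  define \<phi> where "\<phi> = (\<lambda>a :: nat \<Rightarrow> 'k. Polynomial.monom 1 n + (\<Sum>i<n. Polynomial.monom (a i) i))"
  have cf: "Polynomial.coeff (\<phi> a) i = (if i = n then 1 else if i < n then a i else 0)" for a i
    by (auto simp: \<phi>_def coeff_monom coeff_sum)
  have "bij_betw \<phi> (PiE {..<n} (\<lambda>_. UNIV)) (monic_polys n)"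
  proof (rule bij_betw_byWitness[where f' = "\<lambda>f. restrict (Polynomial.coeff f) {..<n}"])
    show "\<forall>a\<in>PiE {..<n} (\<lambda>_. UNIV). restrict (Polynomial.coeff (\<phi> a)) {..<n} = a"
      by (auto simp: fun_eq_iff cf PiE_def extensional_def)
    show "\<forall>f\<in>monic_polys n. \<phi> (restrict (Polynomial.coeff f) {..<n}) = f"
      by (auto simp: poly_eq_iff cf monic_polys_def coeff_eq_0)
    show "\<phi> ` PiE {..<n} (\<lambda>_. UNIV) \<subseteq> monic_polys n"
    proof safe
      fix a
      have "Polynomial.degree (\<phi> a) = n"
      proof (rule antisym)
        show "Polynomial.degree (\<phi> a) \<le> n" by (rule degree_le) (simp add: cf)
        show "n \<le> Polynomial.degree (\<phi> a)" by (rule le_degree) (simp add: cf)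
      qed
      then show "\<phi> a \<in> monic_polys n" by (simp add: monic_polys_def cf)
    qed
    show "(\<lambda>f. restrict (Polynomial.coeff f) {..<n}) ` monic_polys n \<subseteq> PiE {..<n} (\<lambda>_. UNIV)"
      by (simp add: image_subset_iff)
  qed
  then have *: "card (PiE {..<n} (\<lambda>_. UNIV :: 'k set)) = card (monic_polys n :: 'k poly set)"
    "finite (PiE {..<n} (\<lambda>_. UNIV :: 'k set)) = finite (monic_polys n :: 'k poly set)"
    by (auto dest: bij_betw_same_card bij_betw_finite)
  show "card (monic_polys n :: 'k poly set) = CARD('k) ^ n" using *(1) by (simp add: card_PiE)
  show "finite (monic_polys n :: 'k poly set)" using *(2) by (simp add: finite_PiE)
qed

lemma card_field_ge_2: "2 \<le> CARD('k::{field,finite})"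
proof -
  have "card {0, 1 :: 'k} \<le> CARD('k)" by (rule card_mono) auto
  then show ?thesis by simp
qed

lemma has_sum_geometric:
  fixes x :: "'a::{real_normed_field,banach}"
  assumes "norm x < 1"
  shows "((\<lambda>n. x ^ n) has_sum (1 / (1 - x))) UNIV"
  by (rule norm_summable_imp_has_sum) (use assms in \<open>auto simp: norm_power intro: geometric_sums summable_geometric\<close>)

lemma has_sum_monic_polys:
  fixes r :: "'a::{real_normed_field,banach}"
  assumes r: "of_nat CARD('k::{field,finite}) * norm r < 1"
  shows "((\<lambda>f. r ^ Polynomial.degree f) has_sum (1 / (1 - of_nat CARD('k) * r))) {f :: 'k poly. Polynomial.lead_coeff f = 1}"
    and "(\<lambda>f. norm (r ^ Polynomial.degree f)) summable_on {f :: 'k poly. Polynomial.lead_coeff f = 1}"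
proof -
  let ?q = "of_nat CARD('k)" and ?M = "{f :: 'k poly. Polynomial.lead_coeff f = 1}"
  let ?X = "SIGMA n:UNIV. (monic_polys n :: 'k poly set)"
  have bij: "bij_betw snd ?X ?M"
    by (rule bij_betw_byWitness[where f' = "\<lambda>f. (Polynomial.degree f, f)"]) (auto simp: monic_polys_def)
  have inner: "((\<lambda>f. s ^ Polynomial.degree f) has_sum (of_nat CARD('k) * s) ^ n) (monic_polys n :: 'k poly set)"
    for s :: "'b::{real_normed_field,banach}" and n
  proof (rule has_sum_finiteI)
    have "(\<Sum>f\<in>(monic_polys n :: 'k poly set). s ^ Polynomial.degree f) = (\<Sum>f\<in>(monic_polys n :: 'k poly set). s ^ n)"
      by (intro sum.cong) (auto simp: monic_polys_def)
    then show "(of_nat CARD('k) * s) ^ n = (\<Sum>f\<in>(monic_polys n :: 'k poly set). s ^ Polynomial.degree f)"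
      by (simp add: card_monic_polys power_mult_distrib)
  qed (rule card_monic_polys)
  have nr: "norm (of_nat CARD('k) * r) < 1" "norm (of_nat CARD('k) * norm r) < 1" using r by (simp_all add: norm_mult)
  have "(\<lambda>p. norm r ^ Polynomial.degree (snd p)) summable_on ?X"
  proof (rule summable_on_SigmaI)
    show "((\<lambda>y. norm r ^ Polynomial.degree (snd (n, y))) has_sum (of_nat CARD('k) * norm r) ^ n) (monic_polys n :: 'k poly set)" for n
      using inner[of "norm r" n] by simp
    show "(\<lambda>n. (of_nat CARD('k) * norm r) ^ n) summable_on UNIV"
      using has_sum_geometric[OF nr(2)] by (auto simp: summable_on_def)
  qed auto
  then have abs: "(\<lambda>p. norm (r ^ Polynomial.degree (snd p))) summable_on ?X" by (simp add: norm_power)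
  then show "(\<lambda>f. norm (r ^ Polynomial.degree f)) summable_on ?M"
    by (subst (asm) summable_on_reindex_bij_betw[OF bij])
  have "((\<lambda>p. r ^ Polynomial.degree (snd p)) has_sum (1 / (1 - of_nat CARD('k) * r))) ?X"
  proof (rule has_sum_SigmaI)
    show "((\<lambda>y. r ^ Polynomial.degree (snd (n, y))) has_sum (of_nat CARD('k) * r) ^ n) (monic_polys n :: 'k poly set)" for n
      using inner[of r n] by simp
    show "((\<lambda>n. (of_nat CARD('k) * r) ^ n) has_sum 1 / (1 - of_nat CARD('k) * r)) UNIV"
      by (rule has_sum_geometric[OF nr(1)])
    show "(\<lambda>p. r ^ Polynomial.degree (snd p)) summable_on ?X"
      by (rule abs_summable_summable[OF abs])
  qed
  then show "((\<lambda>f. r ^ Polynomial.degree f) has_sum (1 / (1 - of_nat CARD('k) * r))) ?M"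
    by (subst (asm) has_sum_reindex_bij_betw[OF bij])
qed

text \<open>
  A series over the closed points is dominated by the series over all monic polynomials.
\<close>

lemma summable_on_points:
  assumes r: "0 \<le> r" "real CARD('k::{field,finite}) * r < 1"
  shows "(\<lambda>c :: 'k closed_point. r ^ deg_pt c) summable_on UNIV"
proof -
  let ?M = "{f :: 'k poly. monic_irreducible f}"
  have "(\<lambda>f. r ^ Polynomial.degree f) summable_on {f :: 'k poly. Polynomial.lead_coeff f = 1}"
    using has_sum_monic_polys(2)[where ?'k = 'k, of r] r by (simp add: norm_power)
  then have "(\<lambda>f. r ^ Polynomial.degree f) summable_on ?M"
    by (rule summable_on_subset_banach) (auto simp: monic_irreducible_def)
  then have "((\<lambda>c. r ^ deg_pt c) \<circ> affine_pt) summable_on ?M"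
    by (rule summable_on_cong[THEN iffD1, rotated]) simp
  then have "(\<lambda>c. r ^ deg_pt c) summable_on affine_pt ` ?M"
    by (subst summable_on_reindex) (auto simp: inj_on_def affine_pt_eq_iff)
  then have "(\<lambda>c. r ^ deg_pt c) summable_on insert infty_pt (affine_pt ` ?M)"
    by (simp add: summable_on_insert_iff)
  moreover have "insert infty_pt (affine_pt ` ?M) = UNIV"
    using closed_point_cases by (metis (mono_tags, lifting) UNIV_eq_I image_eqI insertCI mem_Collect_eq)
  ultimately show ?thesis by simp
qed

text \<open>
  The equation of a closed point, and of an effective divisor, on the affine chart. The point at
  infinity contributes the factor 1, so a divisor is determined by its polynomial together with its
  multiplicity at infinity (\<open>div_poly_inj\<close>), and both are arbitrary (\<open>div_poly_surj\<close>).
\<close>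

definition pt_poly :: "'k::field closed_point \<Rightarrow> 'k poly" where
  "pt_poly c = (case Rep_closed_point c of Affine f \<Rightarrow> f | Infty \<Rightarrow> 1)"

lemma pt_poly_simps [simp]: "pt_poly infty_pt = 1" "monic_irreducible f \<Longrightarrow> pt_poly (affine_pt f) = f"
  by (simp_all add: pt_poly_def)

definition div_poly :: "'k::field closed_point multiset \<Rightarrow> 'k poly" where
  "div_poly D = (\<Prod>c\<in>#D. pt_poly c)"

lemma pt_poly_monic: "Polynomial.lead_coeff (pt_poly c) = 1"
  by (cases c rule: closed_point_cases) (simp_all add: monic_irreducible_def)

lemma div_poly_add [simp]: "div_poly (add_mset c D) = pt_poly c * div_poly D" by (simp add: div_poly_def)
lemma div_poly_empty [simp]: "div_poly {#} = 1" by (simp add: div_poly_def)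

lemma div_poly_monic: "Polynomial.lead_coeff (div_poly D) = 1"
  by (induction D) (simp_all only: div_poly_add lead_coeff_mult pt_poly_monic div_poly_empty lead_coeff_1 mult_1)

lemma deg_div_eq: "deg_div D = count D infty_pt + Polynomial.degree (div_poly D)"
proof (induction D)
  case (add c D)
  have nz: "pt_poly c \<noteq> 0" "div_poly D \<noteq> 0" using pt_poly_monic[of c] div_poly_monic[of D] by auto
  show ?case using add nz affine_neq_infty
    by (cases c rule: closed_point_cases) (auto simp: deg_div_def degree_mult_eq)
qed (simp add: deg_div_def)

lemma dvd_div_poly:
  assumes "monic_irreducible f" "f dvd div_poly D"
  shows "affine_pt f \<in># D"
  using assms(2)
proof (induction D)
  case empty
  then show ?case using assms(1) by (simp add: monic_irreducible_def Factorial_Ring.irreducible_def)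
next
  case (add c D)
  have "prime_elem f" using assms(1) field_poly_irreducible_imp_prime by (auto simp: monic_irreducible_def)
  then have "f dvd pt_poly c \<or> f dvd div_poly D" using add.prems by (simp add: prime_elem_dvd_mult_iff)
  then show ?case
  proof
    assume *: "f dvd pt_poly c"
    show ?thesis
    proof (cases c rule: closed_point_cases)
      case infty
      then show ?thesis using * assms(1) by (simp add: monic_irreducible_def Factorial_Ring.irreducible_def)
    next
      case (affine g)
      then have "f dvd g" using * by simp
      moreover have "\<not> is_unit f" using assms(1) by (simp add: monic_irreducible_def Factorial_Ring.irreducible_def)
      ultimately have "g dvd f" using affine(1) unfolding monic_irreducible_def by (metis Factorial_Ring.irreducible_altdef)
      then have "f = g" using \<open>f dvd g\<close> affine(1) assms(1) by (auto simp: monic_irreducible_def intro: monic_dvd_antisym)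
      then show ?thesis by (simp add: affine)
    qed
  qed (use add.IH in auto)
qed

lemma div_poly_inj:
  "count D infty_pt = count E infty_pt \<Longrightarrow> div_poly D = div_poly E \<Longrightarrow> D = E"
proof (induction D arbitrary: E)
  case empty
  show ?case
  proof (rule ccontr)
    assume "{#} \<noteq> E"
    then obtain c F where E: "E = add_mset c F" by (metis multiset_cases)
    show False
    proof (cases c rule: closed_point_cases)
      case infty
      then show ?thesis using empty(1) E by simp
    next
      case (affine f)
      then have "f dvd 1" using empty(2) E by (metis div_poly_add div_poly_empty dvd_triv_left pt_poly_simps(2))
      then show ?thesis using affine(1) by (simp add: monic_irreducible_def Factorial_Ring.irreducible_def)
    qed
  qed
next
  case (add c D)
  have "c \<in># E"
  proof (cases c rule: closed_point_cases)
    case infty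
    then show ?thesis using add.prems(1) by (metis count_add_mset count_greater_zero_iff zero_less_Suc)
  next
    case (affine f)
    then show ?thesis using add.prems(2) dvd_div_poly by (metis div_poly_add dvd_triv_left pt_poly_simps(2))
  qed
  then obtain F where E: "E = add_mset c F" by (metis insert_DiffM)
  have "pt_poly c \<noteq> 0" using pt_poly_monic[of c] by auto
  then have "D = F" using add.prems by (intro add.IH) (auto simp: E split: if_splits)
  then show ?case by (simp add: E)
qed

lemma div_poly_surj:
  fixes f :: "'k::field poly"
  assumes "Polynomial.lead_coeff f = 1"
  shows "\<exists>D. count D infty_pt = n \<and> div_poly D = f"
  using assms
proof (induction "Polynomial.degree f" arbitrary: f rule: less_induct)
  case less
  show ?case
  proof (cases "Polynomial.degree f = 0")
    case True
    then have "f = 1" using less.prems by (metis degree_eq_zeroE lead_coeff_pCons(2) one_pCons)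
    moreover have "div_poly (replicate_mset n infty_pt) = (1 :: 'k poly)" by (simp add: div_poly_def)
    ultimately show ?thesis by (intro exI[of _ "replicate_mset n infty_pt"]) simp
  next
    case False
    let ?P = "\<lambda>p. p dvd f \<and> Polynomial.lead_coeff p = 1 \<and> 0 < Polynomial.degree p"
    have "?P f" using less.prems False by simp
    then have "\<exists>p. ?P p \<and> (\<forall>h. ?P h \<longrightarrow> Polynomial.degree p \<le> Polynomial.degree h)"
      by (rule ex_has_least_nat)
    then obtain p where p: "?P p" and min: "\<And>h. ?P h \<Longrightarrow> Polynomial.degree p \<le> Polynomial.degree h" by blast
    have p0: "p \<noteq> 0" using p by auto
    have irr: "Factorial_Ring.irreducible p"
    proof (rule Factorial_Ring.irreducibleI)
      show "\<not> is_unit p" using p p0 by (simp add: is_unit_iff_degree)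
      fix a b assume ab: "p = a * b"
      have nz: "a \<noteq> 0" "b \<noteq> 0" using ab p0 by auto
      show "is_unit a \<or> is_unit b"
      proof (rule ccontr)
        assume n: "\<not> (is_unit a \<or> is_unit b)"
        let ?a = "Polynomial.smult (inverse (Polynomial.lead_coeff a)) a"
        have "?a dvd a" using nz by (intro smult_dvd) auto
        then have "?a dvd f" using ab p by (meson dvd_trans dvd_triv_left)
        then have "Polynomial.degree p \<le> Polynomial.degree ?a"
          using n nz by (intro min) (auto simp: is_unit_iff_degree)
        then have "Polynomial.degree p \<le> Polynomial.degree a" using nz by simp
        then show False using n nz by (simp add: ab degree_mult_eq is_unit_iff_degree)
      qed
    qed (rule p0)
    obtain h where h: "f = p * h" using p by (elim conjE dvdE)
    have h0: "h \<noteq> 0" using h less.prems by auto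
    have "Polynomial.lead_coeff h = 1" using less.prems p by (simp add: h lead_coeff_mult)
    moreover have "Polynomial.degree h < Polynomial.degree f" using p p0 h0 by (simp add: h degree_mult_eq)
    ultimately obtain D where D: "count D infty_pt = n" "div_poly D = h" using less.hyps by blast
    have mi: "monic_irreducible p" using irr p by (simp add: monic_irreducible_def)
    show ?thesis
      using D mi affine_neq_infty[OF mi] by (intro exI[of _ "add_mset (affine_pt p) D"]) (simp add: h)
  qed
qed

lemma has_sum_divisors:
  fixes r :: "'a::{real_normed_field,banach}"
  assumes r: "of_nat CARD('k::{field,finite}) * norm r < 1"
  shows "((\<lambda>D :: 'k closed_point multiset. r ^ deg_div D) has_sum
      (1 / ((1 - r) * (1 - of_nat CARD('k) * r)))) UNIV"
proof -
  let ?M = "{f :: 'k poly. Polynomial.lead_coeff f = 1}"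
  have "norm r \<le> of_nat CARD('k) * norm r" using card_field_ge_2[where ?'k = 'k] by (simp add: mult_le_cancel_right1)
  then have r1: "norm r < 1" using r by simp
  have bij: "bij_betw (\<lambda>D. (count D infty_pt, div_poly D)) (UNIV :: 'k closed_point multiset set) (UNIV \<times> ?M)"
    unfolding bij_betw_def
  proof
    show "inj (\<lambda>D :: 'k closed_point multiset. (count D infty_pt, div_poly D))"
      by (rule injI) (auto intro: div_poly_inj)
    show "range (\<lambda>D :: 'k closed_point multiset. (count D infty_pt, div_poly D)) = UNIV \<times> ?M"
    proof (intro equalityI subsetI)
      fix x assume x: "x \<in> (UNIV :: nat set) \<times> ?M"
      obtain D where "count D infty_pt = fst x" "div_poly D = snd x"
        using div_poly_surj[of "snd x" "fst x"] x by auto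
      then have "x = (count D infty_pt, div_poly D)" by (simp add: prod_eq_iff)
      then show "x \<in> range (\<lambda>D :: 'k closed_point multiset. (count D infty_pt, div_poly D))"
        by (rule range_eqI)
    qed (use div_poly_monic in auto)
  qed
  have "((\<lambda>(n, f). r ^ n * r ^ Polynomial.degree f) has_sum
      (1 / (1 - r) * (1 / (1 - of_nat CARD('k) * r)))) (UNIV \<times> ?M)"
  proof (rule has_sum_SigmaI)
    show "((\<lambda>f. case (n, f) of (n, f) \<Rightarrow> r ^ n * r ^ Polynomial.degree f) has_sum
        (r ^ n * (1 / (1 - of_nat CARD('k) * r)))) ?M" for n
      using has_sum_cmult_right[OF has_sum_monic_polys(1)[OF r], of "r ^ n"] by simp
    show "((\<lambda>n. r ^ n * (1 / (1 - of_nat CARD('k) * r))) has_sum (1 / (1 - r) * (1 / (1 - of_nat CARD('k) * r)))) UNIV"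
      by (rule has_sum_cmult_left[OF has_sum_geometric[OF r1]])
    have "(\<lambda>(n, f). norm (r ^ n * r ^ Polynomial.degree f)) summable_on (UNIV \<times> ?M)"
    proof (rule summable_on_SigmaI)
      have s: "((\<lambda>f. norm (r ^ Polynomial.degree f)) has_sum (\<Sum>\<^sub>\<infinity>f\<in>?M. norm (r ^ Polynomial.degree f))) ?M"
        by (rule has_sum_infsum[OF has_sum_monic_polys(2)[OF r]])
      show "((\<lambda>f. case (n, f) of (n, f) \<Rightarrow> norm (r ^ n * r ^ Polynomial.degree f)) has_sum
          (norm r ^ n * (\<Sum>\<^sub>\<infinity>f\<in>?M. norm (r ^ Polynomial.degree f)))) ?M" for n
        using has_sum_cmult_right[OF s, of "norm r ^ n"] by (simp add: norm_mult norm_power)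
      show "(\<lambda>n. norm r ^ n * (\<Sum>\<^sub>\<infinity>f\<in>?M. norm (r ^ Polynomial.degree f))) summable_on UNIV"
        using has_sum_geometric[of "norm r"] r1 by (intro summable_on_cmult_left) (auto simp: summable_on_def)
    qed auto
    then have "(\<lambda>p. norm (case p of (n, f) \<Rightarrow> r ^ n * r ^ Polynomial.degree f)) summable_on (UNIV \<times> ?M)"
      by (simp add: case_prod_unfold)
    then show "(\<lambda>(n, f). r ^ n * r ^ Polynomial.degree f) summable_on (UNIV \<times> ?M)"
      by (rule abs_summable_summable)
  qed
  then have "((\<lambda>D :: 'k closed_point multiset. case (count D infty_pt, div_poly D) of (n, f) \<Rightarrow> r ^ n * r ^ Polynomial.degree f)
      has_sum (1 / (1 - r) * (1 / (1 - of_nat CARD('k) * r)))) UNIV"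
    by (subst has_sum_reindex_bij_betw[OF bij])
  then show ?thesis by (simp add: deg_div_eq power_add)
qed

lemma bij_count_finsupp: "bij_betw count UNIV (finsupp UNIV (0 :: nat) :: ('c \<Rightarrow> nat) set)"
proof (rule bij_betw_byWitness[where f' = Abs_multiset])
  show "\<forall>\<sigma>\<in>finsupp UNIV 0. count (Abs_multiset \<sigma>) = \<sigma>"
    by (auto simp: finsupp_def intro!: count_Abs_multiset)
  show "range count \<subseteq> finsupp UNIV 0" by (auto simp: finsupp_def)
qed (auto simp: count_inverse)

lemma sum_mset_eq_sum_count:
  fixes f :: "'c \<Rightarrow> nat"
  assumes "finite A" "set_mset D \<subseteq> A"
  shows "(\<Sum>c\<in>#D. f c) = (\<Sum>c\<in>A. f c * count D c)"
  using assms(2)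
proof (induction D)
  case (add x D)
  have "(\<Sum>c\<in>A. f c * count (add_mset x D) c) = (\<Sum>c\<in>A. f c * count D c + (if c = x then f c else 0))"
    by (intro sum.cong) auto
  also have "\<dots> = (\<Sum>c\<in>A. f c * count D c) + f x"
    using add.prems assms(1) by (simp add: sum.distrib)
  finally show ?case using add by simp
qed simp

lemma zeta_euler_product:
  fixes r :: complex
  assumes r: "real CARD('k::{field,finite}) * norm r < 1"
  shows "((\<lambda>A. \<Prod>c\<in>A. 1 / (1 - r ^ deg_pt c)) \<longlongrightarrow> zeta_P1 (real CARD('k)) r)
     (finite_subsets_at_top (UNIV :: 'k closed_point set))"
proof -
  define g where "g = (\<lambda>(c :: 'k closed_point) n. (r ^ deg_pt c) ^ n)"
  have q2: "2 \<le> real CARD('k)" using card_field_ge_2[where ?'k = 'k] by linarith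
  then have "2 * norm r \<le> real CARD('k) * norm r" by (intro mult_right_mono) auto
  then have r2: "norm r < 1 / 2" using r by simp
  have x: "norm (r ^ deg_pt c) < 1 / 2" for c :: "'k closed_point"
  proof -
    have "norm (r ^ deg_pt c) \<le> norm r ^ 1" unfolding norm_power using r2 deg_pt_pos[of c]
      by (intro power_decreasing) auto
    then show ?thesis using r2 by simp
  qed
  have gsum: "(g c has_sum (1 / (1 - r ^ deg_pt c))) UNIV" for c
    unfolding g_def by (rule has_sum_geometric) (use x[of c] in simp)
  have gabs: "((\<lambda>n. norm (g c n)) has_sum (1 / (1 - norm (r ^ deg_pt c)))) UNIV" for c
    using has_sum_geometric[of "norm (r ^ deg_pt c)"] x[of c] by (simp add: g_def norm_power)
  have H: "(\<Sum>\<^sub>\<infinity>n\<in>UNIV - {0}. norm (g c n)) = norm (r ^ deg_pt c) / (1 - norm (r ^ deg_pt c))" for c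
  proof -
    have "(\<Sum>\<^sub>\<infinity>n\<in>UNIV - {0}. norm (g c n)) = 1 / (1 - norm (r ^ deg_pt c)) - norm (g c 0)"
    proof -
      have "(\<lambda>n. norm (g c n)) summable_on UNIV" using gabs[of c] by (auto simp: summable_on_def)
      then show ?thesis using infsumI[OF gabs[of c]] by (subst infsum_Diff) simp_all
    qed
    also have "\<dots> = norm (r ^ deg_pt c) / (1 - norm (r ^ deg_pt c))"
      using x[of c] by (simp add: g_def field_simps)
    finally show ?thesis .
  qed
  have sum: "(\<lambda>c. \<Sum>\<^sub>\<infinity>n\<in>UNIV - {0}. norm (g c n)) summable_on UNIV"
  proof (rule summable_on_comparison_test)
    show "(\<lambda>c :: 'k closed_point. 2 * norm r ^ deg_pt c) summable_on UNIV"
      by (intro summable_on_cmult_right summable_on_points) (use r in auto)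
    show "(\<Sum>\<^sub>\<infinity>n\<in>UNIV - {0}. norm (g c n)) \<le> 2 * norm r ^ deg_pt c" for c
    proof -
      have "norm (r ^ deg_pt c) / (1 - norm (r ^ deg_pt c)) \<le> norm (r ^ deg_pt c) / (1 / 2)"
        using x[of c] by (intro divide_left_mono) auto
      then show ?thesis unfolding H by (simp add: norm_power)
    qed
    show "0 \<le> (\<Sum>\<^sub>\<infinity>n\<in>UNIV - {0}. norm (g c n))" for c by (rule infsum_nonneg) simp
  qed
  have F: "(\<Sum>\<^sub>\<infinity>n\<in>UNIV. g c n) = 1 / (1 - r ^ deg_pt c)" for c using gsum by (rule infsumI)
  note ep = euler_product[of 0 UNIV g, OF _ _ _ sum]
  have prem: "g c 0 = 1" "(\<lambda>n. norm (g c n)) summable_on UNIV" for c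
    using gabs[of c] by (auto simp: g_def summable_on_def)
  have conv: "abs_convergent_infprod (\<lambda>c :: 'k closed_point. 1 / (1 - r ^ deg_pt c))"
    using ep(2) prem by (simp add: F)
  have "infprod (\<lambda>c :: 'k closed_point. 1 / (1 - r ^ deg_pt c)) =
      (\<Sum>\<^sub>\<infinity>\<sigma>\<in>finsupp UNIV 0. \<Prod>c | \<sigma> c \<noteq> 0. g c (\<sigma> c))"
    using ep(3) prem by (simp add: F)
  also have "\<dots> = (\<Sum>\<^sub>\<infinity>D. \<Prod>c | count D c \<noteq> 0. g c (count D c))"
    by (rule infsum_reindex_bij_betw[OF bij_count_finsupp, symmetric])
  also have "\<dots> = (\<Sum>\<^sub>\<infinity>D :: 'k closed_point multiset. r ^ deg_div D)"
  proof (rule infsum_cong)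
    fix D :: "'k closed_point multiset"
    have "(\<Prod>c | count D c \<noteq> 0. g c (count D c)) = (\<Prod>c\<in>set_mset D. r ^ (deg_pt c * count D c))"
    proof (rule prod.cong)
      show "{c. count D c \<noteq> 0} = set_mset D" by (rule Set.set_eqI) (simp add: count_eq_zero_iff)
    qed (simp add: g_def power_mult)
    also have "\<dots> = r ^ (\<Sum>c\<in>set_mset D. deg_pt c * count D c)" by (simp add: power_sum)
    also have "(\<Sum>c\<in>set_mset D. deg_pt c * count D c) = deg_div D"
      by (simp add: deg_div_def sum_mset_eq_sum_count[of "set_mset D"])
    finally show "(\<Prod>c | count D c \<noteq> 0. g c (count D c)) = r ^ deg_div D" .
  qed
  also have "\<dots> = zeta_P1 (real CARD('k)) r"
    using has_sum_divisors[where ?'k = 'k, of r] r by (simp add: zeta_P1_def infsumI)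
  finally show ?thesis using tendsto_infprod[OF conv] by simp
qed

section \<open>The local sum\<close>

text \<open>
  The multiplicities \<open>v\<close> of the four divisors \<open>w\<^sub>i\<close> at a point, as a jet.
\<close>

definition diag_of :: "(4 \<Rightarrow> nat) \<Rightarrow> coatom \<Rightarrow> nat" where
  "diag_of v s = (case s of Diag i \<Rightarrow> v i | _ \<Rightarrow> 0)"

text \<open>
  The local components of the pairs \<open>w \<le> x\<close>; at most one of the disjoint divisors \<open>w\<^sub>i\<close> passes through a
  given point.
\<close>

definition local_pairs :: "((4 \<Rightarrow> nat) \<times> (coatom \<Rightarrow> nat)) set" where
  "local_pairs = {(v, y). (\<forall>i j. i \<noteq> j \<longrightarrow> v i = 0 \<or> v j = 0) \<and> y \<in> jets \<and> diag_of v \<le> y}"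

text \<open>
  The exponent vector with entry \<open>k\<close> at \<open>i\<close> and 0 elsewhere.
\<close>

definition axis_exp :: "4 \<Rightarrow> nat \<Rightarrow> 4 \<Rightarrow> nat" where
  "axis_exp i k j = (if j = i then k else 0)"

lemma diag_of_axis: "diag_of (axis_exp i k) = diag_jet i k"
  by (auto simp: fun_eq_iff diag_of_def axis_exp_def diag_jet_def split: coatom.splits)

lemma diag_of_zero [simp]: "diag_of (\<lambda>_. 0) = (\<lambda>_. 0)"
  by (auto simp: fun_eq_iff diag_of_def split: coatom.splits)

lemma axis_exp_cases:
  assumes "\<forall>i j. i \<noteq> j \<longrightarrow> v i = 0 \<or> v j = (0 :: nat)"
  obtains "v = (\<lambda>_. 0)" | i n where "v = axis_exp i (Suc n)"
proof (cases "v = (\<lambda>_. 0)")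
  case False
  then obtain i where i: "v i \<noteq> 0" by blast
  then obtain n where n: "v i = Suc n" by (cases "v i") auto
  have "v = axis_exp i (Suc n)" using assms i n by (force simp: axis_exp_def fun_eq_iff)
  then show ?thesis by (rule that(2))
qed (use that in auto)

lemma axis_exp_Suc_eq_iff: "axis_exp i (Suc n) = axis_exp j (Suc m) \<longleftrightarrow> i = j \<and> n = m"
proof
  assume *: "axis_exp i (Suc n) = axis_exp j (Suc m)"
  show "i = j \<and> n = m" using fun_cong[OF *, of i] by (auto simp: axis_exp_def split: if_splits)
qed auto

lemma axis_exp_Suc_neq_zero: "axis_exp i (Suc n) \<noteq> (\<lambda>_. 0)"
proof
  assume *: "axis_exp i (Suc n) = (\<lambda>_. 0)"
  show False using fun_cong[OF *, of i] by (simp add: axis_exp_def)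
qed

lemma cube_jet_inj:
  assumes "cube_jet i k b = cube_jet i k b'" shows "b = b'"
proof -
  obtain b1 b2 b3 b1' b2' b3' where b: "b = (b1, b2, b3)" "b' = (b1', b2', b3')" by (metis prod_cases3)
  show ?thesis
    using fun_cong[OF assms, of Fst] fun_cong[OF assms, of Snd] fun_cong[OF assms, of "Diag i"]
    by (simp add: cube_jet_def b of_bool_eq_iff)
qed

lemma diag_le_cube: "diag_jet i k \<le> cube_jet i k b"
proof (rule le_funI)
  fix s show "diag_jet i k s \<le> cube_jet i k b s"
    by (cases s; cases b) (auto simp: diag_jet_def cube_jet_def)
qed

lemma moebius_flag_jet:
  assumes "S \<in> flags" shows "moebius jets (\<lambda>_. 0) (flag_jet S) = flag_moebius S"
proof -
  have "moebius jets (\<lambda>_. 0) (flag_jet S) = (\<Sum>S'\<in>flags. if S' = S then flag_moebius S' else 0)"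
    unfolding moebius_jets_zero[OF flag_jet_in_jets[OF assms]]
    using inj_flag_jet by (intro sum.cong) (auto simp: inj_def)
  then show ?thesis using assms by (simp add: flags_eq)
qed

lemma moebius_cube_jet: "moebius jets (diag_jet i (Suc n)) (cube_jet i (Suc n) b) = cube_sign b"
proof -
  have "moebius jets (diag_jet i (Suc n)) (cube_jet i (Suc n) b) = (\<Sum>b'\<in>UNIV. if b' = b then cube_sign b' else 0)"
    unfolding moebius_jets_diag[OF zero_less_Suc cube_jet_in_jets[OF zero_less_Suc] diag_le_cube]
    by (intro sum.cong) (auto dest: cube_jet_inj)
  then show ?thesis by simp
qed

text \<open>
  The two families of local pairs on which the Moebius function does not vanish. In \<open>cube_pair\<close> the
  multiplicity of \<open>w\<^sub>i\<close> is \<open>n + 1\<close>, hence positive.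
\<close>

definition flag_pair :: "coatom set \<Rightarrow> (4 \<Rightarrow> nat) \<times> (coatom \<Rightarrow> nat)" where
  "flag_pair S = ((\<lambda>_. 0), flag_jet S)"

definition cube_pair :: "4 \<times> bool \<times> bool \<times> bool \<Rightarrow> nat \<Rightarrow> (4 \<Rightarrow> nat) \<times> (coatom \<Rightarrow> nat)" where
  "cube_pair = (\<lambda>(i, b) n. (axis_exp i (Suc n), cube_jet i (Suc n) b))"

lemma local_pairs_support:
  assumes "(v, y) \<in> local_pairs" "moebius jets (diag_of v) y \<noteq> 0"
  shows "(v, y) \<in> flag_pair ` flags \<union> (\<Union>p. range (cube_pair p))"
proof -
  have v: "\<forall>i j. i \<noteq> j \<longrightarrow> v i = 0 \<or> v j = 0" and y: "y \<in> jets" "diag_of v \<le> y"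
    using assms(1) by (auto simp: local_pairs_def)
  from v show ?thesis
  proof (cases rule: axis_exp_cases)
    case 1
    then have "(\<Sum>S\<in>flags. if y = flag_jet S then flag_moebius S else 0) \<noteq> 0"
      using assms(2) moebius_jets_zero[OF y(1)] by simp
    then obtain S where "S \<in> flags" "(if y = flag_jet S then flag_moebius S else 0) \<noteq> 0" by (rule sum.not_neutral_contains_not_neutral)
    then have "(v, y) = flag_pair S" "S \<in> flags" using 1 by (auto simp: flag_pair_def split: if_splits)
    then show ?thesis by blast
  next
    case (2 i n)
    then have "(\<Sum>b\<in>UNIV. if y = cube_jet i (Suc n) b then cube_sign b else 0) \<noteq> 0"
      using assms(2) y moebius_jets_diag[OF zero_less_Suc y(1), of i n] by (simp add: diag_of_axis)
    then obtain b where "(if y = cube_jet i (Suc n) b then cube_sign b else 0) \<noteq> 0" by (rule sum.not_neutral_contains_not_neutral)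
    then have "(v, y) = cube_pair (i, b) n" using 2 by (auto simp: cube_pair_def split: if_splits)
    then show ?thesis by blast
  qed
qed

lemma flag_pair_in: "S \<in> flags \<Longrightarrow> flag_pair S \<in> local_pairs"
  by (auto simp: local_pairs_def flag_pair_def flag_jet_in_jets le_fun_def)

lemma cube_pair_in: "cube_pair p n \<in> local_pairs"
  by (cases p) (auto simp: local_pairs_def cube_pair_def diag_of_axis diag_le_cube cube_jet_in_jets axis_exp_def)

lemma cube_pair_eq_iff: "cube_pair p n = cube_pair p' n' \<longleftrightarrow> p = p' \<and> n = n'"
  by (cases p; cases p') (auto simp: cube_pair_def axis_exp_Suc_eq_iff dest: cube_jet_inj)

lemma flag_pair_neq_cube_pair: "flag_pair S \<noteq> cube_pair p n"
  using axis_exp_Suc_neq_zero[of "fst p" n] by (cases p) (auto simp: flag_pair_def cube_pair_def)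

text \<open>
  A common summation formula for the weights and for their absolute values: the flags contribute a
  finite sum, and each vertex \<open>b\<close> of the cube a geometric series.
\<close>

lemma has_sum_local_pairs:
  fixes f :: "(4 \<Rightarrow> nat) \<times> (coatom \<Rightarrow> nat) \<Rightarrow> 'a::{real_normed_field,banach}"
  assumes zero: "\<And>v y. (v, y) \<in> local_pairs \<Longrightarrow> moebius jets (diag_of v) y = 0 \<Longrightarrow> f (v, y) = 0"
    and cube: "\<And>i b n. f (cube_pair (i, b) n) = C b * z i ^ Suc n"
    and z: "\<And>i. norm (z i) < 1"
  shows "(f has_sum ((\<Sum>S\<in>flags. f (flag_pair S)) + (\<Sum>i\<in>UNIV. (\<Sum>b\<in>UNIV. C b) * (z i / (1 - z i))))) local_pairs"
proof -
  have fin: "finite flags" by (simp add: flags_eq)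
  have range: "(f has_sum (C b * (z i / (1 - z i)))) (range (cube_pair (i, b)))" for i b
  proof -
    have inj: "inj (cube_pair (i, b))" by (rule injI) (simp add: cube_pair_eq_iff)
    have "((\<lambda>n. (C b * z i) * z i ^ n) has_sum ((C b * z i) * (1 / (1 - z i)))) UNIV"
      by (intro has_sum_cmult_right has_sum_geometric z)
    then have "((f \<circ> cube_pair (i, b)) has_sum (C b * (z i / (1 - z i)))) UNIV"
      by (simp add: cube comp_def mult.assoc)
    then show ?thesis by (simp add: has_sum_reindex[OF inj])
  qed
  have "(f has_sum (\<Sum>p\<in>UNIV. C (snd p) * (z (fst p) / (1 - z (fst p))))) (\<Union>p\<in>UNIV. range (cube_pair p))"
  proof (rule sum_has_sum)
    show "(f has_sum (C (snd p) * (z (fst p) / (1 - z (fst p))))) (range (cube_pair p))" for p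
      using range[of "fst p" "snd p"] by simp
    show "range (cube_pair p) \<inter> range (cube_pair p') = {}" if "p \<noteq> p'" for p p'
      using that by (auto simp: cube_pair_eq_iff)
  qed simp
  also have "(\<Sum>p\<in>UNIV. C (snd p) * (z (fst p) / (1 - z (fst p)))) = (\<Sum>i\<in>UNIV. (\<Sum>b\<in>UNIV. C b) * (z i / (1 - z i)))"
    unfolding sum_distrib_right sum.cartesian_product by (simp add: case_prod_unfold)
  finally have K: "(f has_sum (\<Sum>i\<in>UNIV. (\<Sum>b\<in>UNIV. C b) * (z i / (1 - z i)))) (\<Union>p\<in>UNIV. range (cube_pair p))" .
  have "inj_on flag_pair flags"
    by (rule inj_onI) (simp add: flag_pair_def inj_eq[OF inj_flag_jet])
  then have J: "(f has_sum (\<Sum>S\<in>flags. f (flag_pair S))) (flag_pair ` flags)"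
    using fin by (intro has_sum_finiteI) (simp_all add: sum.reindex)
  have "(f has_sum ((\<Sum>S\<in>flags. f (flag_pair S)) + (\<Sum>i\<in>UNIV. (\<Sum>b\<in>UNIV. C b) * (z i / (1 - z i)))))
      (flag_pair ` flags \<union> (\<Union>p\<in>UNIV. range (cube_pair p)))"
    by (rule has_sum_Un_disjoint[OF J K]) (use flag_pair_neq_cube_pair in blast)
  then show ?thesis
  proof (rule has_sum_cong_neutral[THEN iffD1, rotated -1])
    fix p assume p: "p \<in> local_pairs - (flag_pair ` flags \<union> (\<Union>p\<in>UNIV. range (cube_pair p)))"
    obtain v y where vy: "p = (v, y)" by (cases p)
    show "f p = 0" using p local_pairs_support[of v y] zero[of v y] by (auto simp: vy)
  next
    fix p assume "p \<in> (flag_pair ` flags \<union> (\<Union>p\<in>UNIV. range (cube_pair p))) - local_pairs"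
    then show "f p = 0" using flag_pair_in cube_pair_in by blast
  qed auto
qed

text \<open>
  The contribution of a local pair to the series. For the point \<open>c\<close> the arguments are \<open>u = q^{-|c|}\<close> and
  \<open>x i = (q t\<^sub>i)^{|c|}\<close>.
\<close>

definition pair_weight :: "real \<Rightarrow> (4 \<Rightarrow> complex) \<Rightarrow> (4 \<Rightarrow> nat) \<times> (coatom \<Rightarrow> nat) \<Rightarrow> complex" where
  "pair_weight u x = (\<lambda>(v, y). of_int (moebius jets (diag_of v) y) * of_real u ^ jet_gamma y * (\<Prod>i\<in>UNIV. x i ^ v i))"

lemma prod_axis_exp: "(\<Prod>j\<in>UNIV. x j ^ axis_exp i k j) = (x i :: 'a::comm_monoid_mult) ^ k"
proof -
  have "(\<Prod>j\<in>UNIV. x j ^ axis_exp i k j) = (\<Prod>j\<in>UNIV. if j = i then x j ^ k else 1)"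
    by (intro prod.cong) (auto simp: axis_exp_def)
  then show ?thesis by simp
qed

lemma pair_weight_flag:
  "S \<in> flags \<Longrightarrow> pair_weight u x (flag_pair S) = of_int (flag_moebius S) * of_real u ^ flag_gamma S"
  by (simp add: pair_weight_def flag_pair_def moebius_flag_jet jet_gamma_flag_jet)

lemma pair_weight_cube:
  "pair_weight u x (cube_pair (i, b1, b2, b3) n) =
     (of_int (cube_sign (b1, b2, b3)) * of_real u ^ (of_bool b1 + of_bool b2 + 2 * of_bool b3)) * (of_real u ^ 2 * x i) ^ Suc n"
proof -
  have "of_real u ^ (2 * Suc n + of_bool b1 + of_bool b2 + 2 * of_bool b3) =
      (of_real u ^ (of_bool b1 + of_bool b2 + 2 * of_bool b3) * (of_real u ^ 2) ^ Suc n :: complex)"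
    by (simp only: power_add[symmetric] power_mult[symmetric] ac_simps)
  then show ?thesis
    by (simp only: pair_weight_def cube_pair_def prod.case diag_of_axis moebius_cube_jet prod_axis_exp
        jet_gamma_cube_jet[OF zero_less_Suc] power_mult_distrib mult.assoc)
qed

lemma has_sum_pair_weight:
  assumes "\<And>i. norm (of_real u ^ 2 * x i) < 1"
  defines "w \<equiv> complex_of_real u"
  shows "(pair_weight u x has_sum ((1 - w) ^ 3 * (1 + 3 * w) +
      (\<Sum>i\<in>UNIV. (1 - w) ^ 3 * (1 + w) * (w ^ 2 * x i / (1 - w ^ 2 * x i))))) local_pairs"
proof -
  let ?C = "\<lambda>(b1, b2, b3). of_int (cube_sign (b1, b2, b3)) * w ^ (of_bool b1 + of_bool b2 + 2 * of_bool b3)"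
  have "(pair_weight u x has_sum ((\<Sum>S\<in>flags. pair_weight u x (flag_pair S)) +
      (\<Sum>i\<in>UNIV. (\<Sum>b\<in>UNIV. ?C b) * (w ^ 2 * x i / (1 - w ^ 2 * x i))))) local_pairs"
  proof (rule has_sum_local_pairs)
    show "pair_weight u x (cube_pair (i, b) n) = ?C b * (w ^ 2 * x i) ^ Suc n" for i b n
      by (cases b) (simp only: prod.case pair_weight_cube w_def)
    show "norm (w ^ 2 * x i) < 1" for i using assms(1)[of i] by (simp add: w_def)
  qed (simp add: pair_weight_def)
  also have "(\<Sum>b\<in>UNIV. ?C b) = (1 - w) ^ 3 * (1 + w)"
    by (simp add: sum_bool3 sum_bool cube_sign_def, simp add: algebra_simps eval_nat_numeral)
  also have "(\<Sum>S\<in>flags. pair_weight u x (flag_pair S)) = (\<Sum>S\<in>flags. of_int (flag_moebius S) * w ^ flag_gamma S)"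
    by (intro sum.cong) (auto simp: pair_weight_flag w_def)
  also have "\<dots> = (1 - w) ^ 3 * (1 + 3 * w)"
    unfolding sum_flags by (simp, simp add: algebra_simps eval_nat_numeral)
  finally show ?thesis .
qed

lemma has_sum_norm_pair_weight:
  assumes u: "0 \<le> u" and x: "\<And>i. u ^ 2 * norm (x i) < 1"
  shows "((\<lambda>p. norm (pair_weight u x p)) has_sum (1 + 6 * u ^ 2 + 8 * u ^ 3 + 3 * u ^ 4 +
      (\<Sum>i\<in>UNIV. (1 + u) ^ 2 * (1 + u ^ 2) * (u ^ 2 * norm (x i) / (1 - u ^ 2 * norm (x i)))))) local_pairs"
proof -
  let ?C = "\<lambda>(b1, b2, b3). u ^ (of_bool b1 + of_bool b2 + 2 * of_bool b3)"
  \<comment> \<open>the signs disappear in the absolute values\<close>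
  have s: "\<bar>real_of_int (cube_sign b)\<bar> = 1" for b
    by (cases b) (simp add: cube_sign_def)
  have "((\<lambda>p. norm (pair_weight u x p)) has_sum ((\<Sum>S\<in>flags. norm (pair_weight u x (flag_pair S))) +
      (\<Sum>i\<in>UNIV. (\<Sum>b\<in>UNIV. ?C b) * (u ^ 2 * norm (x i) / (1 - u ^ 2 * norm (x i)))))) local_pairs"
  proof (rule has_sum_local_pairs)
    show "norm (pair_weight u x (cube_pair (i, b) n)) = ?C b * (u ^ 2 * norm (x i)) ^ Suc n" for i b n
      using u s by (cases b) (simp only: prod.case pair_weight_cube norm_mult norm_power norm_of_real norm_of_int abs_of_nonneg mult_1_left)
    show "norm (u ^ 2 * norm (x i)) < 1" for i using x[of i] by simp
  qed (simp add: pair_weight_def)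
  also have "(\<Sum>b\<in>UNIV. ?C b) = (1 + u) ^ 2 * (1 + u ^ 2)"
    by (simp add: sum_bool3 sum_bool, simp add: algebra_simps eval_nat_numeral)
  also have "(\<Sum>S\<in>flags. norm (pair_weight u x (flag_pair S))) = (\<Sum>S\<in>flags. \<bar>of_int (flag_moebius S)\<bar> * u ^ flag_gamma S)"
    using u by (intro sum.cong) (auto simp: pair_weight_flag norm_mult norm_power)
  also have "\<dots> = 1 + 6 * u ^ 2 + 8 * u ^ 3 + 3 * u ^ 4"
    unfolding sum_flags by (simp add: algebra_simps)
  finally show ?thesis .
qed


lemma norm_prod_le_pow:
  fixes t :: "complex ^ 4" and l :: "4 \<Rightarrow> nat"
  assumes "\<And>i. norm (t $ i) \<le> M" "0 \<le> M"
  shows "norm (\<Prod>i\<in>UNIV. (t $ i) ^ (n * l i)) \<le> (M ^ n) ^ (\<Sum>i\<in>UNIV. l i)"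
proof -
  have "norm (\<Prod>i\<in>UNIV. (t $ i) ^ (n * l i)) = (\<Prod>i\<in>UNIV. norm (t $ i) ^ (n * l i))"
    by (simp only: prod_norm[symmetric] norm_power)
  also have "\<dots> \<le> (\<Prod>i\<in>UNIV. M ^ (n * l i))"
    using assms by (intro prod_mono conjI power_mono zero_le_power) auto
  also have "\<dots> = (M ^ n) ^ (\<Sum>i\<in>UNIV. l i)" by (simp add: power_sum power_mult)
  finally show ?thesis .
qed

section \<open>The Euler factors\<close>

lemma finite_higher_exponents: "finite higher_exponents"
proof (rule finite_subset)
  show "higher_exponents \<subseteq> PiE UNIV (\<lambda>_. {0, 1})" by (auto simp: higher_exponents_def)
qed (simp add: finite_PiE)

lemma sum_axis_exp: "(\<Sum>j\<in>UNIV. axis_exp i k j) = k"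
  by (simp add: axis_exp_def)

lemma zero_one_exponents:
  "PiE UNIV (\<lambda>_. {0, 1}) = insert (\<lambda>_. 0) (range (\<lambda>i. axis_exp i 1) \<union> higher_exponents)"
proof (intro equalityI subsetI)
  fix l :: "4 \<Rightarrow> nat" assume "l \<in> PiE UNIV (\<lambda>_. {0, 1})"
  then have l: "l i = 0 \<or> l i = 1" for i by (auto simp: PiE_def Pi_def)
  show "l \<in> insert (\<lambda>_. 0) (range (\<lambda>i. axis_exp i 1) \<union> higher_exponents)"
  proof (cases "l = (\<lambda>_. 0) \<or> (\<Sum>i\<in>UNIV. l i) > 1")
    case True
    moreover have "range l \<subseteq> {0, 1}" using l by (auto simp: image_subset_iff)
    ultimately show ?thesis unfolding higher_exponents_def by blast
  next
    case False
    then obtain i where i: "l i \<noteq> 0" by blast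
    have "(\<Sum>j\<in>UNIV. l j) = l i + (\<Sum>j\<in>UNIV - {i}. l j)" by (rule sum.remove) auto
    then have "(\<Sum>j\<in>UNIV - {i}. l j) = 0" using False i by linarith
    moreover have "l i = 1" using i l[of i] by simp
    ultimately have "l j = (if j = i then 1 else 0)" for j by auto
    then have "l = axis_exp i 1" by (simp add: axis_exp_def fun_eq_iff)
    then show ?thesis by blast
  qed
next
  fix l assume "l \<in> insert (\<lambda>_. 0) (range (\<lambda>i. axis_exp i 1) \<union> higher_exponents)"
  then show "l \<in> PiE UNIV (\<lambda>_. {0, 1})"
    by (auto simp: axis_exp_def higher_exponents_def PiE_def Pi_def)
qed

lemma sum_zero_one_exponents:
  fixes f :: "(4 \<Rightarrow> nat) \<Rightarrow> 'a::comm_monoid_add"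
  shows "(\<Sum>l\<in>PiE UNIV (\<lambda>_. {0, 1}). f l) = f (\<lambda>_. 0) + ((\<Sum>i\<in>UNIV. f (axis_exp i 1)) + (\<Sum>l\<in>higher_exponents. f l))"
proof -
  have "inj (\<lambda>i. axis_exp i 1)"
  proof (rule injI)
    fix i j assume *: "axis_exp i 1 = axis_exp j 1"
    show "i = j" using fun_cong[OF *, of i] by (simp add: axis_exp_def split: if_splits)
  qed
  then have r: "sum f (range (\<lambda>i. axis_exp i 1)) = (\<Sum>i\<in>UNIV. f (axis_exp i 1))" by (simp add: sum.reindex)
  have d: "range (\<lambda>i. axis_exp i 1) \<inter> higher_exponents = {}"
    using sum_axis_exp[where k = 1] by (auto simp: higher_exponents_def)
  have n: "(\<lambda>_. 0) \<notin> range (\<lambda>i. axis_exp i 1) \<union> higher_exponents"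
  proof
    assume "(\<lambda>_. 0) \<in> range (\<lambda>i. axis_exp i 1) \<union> higher_exponents"
    then show False
    proof
      assume "(\<lambda>_. 0) \<in> range (\<lambda>i. axis_exp i 1)"
      then obtain i where *: "(\<lambda>_. 0) = axis_exp i 1" by blast
      show False using fun_cong[OF *, of i] by (simp add: axis_exp_def)
    qed (simp add: higher_exponents_def)
  qed
  show ?thesis
    unfolding zero_one_exponents
    using n d by (simp add: sum.union_disjoint finite_higher_exponents r[simplified])
qed

lemma prod_one_minus_expand:
  fixes z :: "4 \<Rightarrow> 'a::comm_ring_1"
  shows "(\<Prod>i\<in>UNIV. 1 - z i) = (\<Sum>l\<in>PiE UNIV (\<lambda>_. {0, 1}). \<Prod>i\<in>UNIV. (- z i) ^ l i)"
proof -
  have "(\<Prod>i\<in>UNIV. 1 - z i) = (\<Prod>i\<in>UNIV. \<Sum>y\<in>{0, 1}. (- z i) ^ y)" by simp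
  also have "\<dots> = (\<Sum>l\<in>PiE UNIV (\<lambda>_. {0, 1}). \<Prod>i\<in>UNIV. (- z i) ^ l i)"
    by (rule prod_sum_PiE) auto
  finally show ?thesis .
qed

text \<open>
  Differentiating \<open>\<Prod>\<^sub>i (1 - s z\<^sub>i)\<close> in \<open>s\<close> multiplies the monomials by their degree.
\<close>

lemma sum_punctured_prod_expand:
  fixes z :: "4 \<Rightarrow> 'a::comm_ring_1"
  shows "(\<Sum>i\<in>UNIV. z i * (\<Prod>j\<in>UNIV - {i}. 1 - z j)) =
    - (\<Sum>l\<in>PiE UNIV (\<lambda>_. {0, 1}). of_nat (\<Sum>i\<in>UNIV. l i) * (\<Prod>i\<in>UNIV. (- z i) ^ l i))"
proof -
  have one: "z i * (\<Prod>j\<in>UNIV - {i}. 1 - z j) = - (\<Sum>l\<in>PiE UNIV (\<lambda>_. {0, 1}). of_nat (l i) * (\<Prod>j\<in>UNIV. (- z j) ^ l j))"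
    (is "_ = - ?R") for i
  proof -
    let ?f = "\<lambda>j y. (if j = i then of_nat y else 1) * (- z j) ^ y"
    have "(\<Prod>j\<in>UNIV. \<Sum>y\<in>{0, 1}. ?f j y) = (\<Sum>l\<in>PiE UNIV (\<lambda>_. {0, 1}). \<Prod>j\<in>UNIV. ?f j (l j))"
      by (rule prod_sum_PiE) auto
    also have "\<dots> = ?R" by (simp add: prod.distrib)
    finally have "?R = (\<Prod>j\<in>UNIV. \<Sum>y\<in>{0, 1}. ?f j y)" ..
    also have "\<dots> = (\<Sum>y\<in>{0, 1}. ?f i y) * (\<Prod>j\<in>UNIV - {i}. \<Sum>y\<in>{0, 1}. ?f j y)"
      by (rule prod.remove) auto
    also have "(\<Prod>j\<in>UNIV - {i}. \<Sum>y\<in>{0, 1}. ?f j y) = (\<Prod>j\<in>UNIV - {i}. 1 - z j)"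
      by (intro prod.cong) auto
    also have "(\<Sum>y\<in>{0, 1}. ?f i y) = - z i" by simp
    finally show ?thesis by simp
  qed
  show ?thesis
    unfolding one sum_negf of_nat_sum sum_distrib_right by (subst sum.swap) simp
qed

text \<open>
  The coefficient of a monomial of degree \<open>n\<close> in the Euler factor, with \<open>u = q^{-|c|}\<close>.
\<close>

definition euler_coeff :: "real \<Rightarrow> nat \<Rightarrow> real" where
  "euler_coeff u n = (- u) ^ n * ((1 - u) ^ 3 * (1 + 3 * u) - of_nat n * ((1 - u) ^ 3 * (1 + u)))"

text \<open>
  The number \<open>q^{-|c|}\<close>.
\<close>

definition point_size_inv :: "'k::{field,finite} closed_point \<Rightarrow> real" where
  "point_size_inv c = 1 / real CARD('k) ^ deg_pt c"

text \<open>
  The O-terms of the Euler factors.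
\<close>

definition euler_a :: "'k::{field,finite} closed_point \<Rightarrow> real" where
  "euler_a c = euler_coeff (point_size_inv c) 0 - 1"

definition euler_b :: "'k::{field,finite} closed_point \<Rightarrow> 4 \<Rightarrow> real" where
  "euler_b c i = euler_coeff (point_size_inv c) 1"

definition euler_e :: "'k::{field,finite} closed_point \<Rightarrow> (4 \<Rightarrow> nat) \<Rightarrow> real" where
  "euler_e c l = euler_coeff (point_size_inv c) (\<Sum>i\<in>UNIV. l i)"

lemma q_ge_2: "2 \<le> real CARD('k::{field,finite})"
  using card_field_ge_2[where ?'k = 'k] by linarith

lemma point_size_inv_bounds: "0 < point_size_inv (c :: 'k::{field,finite} closed_point)" "point_size_inv c \<le> 1 / 2"
proof -
  have "2 ^ 1 \<le> real CARD('k) ^ 1" using q_ge_2[where ?'k = 'k] by simp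
  also have "\<dots> \<le> real CARD('k) ^ deg_pt c"
    using q_ge_2[where ?'k = 'k] deg_pt_pos[of c] by (intro power_increasing) auto
  finally show "0 < point_size_inv c" "point_size_inv c \<le> 1 / 2"
    using q_ge_2[where ?'k = 'k] by (simp_all add: point_size_inv_def field_simps)
qed

lemma euler_factor_eq_sum:
  fixes c :: "'k::{field,finite} closed_point"
  shows "euler_factor euler_a euler_b euler_e t c = (\<Sum>l\<in>PiE UNIV (\<lambda>_. {0, 1}).
     of_real (euler_coeff (point_size_inv c) (\<Sum>i\<in>UNIV. l i)) * (\<Prod>i\<in>UNIV. (t $ i) ^ (deg_pt c * l i)))"
proof -
  have p: "(\<Prod>j\<in>UNIV. (t $ j) ^ (deg_pt c * axis_exp i 1 j)) = (t $ i) ^ deg_pt c" for i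
  proof -
    have "(\<Prod>j\<in>UNIV. (t $ j) ^ (deg_pt c * axis_exp i 1 j)) = (\<Prod>j\<in>UNIV. if j = i then (t $ j) ^ deg_pt c else 1)"
      by (intro prod.cong) (auto simp: axis_exp_def)
    then show ?thesis by simp
  qed
  show ?thesis
    unfolding sum_zero_one_exponents p sum_axis_exp
    by (simp add: euler_factor_def euler_a_def euler_b_def euler_e_def)
qed

text \<open>
  The Euler factor is the local sum with the denominators \<open>1 - z\<^sub>i\<close> cleared.
\<close>

lemma euler_factor_eq:
  fixes c :: "'k::{field,finite} closed_point" and t :: "complex ^ 4"
  defines "w \<equiv> complex_of_real (point_size_inv c)" and "z \<equiv> \<lambda>i. complex_of_real (point_size_inv c) * (t $ i) ^ deg_pt c"
  shows "euler_factor euler_a euler_b euler_e t c =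
    (1 - w) ^ 3 * (1 + 3 * w) * (\<Prod>i\<in>UNIV. 1 - z i) +
    (1 - w) ^ 3 * (1 + w) * (\<Sum>i\<in>UNIV. z i * (\<Prod>j\<in>UNIV - {i}. 1 - z j))"
proof -
  have z: "(\<Prod>i\<in>UNIV. (- z i) ^ l i) = (- w) ^ (\<Sum>i\<in>UNIV. l i) * (\<Prod>i\<in>UNIV. (t $ i) ^ (deg_pt c * l i))" for l
  proof -
    have "- z i = (- w) * (t $ i) ^ deg_pt c" for i by (simp add: z_def w_def)
    then have "(\<Prod>i\<in>UNIV. (- z i) ^ l i) = (\<Prod>i\<in>UNIV. (- w) ^ l i * (t $ i) ^ (deg_pt c * l i))"
      by (simp only: power_mult_distrib power_mult)
    then show ?thesis by (simp add: prod.distrib power_sum)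
  qed
  have "of_real (euler_coeff (point_size_inv c) n) = (- w) ^ n * ((1 - w) ^ 3 * (1 + 3 * w) - of_nat n * ((1 - w) ^ 3 * (1 + w)))" for n
    by (simp add: euler_coeff_def w_def)
  moreover have "(\<Sum>l\<in>S. (s l * (A - n l * B)) * p l) = A * (\<Sum>l\<in>S. s l * p l) + B * - (\<Sum>l\<in>S. n l * (s l * p l))"
    for A B :: complex and s n p and S :: "(4 \<Rightarrow> nat) set"
    by (simp add: sum_distrib_left sum_subtractf[symmetric] algebra_simps)
  ultimately show ?thesis
    unfolding euler_factor_eq_sum prod_one_minus_expand sum_punctured_prod_expand z by simp
qed

lemma euler_coeff_bound:
  assumes u: "0 < u" "u \<le> 1 / 2" and n: "n \<le> 4"
  shows "\<bar>euler_coeff u n\<bar> \<le> 17 * u ^ n"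
proof -
  have c: "0 \<le> (1 - u) ^ 3" "(1 - u) ^ 3 \<le> 1" using u by (auto intro: power_le_one)
  have "\<bar>(1 + 3 * u) - of_nat n * (1 + u)\<bar> \<le> \<bar>1 + 3 * u\<bar> + \<bar>of_nat n * (1 + u)\<bar>" by (rule abs_triangle_ineq4)
  also have "\<bar>1 + 3 * u\<bar> \<le> 3" using u by simp
  also have "\<bar>of_nat n * (1 + u)\<bar> \<le> 4 * 2" unfolding abs_mult using u n by (intro mult_mono) auto
  finally have i: "\<bar>(1 + 3 * u) - of_nat n * (1 + u)\<bar> \<le> 17" by simp
  have "\<bar>euler_coeff u n\<bar> = u ^ n * ((1 - u) ^ 3 * \<bar>(1 + 3 * u) - of_nat n * (1 + u)\<bar>)"
  proof -
    have "euler_coeff u n = (- u) ^ n * ((1 - u) ^ 3 * ((1 + 3 * u) - of_nat n * (1 + u)))"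
      by (simp add: euler_coeff_def algebra_simps)
    then show ?thesis using u c by (simp add: abs_mult power_abs)
  qed
  also have "\<dots> \<le> u ^ n * (1 * 17)" using u c i by (intro mult_left_mono mult_mono) auto
  finally show ?thesis by simp
qed

lemma euler_coeff_0_bound:
  assumes u: "0 < u" "u \<le> 1 / 2"
  shows "\<bar>euler_coeff u 0 - 1\<bar> \<le> 17 * u ^ 2"
proof -
  have "euler_coeff u 0 - 1 = (- 6 + 8 * u - 3 * u ^ 2) * u ^ 2"
    by (simp add: euler_coeff_def algebra_simps eval_nat_numeral)
  then have "\<bar>euler_coeff u 0 - 1\<bar> = \<bar>- 6 + 8 * u - 3 * u ^ 2\<bar> * u ^ 2" by (simp add: abs_mult)
  also have "\<bar>- 6 + 8 * u - 3 * u ^ 2\<bar> \<le> 17"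
    unfolding abs_le_iff using u power_le_one[of u 2] zero_le_power2[of u] by (intro conjI; linarith)
  finally show ?thesis by (simp add: mult_right_mono)
qed

lemma euler_coeff_1_bound:
  assumes u: "0 < u" "u \<le> 1 / 2"
  shows "\<bar>euler_coeff u 1\<bar> \<le> 17 * u ^ 2"
proof -
  have "euler_coeff u 1 = - 2 * (1 - u) ^ 3 * u ^ 2"
    by (simp add: euler_coeff_def algebra_simps eval_nat_numeral)
  then have "\<bar>euler_coeff u 1\<bar> = 2 * (1 - u) ^ 3 * u ^ 2" using u by (simp add: abs_mult)
  also have "2 * (1 - u) ^ 3 * u ^ 2 \<le> 2 * 1 * u ^ 2"
    using u by (intro mult_right_mono mult_left_mono power_le_one) auto
  also have "\<dots> \<le> 17 * u ^ 2" by simp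
  finally show ?thesis .
qed

text \<open>
  The constant 17 is the sum of the absolute values of the coefficients of \<open>- 6 u^2 + 8 u^3 - 3 u^4\<close>, the
  constant term minus 1; it is large enough for the other coefficients as well.
\<close>

lemma euler_coeffs_bounded_17:
  "euler_coeffs_bounded 17 euler_a (euler_b :: 'k::{field,finite} closed_point \<Rightarrow> _) euler_e"
  unfolding euler_coeffs_bounded_def
proof (intro allI conjI ballI)
  fix c :: "'k closed_point"
  note u = point_size_inv_bounds[of c]
  have pow: "17 * point_size_inv c ^ n = 17 / real CARD('k) ^ (n * deg_pt c)" for n
    by (simp add: point_size_inv_def power_one_over power_mult mult.commute[of n])
  show "\<bar>euler_a c\<bar> \<le> 17 / real CARD('k) ^ (2 * deg_pt c)"
    using euler_coeff_0_bound[OF u] by (simp only: euler_a_def pow)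
  show "\<bar>euler_b c i\<bar> \<le> 17 / real CARD('k) ^ (2 * deg_pt c)" for i
    using euler_coeff_1_bound[OF u] by (simp only: euler_b_def pow)
  fix l assume l: "l \<in> higher_exponents"
  then have "l i \<le> 1" for i by (auto simp: higher_exponents_def dest: rangeI[of l i, THEN subsetD[rotated]])
  then have "(\<Sum>i\<in>UNIV. l i) \<le> (\<Sum>i\<in>(UNIV :: 4 set). 1)" by (intro sum_mono)
  then have "(\<Sum>i\<in>UNIV. l i) \<le> 4" by simp
  from euler_coeff_bound[OF u this] show "\<bar>euler_e c l\<bar> \<le> 17 / real CARD('k) ^ ((\<Sum>i\<in>UNIV. l i) * deg_pt c)"
    by (simp only: euler_e_def pow)
qed

text \<open>
  Since \<open>M \<ge> 1\<close>, the terms of degree 0 and 1 are bounded by \<open>C (M / q)^{2|c|}\<close>; since \<open>M \<le> q\<close>, so are the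
  terms of degree at least 2.
\<close>

lemma norm_euler_factor_minus_1:
  fixes c :: "'k::{field,finite} closed_point" and t :: "complex ^ 4"
  assumes bd: "euler_coeffs_bounded C a b e"
    and M: "1 \<le> M" "M \<le> real CARD('k)" and t: "\<And>i. norm (t $ i) \<le> M"
  shows "norm (euler_factor a b e t c - 1) \<le> C * (5 + real (card higher_exponents)) * ((M / real CARD('k)) ^ 2) ^ deg_pt c"
proof -
  let ?q = "real CARD('k)" and ?n = "deg_pt c"
  define B where "B = ((M / ?q) ^ 2) ^ ?n"
  have q: "0 < ?q" "1 \<le> ?q" using q_ge_2[where ?'k = 'k] by auto
  have C: "0 \<le> C"
  proof -
    have "0 \<le> C / ?q ^ (2 * ?n)" using bd abs_ge_zero order_trans unfolding euler_coeffs_bounded_def by blast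
    moreover have "0 < ?q ^ (2 * ?n)" using q by simp
    ultimately show ?thesis by (simp only: zero_le_divide_iff) linarith
  qed
  have B_eq: "B = (M ^ ?n) ^ 2 / ?q ^ (2 * ?n)"
    by (simp add: B_def power_divide power_mult[symmetric] mult.commute)
  have Mn: "1 \<le> M ^ ?n" using M by simp
  have a: "norm (complex_of_real (a c)) \<le> C * B"
  proof -
    have "norm (complex_of_real (a c)) \<le> C / ?q ^ (2 * ?n) * 1"
      using bd by (simp add: euler_coeffs_bounded_def)
    also have "\<dots> \<le> C / ?q ^ (2 * ?n) * (M ^ ?n) ^ 2"
      using Mn C q by (intro mult_left_mono) (auto intro: one_le_power)
    finally show ?thesis by (simp add: B_eq)
  qed
  have b: "norm (of_real (b c i) * (t $ i) ^ ?n) \<le> C * B" for i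
  proof -
    have "norm (of_real (b c i) * (t $ i) ^ ?n) = \<bar>b c i\<bar> * norm (t $ i) ^ ?n" by (simp add: norm_mult norm_power)
    also have "\<dots> \<le> (C / ?q ^ (2 * ?n)) * M ^ ?n"
      using bd t C q by (intro mult_mono power_mono) (auto simp: euler_coeffs_bounded_def)
    also have "\<dots> \<le> (C / ?q ^ (2 * ?n)) * (M ^ ?n) ^ 2"
      using Mn C q by (intro mult_left_mono) (auto simp: power2_eq_square)
    finally show ?thesis by (simp add: B_eq)
  qed
  have e: "norm (of_real (e c l) * (\<Prod>i\<in>UNIV. (t $ i) ^ (?n * l i))) \<le> C * B" if l: "l \<in> higher_exponents" for l
  proof -
    let ?s = "\<Sum>i\<in>UNIV. l i"
    have s: "2 \<le> ?s" using l by (simp add: higher_exponents_def)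
    have r: "0 \<le> (M / ?q) ^ ?n" "(M / ?q) ^ ?n \<le> 1" using M q by (auto intro!: power_le_one)
    have "norm (of_real (e c l) * (\<Prod>i\<in>UNIV. (t $ i) ^ (?n * l i))) \<le> (C / ?q ^ (?s * ?n)) * (M ^ ?n) ^ ?s"
      unfolding norm_mult using bd l norm_prod_le_pow[OF t, of ?n l] M C q
      by (intro mult_mono) (auto simp: euler_coeffs_bounded_def)
    also have "\<dots> = C * ((M / ?q) ^ ?n) ^ ?s"
      by (simp add: power_divide power_mult[symmetric] mult.commute)
    also have "\<dots> \<le> C * ((M / ?q) ^ ?n) ^ 2"
      using r s C by (intro mult_left_mono power_decreasing) auto
    also have "((M / ?q) ^ ?n) ^ 2 = B" by (simp add: B_def power_mult[symmetric] mult.commute)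
    finally show ?thesis .
  qed
  have "euler_factor a b e t c - 1 = (of_real (a c) + (\<Sum>i\<in>UNIV. of_real (b c i) * (t $ i) ^ ?n)) +
     (\<Sum>l\<in>higher_exponents. of_real (e c l) * (\<Prod>i\<in>UNIV. (t $ i) ^ (?n * l i)))"
    by (simp add: euler_factor_def)
  also have "norm \<dots> \<le> (C * B + (\<Sum>i\<in>(UNIV :: 4 set). C * B)) + (\<Sum>l\<in>higher_exponents. C * B)"
    by (intro norm_triangle_le add_mono a sum_norm_le b e)
  also have "\<dots> = C * (5 + real (card higher_exponents)) * B"
    by (simp add: algebra_simps)
  finally show ?thesis by (simp add: B_def)
qed

lemma summable_on_euler_bound:
  assumes "1 \<le> M" "M ^ 2 < real CARD('k::{field,finite})"
  shows "(\<lambda>c :: 'k closed_point. K * ((M / real CARD('k)) ^ 2) ^ deg_pt c) summable_on UNIV"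
proof (intro summable_on_cmult_right summable_on_points)
  have "0 < real CARD('k)" by simp
  then show "real CARD('k) * (M / real CARD('k))\<^sup>2 < 1"
    using assms by (simp add: power2_eq_square field_simps)
qed simp

lemma euler_factor_at_1: "euler_factor euler_a euler_b euler_e (\<chi> i. 1) c = limit_factor c"
proof -
  define w where "w = complex_of_real (point_size_inv c)"
  have "euler_factor euler_a euler_b euler_e (\<chi> i. 1) c =
     (1 - w) ^ 3 * (1 + 3 * w) * (1 - w) ^ 4 + (1 - w) ^ 3 * (1 + w) * (4 * (w * (1 - w) ^ 3))"
    unfolding euler_factor_eq by (simp add: w_def[symmetric] card_Diff_singleton)
  also have "\<dots> = (1 - w) ^ 6 * (1 + 6 * w + w ^ 2)"
    by (simp add: algebra_simps eval_nat_numeral)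
  also have "\<dots> = limit_factor c"
    by (simp add: limit_factor_def w_def point_size_inv_def Let_def)
  finally show ?thesis .
qed

section \<open>The series as a sum over families of local pairs\<close>

text \<open>
  The local pair at the points outside the support of \<open>x\<close>.
\<close>

abbreviation trivial_pair :: "(4 \<Rightarrow> nat) \<times> (coatom \<Rightarrow> nat)" where
  "trivial_pair \<equiv> (\<lambda>_. 0, \<lambda>_. 0)"

lemma zero_in_jets: "(\<lambda>_. 0) \<in> jets" by (simp add: jets_def)

lemma trivial_pair_in: "trivial_pair \<in> local_pairs"
  by (simp add: local_pairs_def zero_in_jets)

lemma diag_of_in_jets:
  assumes "\<forall>i j. i \<noteq> j \<longrightarrow> v i = 0 \<or> v j = 0"
  shows "diag_of v \<in> jets"
proof -
  have "min (v i) (v j) = 0" if "i \<noteq> j" for i j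
    using assms[rule_format, OF that] by auto
  then show ?thesis by (simp add: jets_def diag_of_def)
qed

lemma local_pairs_trivial:
  assumes "p \<in> local_pairs" "snd p = (\<lambda>_. 0)" shows "p = trivial_pair"
proof -
  obtain v y where p: "p = (v, y)" by (cases p)
  have "v i = 0" for i
    using assms le_funD[of "diag_of v" y "Diag i"] by (auto simp: local_pairs_def p diag_of_def)
  then show ?thesis using assms(2) by (auto simp: p)
qed

context two_pencils
begin

text \<open>
  The pairs \<open>w \<le> x\<close> for all degree vectors at once.
\<close>

definition all_pairs :: "((4 \<Rightarrow> 'k::field closed_point multiset) \<times> (('v \<times> 'w) set \<Rightarrow> 'k closed_point subscheme)) set" where
  "all_pairs = {(w, x). (\<forall>i j. i \<noteq> j \<longrightarrow> set_mset (w i) \<inter> set_mset (w j) = {}) \<and> x \<in> QJB L1 L2 \<and> to_QJB L1 L2 w \<le> x}"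

text \<open>
  The global pair with given local pairs.
\<close>

definition to_pair :: "('k::field closed_point \<Rightarrow> (4 \<Rightarrow> nat) \<times> (coatom \<Rightarrow> nat)) \<Rightarrow>
    (4 \<Rightarrow> 'k closed_point multiset) \<times> (('v \<times> 'w) set \<Rightarrow> 'k closed_point subscheme)" where
  "to_pair \<sigma> = (\<lambda>i. Abs_multiset (\<lambda>c. fst (\<sigma> c) i), of_jets (\<lambda>c. snd (\<sigma> c)))"

lemma count_to_pair:
  assumes "\<sigma> \<in> finsupp local_pairs trivial_pair"
  shows "count (fst (to_pair \<sigma>) i) c = fst (\<sigma> c) i"
proof -
  have "{c. 0 < fst (\<sigma> c) i} \<subseteq> {c. \<sigma> c \<noteq> trivial_pair}" by auto
  then have "finite {c. 0 < fst (\<sigma> c) i}" using finsupp_memD(2)[OF assms] finite_subset by blast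
  then show ?thesis by (simp add: to_pair_def count_Abs_multiset)
qed

lemma diag_jets_to_pair:
  assumes "\<sigma> \<in> finsupp local_pairs trivial_pair"
  shows "diag_jets (fst (to_pair \<sigma>)) = (\<lambda>c. diag_of (fst (\<sigma> c)))"
  by (intro ext) (simp add: diag_jets_def diag_of_def count_to_pair[OF assms] split: coatom.splits)

lemma finsupp_local_pairsD:
  assumes "\<sigma> \<in> finsupp local_pairs trivial_pair"
  shows "\<forall>i j. i \<noteq> j \<longrightarrow> fst (\<sigma> c) i = 0 \<or> fst (\<sigma> c) j = 0" "snd (\<sigma> c) \<in> jets" "diag_of (fst (\<sigma> c)) \<le> snd (\<sigma> c)"
  using finsupp_memD(1)[OF assms, of c] by (simp_all add: local_pairs_def case_prod_unfold)

lemma snd_eq_zero_iff: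
  assumes "\<sigma> \<in> finsupp local_pairs trivial_pair"
  shows "snd (\<sigma> c) = (\<lambda>_. 0) \<longleftrightarrow> \<sigma> c = trivial_pair"
  using local_pairs_trivial[OF finsupp_memD(1)[OF assms, of c]] by auto

lemma to_pair_saturated:
  assumes "\<sigma> \<in> finsupp local_pairs trivial_pair"
  shows "(\<lambda>c. snd (\<sigma> c)) \<in> saturated" "(\<lambda>c. diag_of (fst (\<sigma> c))) \<in> saturated"
proof -
  have fin: "finite {c. \<sigma> c \<noteq> trivial_pair}" by (rule finsupp_memD(2)[OF assms])
  have "finite {c. snd (\<sigma> c) \<noteq> (\<lambda>_. 0)}"
    by (rule finite_subset[OF _ fin]) (simp add: snd_eq_zero_iff[OF assms])
  then show "(\<lambda>c. snd (\<sigma> c)) \<in> saturated" using finsupp_local_pairsD(2)[OF assms] by (auto simp: finsupp_def)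
  have "finite {c. diag_of (fst (\<sigma> c)) \<noteq> (\<lambda>_. 0)}"
    by (rule finite_subset[OF _ fin]) auto
  then show "(\<lambda>c. diag_of (fst (\<sigma> c))) \<in> saturated"
    using diag_of_in_jets[OF finsupp_local_pairsD(1)[OF assms]] by (auto simp: finsupp_def)
qed

lemma bij_to_pair: "bij_betw to_pair (finsupp local_pairs trivial_pair) (all_pairs :: (_ \<times> (_ \<Rightarrow> 'k::field closed_point subscheme)) set)"
  unfolding bij_betw_def
proof
  show "inj_on to_pair (finsupp local_pairs trivial_pair :: ('k closed_point \<Rightarrow> _) set)"
  proof (rule inj_onI)
    fix \<sigma> \<tau> :: "'k closed_point \<Rightarrow> (4 \<Rightarrow> nat) \<times> (coatom \<Rightarrow> nat)"
    assume s: "\<sigma> \<in> finsupp local_pairs trivial_pair" and t: "\<tau> \<in> finsupp local_pairs trivial_pair"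
      and eq: "to_pair \<sigma> = to_pair \<tau>"
    have "fst (\<sigma> c) i = fst (\<tau> c) i" for c i
      using eq by (simp only: count_to_pair[OF s, symmetric] count_to_pair[OF t, symmetric])
    then have 1: "fst (\<sigma> c) = fst (\<tau> c)" for c by blast
    have "of_jets (\<lambda>c. snd (\<sigma> c)) = of_jets (\<lambda>c. snd (\<tau> c))" using eq by (simp add: to_pair_def)
    then have "(\<lambda>c. snd (\<sigma> c)) \<le> (\<lambda>c. snd (\<tau> c))" "(\<lambda>c. snd (\<tau> c)) \<le> (\<lambda>c. snd (\<sigma> c))"
      using of_jets_le_iff[OF to_pair_saturated(1)[OF s] to_pair_saturated(1)[OF t]]
        of_jets_le_iff[OF to_pair_saturated(1)[OF t] to_pair_saturated(1)[OF s]] by simp_all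
    then have "(\<lambda>c. snd (\<sigma> c)) = (\<lambda>c. snd (\<tau> c))" by (rule order_antisym)
    then have 2: "snd (\<sigma> c) = snd (\<tau> c)" for c by (rule fun_cong)
    show "\<sigma> = \<tau>" by (rule ext) (simp add: prod_eq_iff 1 2)
  qed
  show "to_pair ` finsupp local_pairs trivial_pair = (all_pairs :: (_ \<times> (_ \<Rightarrow> 'k closed_point subscheme)) set)"
  proof (intro equalityI subsetI)
    fix p assume "p \<in> (to_pair ` finsupp local_pairs trivial_pair :: (_ \<times> (_ \<Rightarrow> 'k closed_point subscheme)) set)"
    then obtain \<sigma> :: "'k closed_point \<Rightarrow> _" where s: "\<sigma> \<in> finsupp local_pairs trivial_pair" and p: "p = to_pair \<sigma>" by blast
    have "set_mset (fst p i) \<inter> set_mset (fst p j) = {}" if "i \<noteq> j" for i j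
    proof (rule equals0I)
      fix c assume "c \<in> set_mset (fst p i) \<inter> set_mset (fst p j)"
      then have "0 < count (fst p i) c" "0 < count (fst p j) c" by (simp_all add: count_greater_zero_iff)
      then show False using finsupp_local_pairsD(1)[OF s, rule_format, OF that, of c] by (simp add: p count_to_pair[OF s])
    qed
    moreover have "snd p \<in> QJB L1 L2"
      using of_jets_in_QJB[OF to_pair_saturated(1)[OF s]] by (simp add: p to_pair_def)
    moreover have "to_QJB L1 L2 (fst p) \<le> snd p"
    proof -
      have "of_jets (\<lambda>c. diag_of (fst (\<sigma> c))) \<le> of_jets (\<lambda>c. snd (\<sigma> c))"
        unfolding of_jets_le_iff[OF to_pair_saturated(2)[OF s] to_pair_saturated(1)[OF s]]
        using finsupp_local_pairsD(3)[OF s] by (intro le_funI) (simp add: le_fun_def)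
      then show ?thesis
        unfolding to_QJB_eq p diag_jets_to_pair[OF s] by (simp add: to_pair_def)
    qed
    ultimately show "p \<in> all_pairs" by (simp add: all_pairs_def case_prod_unfold)
  next
    fix p :: "(4 \<Rightarrow> 'k closed_point multiset) \<times> (('v \<times> 'w) set \<Rightarrow> 'k closed_point subscheme)"
    assume "p \<in> all_pairs"
    then obtain w x where p: "p = (w, x)" and w: "\<And>i j. i \<noteq> j \<Longrightarrow> set_mset (w i) \<inter> set_mset (w j) = {}"
      and x: "x \<in> QJB L1 L2" and le: "to_QJB L1 L2 w \<le> x" unfolding all_pairs_def by blast
    obtain m where m: "m \<in> saturated" and xm: "x = of_jets m" using x unfolding QJB_eq by blast
    define \<sigma> where "\<sigma> c = (\<lambda>i. count (w i) c, m c)" for c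
    have at_most: "\<forall>i j. i \<noteq> j \<longrightarrow> count (w i) c = 0 \<or> count (w j) c = 0" for c
    proof (intro allI impI)
      fix i j :: 4 assume "i \<noteq> j"
      from w[OF this] have "c \<notin># w i \<or> c \<notin># w j" by blast
      then show "count (w i) c = 0 \<or> count (w j) c = 0" by (simp add: count_eq_zero_iff)
    qed
    have dj: "diag_jets w c = diag_of (\<lambda>i. count (w i) c)" for c
      by (rule ext) (simp add: diag_jets_def diag_of_def split: coatom.splits)
    have dsat: "diag_jets w \<in> saturated"
    proof -
      have "diag_jets w c \<in> jets" for c unfolding dj by (rule diag_of_in_jets[OF at_most])
      moreover have "finite {c. diag_jets w c \<noteq> (\<lambda>_. 0)}"
      proof (rule finite_subset)
        show "{c. diag_jets w c \<noteq> (\<lambda>_. 0)} \<subseteq> (\<Union>i. set_mset (w i))"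
        proof
          fix c assume c: "c \<in> {c. diag_jets w c \<noteq> (\<lambda>_. 0)}"
          then obtain s where "diag_jets w c s \<noteq> 0" by blast
          then obtain i where "count (w i) c \<noteq> 0" by (auto simp: diag_jets_def split: coatom.splits)
          then show "c \<in> (\<Union>i. set_mset (w i))" by (auto simp: count_eq_zero_iff)
        qed
      qed auto
      ultimately show ?thesis by (auto simp: finsupp_def)
    qed
    have "diag_jets w \<le> m" using le unfolding xm to_QJB_eq of_jets_le_iff[OF dsat m] .
    then have "\<sigma> c \<in> local_pairs" for c
      using at_most[of c] saturatedD(1)[OF m, of c] by (simp add: \<sigma>_def local_pairs_def dj[symmetric] le_fun_def)
    moreover have "finite {c. \<sigma> c \<noteq> trivial_pair}"
    proof (rule finite_subset)
      show "{c. \<sigma> c \<noteq> trivial_pair} \<subseteq> {c. m c \<noteq> (\<lambda>_. 0)}"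
      proof
        fix c assume "c \<in> {c. \<sigma> c \<noteq> trivial_pair}"
        then show "c \<in> {c. m c \<noteq> (\<lambda>_. 0)}"
          using local_pairs_trivial[OF \<open>\<sigma> c \<in> local_pairs\<close>] by (auto simp: \<sigma>_def)
      qed
    qed (rule saturatedD(2)[OF m])
    ultimately have "\<sigma> \<in> finsupp local_pairs trivial_pair" by (auto simp: finsupp_def)
    moreover have "to_pair \<sigma> = p" by (simp add: to_pair_def \<sigma>_def p xm count_inverse)
    ultimately show "p \<in> to_pair ` finsupp local_pairs trivial_pair" by blast
  qed
qed

lemma moebius_to_pair:
  fixes \<sigma> :: "'k::field closed_point \<Rightarrow> (4 \<Rightarrow> nat) \<times> (coatom \<Rightarrow> nat)"
  assumes s: "\<sigma> \<in> finsupp local_pairs trivial_pair"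
  shows "moebius (QJB L1 L2) (to_QJB L1 L2 (fst (to_pair \<sigma>))) (snd (to_pair \<sigma>)) =
    (\<Prod>c | \<sigma> c \<noteq> trivial_pair. moebius jets (diag_of (fst (\<sigma> c))) (snd (\<sigma> c)))"
proof -
  let ?w = "\<lambda>c. diag_of (fst (\<sigma> c))" and ?m = "\<lambda>c. snd (\<sigma> c)"
  have sat: "?m \<in> saturated" "?w \<in> saturated" using to_pair_saturated[OF s] by auto
  have le: "?w \<le> ?m" using finsupp_local_pairsD(3)[OF s] by (intro le_funI) (simp add: le_fun_def)
  have least: "(\<lambda>_. 0) \<le> l" for l :: "coatom \<Rightarrow> nat" by (simp add: le_fun_def)
  have fin: "finite {y \<in> jets. y \<le> l}" for l
    using finite_jets_below[of "\<lambda>_. True" l] by simp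
  have "moebius (QJB L1 L2) (to_QJB L1 L2 (fst (to_pair \<sigma>))) (snd (to_pair \<sigma>)) =
      moebius (of_jets ` (saturated :: ('k closed_point \<Rightarrow> _) set)) (of_jets ?w) (of_jets ?m)"
    unfolding QJB_eq to_QJB_eq diag_jets_to_pair[OF s] by (simp add: to_pair_def)
  also have "\<dots> = moebius saturated ?w ?m"
  proof (rule moebius_image[OF of_jets_le_iff _ sat(2,1) le])
    fix x :: "'k closed_point \<Rightarrow> coatom \<Rightarrow> nat" assume x: "x \<in> saturated"
    show "finite {y \<in> saturated. ?w \<le> y \<and> y \<le> x}"
    proof (cases "?w \<le> x")
      case True
      show ?thesis by (rule moebius_finsupp(2)[OF least zero_in_jets fin sat(2) x True])
    next
      case False
      then have "{y \<in> saturated. ?w \<le> y \<and> y \<le> x} = {}" using order_trans by blast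
      then show ?thesis by (simp only: finite.emptyI)
    qed
  qed
  also have "\<dots> = (\<Prod>c | ?m c \<noteq> (\<lambda>_. 0). moebius jets (?w c) (?m c))"
    by (rule moebius_finsupp(1)[OF least zero_in_jets fin sat(2,1) le])
  also have "{c. ?m c \<noteq> (\<lambda>_. 0)} = {c. \<sigma> c \<noteq> trivial_pair}" by (simp only: snd_eq_zero_iff[OF s])
  finally show ?thesis .
qed

text \<open>
  The contribution of a pair to the series.
\<close>

definition pair_term :: "complex ^ 4 \<Rightarrow> (4 \<Rightarrow> 'k::{field,finite} closed_point multiset) \<times> (('v \<times> 'w) set \<Rightarrow> 'k closed_point subscheme) \<Rightarrow> complex" where
  "pair_term t p = of_real (Zterm L1 L2 p) * (\<Prod>i\<in>UNIV. (of_nat CARD('k) * t $ i) ^ deg_div (fst p i))"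

lemma pair_term_to_pair:
  fixes \<sigma> :: "'k::{field,finite} closed_point \<Rightarrow> (4 \<Rightarrow> nat) \<times> (coatom \<Rightarrow> nat)" and t :: "complex ^ 4"
  assumes s: "\<sigma> \<in> finsupp local_pairs trivial_pair"
  shows "pair_term t (to_pair \<sigma>) = (\<Prod>c | \<sigma> c \<noteq> trivial_pair.
     pair_weight (point_size_inv c) (\<lambda>i. (of_nat CARD('k) * t $ i) ^ deg_pt c) (\<sigma> c))"
proof -
  let ?A = "{c. \<sigma> c \<noteq> trivial_pair}" and ?q = "real CARD('k)" and ?M = "\<lambda>c. moebius jets (diag_of (fst (\<sigma> c))) (snd (\<sigma> c))"
  have A: "finite ?A" by (rule finsupp_memD(2)[OF s])
  have "gamma L1 L2 (snd (to_pair \<sigma>)) = (\<Sum>c | snd (\<sigma> c) \<noteq> (\<lambda>_. 0). deg_pt c * jet_gamma (snd (\<sigma> c)))"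
    using gamma_of_jets[OF to_pair_saturated(1)[OF s]] by (simp add: to_pair_def)
  also have "{c. snd (\<sigma> c) \<noteq> (\<lambda>_. 0)} = ?A" by (simp only: snd_eq_zero_iff[OF s])
  finally have g: "gamma L1 L2 (snd (to_pair \<sigma>)) = (\<Sum>c\<in>?A. deg_pt c * jet_gamma (snd (\<sigma> c)))" .
  have deg: "deg_div (fst (to_pair \<sigma>) i) = (\<Sum>c\<in>?A. deg_pt c * fst (\<sigma> c) i)" for i
  proof -
    have "set_mset (fst (to_pair \<sigma>) i) \<subseteq> ?A"
    proof
      fix c assume "c \<in> set_mset (fst (to_pair \<sigma>) i)"
      then have "0 < count (fst (to_pair \<sigma>) i) c" by (simp add: count_greater_zero_iff)
      then show "c \<in> ?A" by (auto simp: count_to_pair[OF s])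
    qed
    from sum_mset_eq_sum_count[OF A this, of deg_pt] show ?thesis
      by (simp add: deg_div_def count_to_pair[OF s])
  qed
  have "(\<Prod>i\<in>UNIV. (of_nat CARD('k) * t $ i) ^ deg_div (fst (to_pair \<sigma>) i)) =
      (\<Prod>i\<in>UNIV. \<Prod>c\<in>?A. ((of_nat CARD('k) * t $ i) ^ deg_pt c) ^ fst (\<sigma> c) i)"
    by (simp add: deg power_sum power_mult)
  also have "\<dots> = (\<Prod>c\<in>?A. \<Prod>i\<in>UNIV. ((of_nat CARD('k) * t $ i) ^ deg_pt c) ^ fst (\<sigma> c) i)" by (rule prod.swap)
  finally have p: "(\<Prod>i\<in>UNIV. (of_nat CARD('k) * t $ i) ^ deg_div (fst (to_pair \<sigma>) i)) = \<dots>" .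
  have "Zterm L1 L2 (to_pair \<sigma>) = of_int (\<Prod>c\<in>?A. ?M c) / ?q ^ (\<Sum>c\<in>?A. deg_pt c * jet_gamma (snd (\<sigma> c)))"
    by (simp only: Zterm_def case_prod_unfold moebius_to_pair[OF s] g)
  also have "\<dots> = (\<Prod>c\<in>?A. of_int (?M c) * point_size_inv c ^ jet_gamma (snd (\<sigma> c)))"
    by (simp add: power_sum power_mult prod.distrib point_size_inv_def power_one_over prod_dividef)
  finally have z: "Zterm L1 L2 (to_pair \<sigma>) = \<dots>" .
  show ?thesis
    unfolding pair_term_def z p
    by (simp add: pair_weight_def case_prod_unfold prod.distrib)
qed

lemma Uk_le_QJB_bij:
  "bij_betw snd (SIGMA k:UNIV. (Uk_le_QJB L1 L2 k :: (_ \<times> (_ \<Rightarrow> 'k::field closed_point subscheme)) set)) all_pairs"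
proof (rule bij_betw_byWitness[where f' = "\<lambda>p. (\<lambda>i. deg_div (fst p i), p)"])
  show "\<forall>a\<in>(SIGMA k:UNIV. (Uk_le_QJB L1 L2 k :: (_ \<times> (_ \<Rightarrow> 'k closed_point subscheme)) set)). (\<lambda>i. deg_div (fst (snd a) i), snd a) = a"
    by (auto simp: Uk_le_QJB_def Uk_def)
  show "snd ` (SIGMA k:UNIV. (Uk_le_QJB L1 L2 k :: (_ \<times> (_ \<Rightarrow> 'k closed_point subscheme)) set)) \<subseteq> all_pairs"
    by (rule image_subsetI, elim SigmaE) (simp add: Uk_le_QJB_def Uk_def all_pairs_def case_prod_unfold)
  show "(\<lambda>p. (\<lambda>i. deg_div (fst p i), p)) ` all_pairs \<subseteq>
      (SIGMA k:UNIV. (Uk_le_QJB L1 L2 k :: (_ \<times> (_ \<Rightarrow> 'k closed_point subscheme)) set))"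
    by (rule image_subsetI) (simp add: Uk_le_QJB_def Uk_def all_pairs_def case_prod_unfold mem_Sigma_iff split_beta)
qed simp

end

text \<open>
  Two distinct lines meet in 0, because a line is spanned by each of its nonzero elements.
\<close>

lemma two_pencils_line:
  fixes sc :: "'k::field \<Rightarrow> 'v::ab_group_add \<Rightarrow> 'v"
  assumes "plane_with_four_lines sc L"
  shows "0 \<in> L i" "L i \<noteq> {0}" "L i \<noteq> UNIV" "i \<noteq> j \<Longrightarrow> L i \<inter> L j = {0}"
proof -
  interpret vector_space sc using assms by (simp add: plane_with_four_lines_def)
  have sub: "subspace (L i)" and dim: "dim (L i) = 1" for i
    using assms by (auto simp: plane_with_four_lines_def)
  have U: "dim (UNIV :: 'v set) = 2" and inj: "inj L" using assms by (auto simp: plane_with_four_lines_def)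
  show zero: "0 \<in> L i" for i by (rule subspace_0[OF sub])
  show "L i \<noteq> UNIV" using U dim[of i] by auto
  have gen: "\<exists>b. b \<noteq> 0 \<and> L i = span {b}" for i
  proof -
    obtain B where B: "B \<subseteq> L i" "independent B" "L i \<subseteq> span B" "card B = dim (L i)" by (rule basis_exists)
    then obtain b where b: "B = {b}" using dim card_1_singletonE by metis
    have "b \<noteq> 0" using B(2) b dependent_zero by blast
    moreover have "span B \<subseteq> L i" using B(1) sub span_minimal by blast
    ultimately show ?thesis using B(3) b by blast
  qed
  have span_eq: "L i = span {x}" if x: "x \<in> L i" "x \<noteq> 0" for x i
  proof -
    obtain b where b: "b \<noteq> 0" "L i = span {b}" using gen by blast
    obtain k where k: "x = sc k b" using x(1) unfolding b(2) span_singleton by blast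
    have "k \<noteq> 0" using x(2) k by auto
    then have "b = sc (inverse k) x" by (simp add: k)
    then have "b \<in> span {x}" unfolding span_singleton by blast
    then have "span {b} \<subseteq> span {x}" by (intro span_minimal) auto
    moreover have "span {x} \<subseteq> span {b}" using x(1) b(2) by (intro span_minimal) auto
    ultimately show ?thesis using b(2) by blast
  qed
  obtain b where "b \<noteq> 0" "L i = span {b}" using gen by blast
  then show "L i \<noteq> {0}" using span_base[of b "{b}"] by auto
  show "L i \<inter> L j = {0}" if "i \<noteq> j"
  proof (rule ccontr)
    assume "L i \<inter> L j \<noteq> {0}"
    then obtain x where "x \<in> L i" "x \<in> L j" "x \<noteq> 0" using zero by blast
    then have "L i = L j" using span_eq by metis
    then show False using inj that by (simp add: inj_eq)
  qed
qed

lemma two_pencils_of_planes: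
  assumes "plane_with_four_lines sc1 L1" "plane_with_four_lines sc2 L2"
  shows "two_pencils L1 L2"
  by unfold_locales (simp_all add: two_pencils_line[OF assms(1)] two_pencils_line[OF assms(2)])

section \<open>The Euler product of the series\<close>

text \<open>
  The sum of the weights of the local pairs at a closed point.
\<close>

definition local_sum :: "complex ^ 4 \<Rightarrow> 'k::{field,finite} closed_point \<Rightarrow> complex" where
  "local_sum t c = (let w = of_real (point_size_inv c); z = (\<lambda>i. w * (t $ i) ^ deg_pt c) in
     (1 - w) ^ 3 * (1 + 3 * w) + (\<Sum>i\<in>UNIV. (1 - w) ^ 3 * (1 + w) * (z i / (1 - z i))))"

lemma point_size_inv_mult:
  "point_size_inv (c :: 'k::{field,finite} closed_point) * real CARD('k) ^ deg_pt c = 1"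
  by (simp add: point_size_inv_def)

lemma point_size_inv_cancel:
  fixes c :: "'k::{field,finite} closed_point"
  shows "complex_of_real (point_size_inv c) ^ 2 * (of_nat CARD('k) * s) ^ deg_pt c = of_real (point_size_inv c) * s ^ deg_pt c"
proof -
  have "complex_of_real (point_size_inv c) * of_nat CARD('k) ^ deg_pt c = 1"
    using arg_cong[OF point_size_inv_mult[of c], of complex_of_real] by simp
  then show ?thesis by (simp add: power2_eq_square power_mult_distrib algebra_simps)
qed

lemma norm_scaled:
  fixes c :: "'k::{field,finite} closed_point"
  shows "norm (complex_of_real (point_size_inv c) * s ^ deg_pt c) = (norm s / real CARD('k)) ^ deg_pt c"
  by (simp add: norm_mult norm_power norm_divide point_size_inv_def power_divide)

lemma norm_scaled_lt:
  fixes c :: "'k::{field,finite} closed_point"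
  assumes "norm s < 1"
  shows "norm (complex_of_real (point_size_inv c) * s ^ deg_pt c) < 1 / 2"
proof -
  have u: "0 < point_size_inv c" "point_size_inv c \<le> 1 / 2" by (rule point_size_inv_bounds)+
  have "norm s ^ deg_pt c < 1" using assms deg_pt_pos[of c] by (simp add: power_less_one_iff)
  then have "point_size_inv c * norm s ^ deg_pt c < point_size_inv c * 1" using u by (intro mult_strict_left_mono)
  then have "point_size_inv c * norm s ^ deg_pt c < 1 / 2" using u by linarith
  then show ?thesis using u by (simp add: norm_mult norm_power)
qed

text \<open>
  In the bound for the nontrivial pairs, the flags contribute at most \<open>(6 + 8 + 3) u^2\<close> and each of the four
  geometric series at most \<open>18 \<rho>^{|c|}\<close>, where \<open>\<rho> = max |t\<^sub>i| / q\<close>. The number \<open>u^2\<close> is \<open>q^{-2|c|}\<close>.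
\<close>

lemma local_has_sum:
  fixes c :: "'k::{field,finite} closed_point" and t :: "complex ^ 4"
  assumes t: "\<And>i. norm (t $ i) < 1"
  defines "W \<equiv> pair_weight (point_size_inv c) (\<lambda>i. (of_nat CARD('k) * t $ i) ^ deg_pt c)"
    and "\<rho> \<equiv> Max (range (\<lambda>i. norm (t $ i))) / real CARD('k)"
  shows "(W has_sum local_sum t c) local_pairs" and "(\<lambda>p. norm (W p)) summable_on local_pairs"
    and "(\<Sum>\<^sub>\<infinity>p\<in>local_pairs - {trivial_pair}. norm (W p)) \<le> 17 * ((1 / real CARD('k)) ^ 2) ^ deg_pt c + 72 * \<rho> ^ deg_pt c"
proof -
  define u where "u = point_size_inv c"
  define z where "z i = norm (of_real u * (t $ i) ^ deg_pt c)" for i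
  have u: "0 < u" "u \<le> 1 / 2" using point_size_inv_bounds[of c] by (simp_all add: u_def)
  have arg: "of_real u ^ 2 * (of_nat CARD('k) * t $ i) ^ deg_pt c = of_real u * (t $ i) ^ deg_pt c" for i
    unfolding u_def by (rule point_size_inv_cancel)
  have zlt: "z i < 1 / 2" and z0: "0 \<le> z i" for i
    using norm_scaled_lt[OF t, of c i] by (simp_all add: z_def u_def)
  have narg: "u ^ 2 * norm ((of_nat CARD('k) * t $ i) ^ deg_pt c) = z i" for i
    using arg_cong[OF arg[of i], of norm] u by (simp add: z_def norm_mult norm_power)
  have zlt1: "z i < 1" for i using zlt[of i] by linarith
  have "norm (of_real u ^ 2 * (of_nat CARD('k) * t $ i) ^ deg_pt c) < 1" for i
    using zlt1[of i] by (simp only: arg z_def)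
  from has_sum_pair_weight[of u "\<lambda>i. (of_nat CARD('k) * t $ i) ^ deg_pt c", OF this] show "(W has_sum local_sum t c) local_pairs"
    by (simp only: W_def local_sum_def Let_def u_def[symmetric] arg)
  have N: "((\<lambda>p. norm (W p)) has_sum (1 + 6 * u ^ 2 + 8 * u ^ 3 + 3 * u ^ 4 +
      (\<Sum>i\<in>UNIV. (1 + u) ^ 2 * (1 + u ^ 2) * (z i / (1 - z i))))) local_pairs"
  proof -
    have "u ^ 2 * norm ((of_nat CARD('k) * t $ i) ^ deg_pt c) < 1" for i using zlt1[of i] by (simp only: narg)
    from has_sum_norm_pair_weight[of u "\<lambda>i. (of_nat CARD('k) * t $ i) ^ deg_pt c", OF less_imp_le[OF u(1)] this] show ?thesis
      by (simp only: W_def u_def[symmetric] narg)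
  qed
  then show "(\<lambda>p. norm (W p)) summable_on local_pairs" by (auto simp: summable_on_def)
  then have "(\<Sum>\<^sub>\<infinity>p\<in>local_pairs - {trivial_pair}. norm (W p)) =
     (\<Sum>\<^sub>\<infinity>p\<in>local_pairs. norm (W p)) - norm (W trivial_pair)"
    using trivial_pair_in by (subst infsum_Diff) simp_all
  also have "W trivial_pair = 1"
    by (simp add: W_def pair_weight_def)
  also have "(\<Sum>\<^sub>\<infinity>p\<in>local_pairs. norm (W p)) = 1 + 6 * u ^ 2 + 8 * u ^ 3 + 3 * u ^ 4 +
      (\<Sum>i\<in>UNIV. (1 + u) ^ 2 * (1 + u ^ 2) * (z i / (1 - z i)))"
    by (rule infsumI[OF N])
  also have "\<dots> - norm (1 :: complex) \<le> 17 * u ^ 2 + 72 * \<rho> ^ deg_pt c"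
  proof -
    have p: "u ^ 3 \<le> u ^ 2" "u ^ 4 \<le> u ^ 2" using u by (auto intro!: power_decreasing)
    have zr: "z i \<le> \<rho> ^ deg_pt c" for i
    proof -
      have "norm (t $ i) \<le> Max (range (\<lambda>i. norm (t $ i)))" by (intro Max_ge) auto
      then have "norm (t $ i) / real CARD('k) \<le> \<rho>" unfolding \<rho>_def by (intro divide_right_mono) auto
      then show ?thesis unfolding z_def u_def norm_scaled by (intro power_mono) auto
    qed
    have "(1 + u) ^ 2 * (1 + u ^ 2) * (z i / (1 - z i)) \<le> 18 * \<rho> ^ deg_pt c" for i
    proof -
      have h1: "(1 + u) ^ 2 * (1 + u ^ 2) \<le> 3 ^ 2 * 1"
      proof -
        have "u ^ 2 \<le> (1 / 2) ^ 2" using u by (intro power_mono) auto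
        moreover have "(1 + u) ^ 2 \<le> (3 / 2) ^ 2" using u by (intro power_mono) auto
        ultimately have "(1 + u) ^ 2 * (1 + u ^ 2) \<le> (3 / 2) ^ 2 * (1 + (1 / 2) ^ 2)" by (intro mult_mono) auto
        then show ?thesis by (simp add: power2_eq_square)
      qed
      have h2: "z i / (1 - z i) \<le> \<rho> ^ deg_pt c / (1 / 2)"
        using zlt[of i] z0[of i] zr[of i] by (intro frac_le) auto
      have "(1 + u) ^ 2 * (1 + u ^ 2) * (z i / (1 - z i)) \<le> (3 ^ 2 * 1) * (\<rho> ^ deg_pt c / (1 / 2))"
        by (rule mult_mono[OF h1 h2]) (use zlt1[of i] z0[of i] in auto)
      then show ?thesis by simp
    qed
    then have "(\<Sum>i\<in>(UNIV :: 4 set). (1 + u) ^ 2 * (1 + u ^ 2) * (z i / (1 - z i))) \<le> (\<Sum>i\<in>(UNIV :: 4 set). 18 * \<rho> ^ deg_pt c)"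
      by (intro sum_mono)
    then show ?thesis using p by simp
  qed
  also have "u ^ 2 = ((1 / real CARD('k)) ^ 2) ^ deg_pt c"
    by (simp add: u_def point_size_inv_def power_one_over power_mult[symmetric] mult.commute)
  finally show "(\<Sum>\<^sub>\<infinity>p\<in>local_pairs - {trivial_pair}. norm (W p)) \<le> 17 * ((1 / real CARD('k)) ^ 2) ^ deg_pt c + 72 * \<rho> ^ deg_pt c" .
qed

lemma local_sum_times_zeta:
  fixes c :: "'k::{field,finite} closed_point" and t :: "complex ^ 4"
  assumes t: "\<And>i. norm (t $ i) < 1"
  shows "euler_factor euler_a euler_b euler_e t c =
    local_sum t c * (\<Prod>i\<in>UNIV. 1 - (t $ i / of_nat CARD('k)) ^ deg_pt c)"
proof -
  define w where "w = complex_of_real (point_size_inv c)"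
  define z where "z i = w * (t $ i) ^ deg_pt c" for i
  have z1: "1 - z i \<noteq> 0" for i
  proof
    assume "1 - z i = 0"
    then have "norm (z i) = 1" by simp
    moreover have "norm (z i) < 1 / 2" unfolding z_def w_def by (rule norm_scaled_lt[OF t])
    ultimately show False by simp
  qed
  have z: "(t $ i / of_nat CARD('k)) ^ deg_pt c = z i" for i
    by (simp add: z_def w_def point_size_inv_def power_divide)
  have "z i / (1 - z i) * (\<Prod>i\<in>UNIV. 1 - z i) = z i * (\<Prod>j\<in>UNIV - {i}. 1 - z j)" for i
  proof -
    have "(\<Prod>i\<in>UNIV. 1 - z i) = (1 - z i) * (\<Prod>j\<in>UNIV - {i}. 1 - z j)" by (rule prod.remove) auto
    then show ?thesis using z1[of i] by simp
  qed
  then have "(\<Sum>i\<in>UNIV. z i * (\<Prod>j\<in>UNIV - {i}. 1 - z j)) = (\<Sum>i\<in>UNIV. z i / (1 - z i)) * (\<Prod>i\<in>UNIV. 1 - z i)"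
    by (simp add: sum_distrib_right)
  then show ?thesis
    unfolding euler_factor_eq local_sum_def Let_def w_def[symmetric] z_def[symmetric] z sum_distrib_left[symmetric]
    by (simp only: distrib_right mult.assoc)
qed

context two_pencils
begin

lemma pair_term_sum:
  fixes t :: "complex ^ 4"
  assumes t: "\<And>i. norm (t $ i) < 1"
  shows "(\<lambda>p. norm (pair_term t p)) summable_on (all_pairs :: (_ \<times> (_ \<Rightarrow> 'k::{field,finite} closed_point subscheme)) set)"
    and "abs_convergent_infprod (local_sum t :: 'k closed_point \<Rightarrow> complex)"
    and "(\<Sum>\<^sub>\<infinity>p\<in>(all_pairs :: (_ \<times> (_ \<Rightarrow> 'k closed_point subscheme)) set). pair_term t p) = infprod (local_sum t :: 'k closed_point \<Rightarrow> complex)"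
proof -
  define g where "g = (\<lambda>c :: 'k closed_point. pair_weight (point_size_inv c) (\<lambda>i. (of_nat CARD('k) * t $ i) ^ deg_pt c))"
  let ?F = "finsupp local_pairs trivial_pair :: ('k closed_point \<Rightarrow> _) set"
  let ?\<rho> = "Max (range (\<lambda>i. norm (t $ i))) / real CARD('k)"
  have q: "2 \<le> real CARD('k)" by (rule q_ge_2)
  have G: "(\<Sum>\<^sub>\<infinity>p\<in>local_pairs. g c p) = local_sum t c" for c
    unfolding g_def by (rule infsumI[OF local_has_sum(1)[OF t]])
  have M: "0 \<le> Max (range (\<lambda>i. norm (t $ i)))" "Max (range (\<lambda>i. norm (t $ i))) < 1"
    using t by (auto simp: Max_ge_iff)
  have s1: "(\<lambda>c :: 'k closed_point. 17 * ((1 / real CARD('k)) ^ 2) ^ deg_pt c) summable_on UNIV"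
    by (intro summable_on_cmult_right summable_on_points) (use q in \<open>auto simp: power2_eq_square\<close>)
  have s2: "(\<lambda>c :: 'k closed_point. 72 * ?\<rho> ^ deg_pt c) summable_on UNIV"
    by (intro summable_on_cmult_right summable_on_points) (use q M in auto)
  have sum: "(\<lambda>c. \<Sum>\<^sub>\<infinity>p\<in>local_pairs - {trivial_pair}. norm (g c p)) summable_on UNIV"
  proof (rule summable_on_comparison_test[OF summable_on_add[OF s1 s2]])
    show "0 \<le> (\<Sum>\<^sub>\<infinity>p\<in>local_pairs - {trivial_pair}. norm (g c p))" for c by (rule infsum_nonneg) simp
  qed (unfold g_def, rule local_has_sum(3)[OF t])
  have one: "g c trivial_pair = 1" for c by (simp add: g_def pair_weight_def)
  have abs: "(\<lambda>p. norm (g c p)) summable_on local_pairs" for c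
    unfolding g_def by (rule local_has_sum(2)[OF t])
  note ep = euler_product[of trivial_pair local_pairs g, OF trivial_pair_in one abs sum, unfolded G]
  show "abs_convergent_infprod (local_sum t :: 'k closed_point \<Rightarrow> complex)" by (rule ep(2))
  have pt: "pair_term t (to_pair \<sigma>) = (\<Prod>c | \<sigma> c \<noteq> trivial_pair. g c (\<sigma> c))" if "\<sigma> \<in> ?F" for \<sigma>
    unfolding g_def by (rule pair_term_to_pair[OF that])
  have "(\<lambda>\<sigma>. norm (pair_term t (to_pair \<sigma>))) summable_on ?F"
    using ep(1) by (rule summable_on_cong[THEN iffD1, rotated]) (simp add: pt)
  then show "(\<lambda>p. norm (pair_term t p)) summable_on (all_pairs :: (_ \<times> (_ \<Rightarrow> 'k closed_point subscheme)) set)"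
    by (subst (asm) summable_on_reindex_bij_betw[OF bij_to_pair])
  have "(\<Sum>\<^sub>\<infinity>p\<in>(all_pairs :: (_ \<times> (_ \<Rightarrow> 'k closed_point subscheme)) set). pair_term t p) = (\<Sum>\<^sub>\<infinity>\<sigma>\<in>?F. pair_term t (to_pair \<sigma>))"
    by (rule infsum_reindex_bij_betw[OF bij_to_pair, symmetric])
  also have "\<dots> = (\<Sum>\<^sub>\<infinity>\<sigma>\<in>?F. \<Prod>c | \<sigma> c \<noteq> trivial_pair. g c (\<sigma> c))" by (rule infsum_cong) (rule pt)
  also have "\<dots> = infprod (local_sum t :: 'k closed_point \<Rightarrow> complex)" by (rule ep(3))
  finally show "(\<Sum>\<^sub>\<infinity>p\<in>(all_pairs :: (_ \<times> (_ \<Rightarrow> 'k closed_point subscheme)) set). pair_term t p) = infprod (local_sum t :: 'k closed_point \<Rightarrow> complex)" .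
qed

lemma pair_term_fibres:
  fixes t :: "complex ^ 4"
  assumes t: "\<And>i. norm (t $ i) < 1"
  shows "(\<lambda>kp. pair_term t (snd kp)) summable_on (SIGMA k:UNIV. (Uk_le_QJB L1 L2 k :: (_ \<times> (_ \<Rightarrow> 'k::{field,finite} closed_point subscheme)) set))"
  unfolding summable_on_reindex_bij_betw[OF Uk_le_QJB_bij]
  by (rule abs_summable_summable[OF pair_term_sum(1)[OF t]])

lemma pair_term_on_fibre:
  fixes t :: "complex ^ 4"
  assumes "p \<in> (Uk_le_QJB L1 L2 k :: (_ \<times> (_ \<Rightarrow> 'k::{field,finite} closed_point subscheme)) set)"
  shows "pair_term t p = of_real (Zterm L1 L2 p) * (\<Prod>i\<in>UNIV. (of_nat CARD('k) * t $ i) ^ k i)"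
  using assms by (auto simp: pair_term_def Uk_le_QJB_def Uk_def)

text \<open>
  The coefficients converge because the whole series converges absolutely at a point with nonzero
  coordinates.
\<close>

lemma Zterm_summable:
  "(Zterm L1 L2 :: (4 \<Rightarrow> 'k::{field,finite} closed_point multiset) \<times> _ \<Rightarrow> real) summable_on Uk_le_QJB L1 L2 k"
proof -
  let ?U = "Uk_le_QJB L1 L2 k :: (_ \<times> (_ \<Rightarrow> 'k closed_point subscheme)) set"
  \<comment> \<open>any point of the open polydisc with nonzero coordinates would do\<close>
  define t :: "complex ^ 4" where "t = (\<chi> i. 1 / 2)"
  define C where "C = (\<Prod>i\<in>(UNIV :: 4 set). (of_nat CARD('k) * t $ i) ^ k i)"
  have C: "C \<noteq> 0" by (simp add: C_def t_def)
  have "(\<lambda>(k, p). pair_term t p) summable_on (SIGMA k:UNIV. (Uk_le_QJB L1 L2 k :: (_ \<times> (_ \<Rightarrow> 'k closed_point subscheme)) set))"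
    using pair_term_fibres[of t, where ?'k = 'k] by (simp add: t_def case_prod_unfold)
  then have "pair_term t summable_on ?U" by (rule summable_on_SigmaD1) simp
  then have "(\<lambda>p. of_real (Zterm L1 L2 p) * C) summable_on ?U"
    by (rule summable_on_cong[THEN iffD1, rotated]) (simp add: pair_term_on_fibre C_def)
  then have "(\<lambda>p. complex_of_real (Zterm L1 L2 p)) summable_on ?U"
    using C by (simp add: summable_on_cmult_left')
  then have "(\<lambda>p. Re (complex_of_real (Zterm L1 L2 p))) summable_on ?U" by (rule summable_on_Re)
  then show ?thesis by simp
qed

lemma Zmonomial_eq:
  fixes t :: "complex ^ 4"
  shows "Zmonomial TYPE('k::{field,finite}) L1 L2 t k = (\<Sum>\<^sub>\<infinity>p\<in>(Uk_le_QJB L1 L2 k :: (_ \<times> (_ \<Rightarrow> 'k closed_point subscheme)) set). pair_term t p)"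
proof -
  let ?U = "Uk_le_QJB L1 L2 k :: (_ \<times> (_ \<Rightarrow> 'k closed_point subscheme)) set"
  have "(\<Sum>\<^sub>\<infinity>p\<in>?U. pair_term t p) = (\<Sum>\<^sub>\<infinity>p\<in>?U. of_real (Zterm L1 L2 p) * (\<Prod>i\<in>UNIV. (of_nat CARD('k) * t $ i) ^ k i))"
    by (rule infsum_cong) (rule pair_term_on_fibre)
  also have "\<dots> = (\<Sum>\<^sub>\<infinity>p\<in>?U. complex_of_real (Zterm L1 L2 p)) * (\<Prod>i\<in>UNIV. (of_nat CARD('k) * t $ i) ^ k i)"
    by (rule infsum_cmult_left')
  also have "(\<Sum>\<^sub>\<infinity>p\<in>?U. complex_of_real (Zterm L1 L2 p)) = of_real (\<Sum>\<^sub>\<infinity>p\<in>?U. Zterm L1 L2 p)"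
    using has_sum_of_real[OF has_sum_infsum[OF Zterm_summable[where ?'k = 'k, of k]]] by (rule infsumI)
  also have "(\<Prod>i\<in>UNIV. (of_nat CARD('k) * t $ i) ^ k i) = of_nat CARD('k) ^ (\<Sum>i\<in>UNIV. k i) * (\<Prod>i\<in>UNIV. (t $ i) ^ k i)"
    by (simp add: power_mult_distrib prod.distrib power_sum)
  finally show ?thesis by (simp add: Zmonomial_def Zcoeff_def)
qed

lemma Zseries_eq:
  fixes t :: "complex ^ 4"
  assumes t: "\<And>i. norm (t $ i) < 1"
  shows "Zmonomial TYPE('k::{field,finite}) L1 L2 t summable_on UNIV"
    and "Zseries TYPE('k) L1 L2 t = infprod (local_sum t :: 'k closed_point \<Rightarrow> complex)"
proof -
  let ?U = "\<lambda>k. Uk_le_QJB L1 L2 k :: (_ \<times> (_ \<Rightarrow> 'k closed_point subscheme)) set"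
  have s: "(\<lambda>(k, p). pair_term t p) summable_on (SIGMA k:UNIV. ?U k)"
    using pair_term_fibres[OF t] by (simp add: case_prod_unfold)
  have Z: "Zmonomial TYPE('k) L1 L2 t = (\<lambda>k. \<Sum>\<^sub>\<infinity>p\<in>?U k. pair_term t p)"
    by (rule ext) (rule Zmonomial_eq)
  show "Zmonomial TYPE('k) L1 L2 t summable_on UNIV"
    unfolding Z using summable_on_Sigma_banach[OF s] .
  have "Zseries TYPE('k) L1 L2 t = (\<Sum>\<^sub>\<infinity>k. \<Sum>\<^sub>\<infinity>p\<in>?U k. pair_term t p)"
    by (simp only: Zseries_def Z)
  also have "\<dots> = (\<Sum>\<^sub>\<infinity>(k, p)\<in>(SIGMA k:UNIV. ?U k). pair_term t p)"
    by (rule infsum_Sigma'_banach[OF s])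
  also have "\<dots> = (\<Sum>\<^sub>\<infinity>kp\<in>(SIGMA k:UNIV. ?U k). pair_term t (snd kp))" by (simp add: case_prod_unfold)
  also have "\<dots> = (\<Sum>\<^sub>\<infinity>p\<in>(all_pairs :: (_ \<times> (_ \<Rightarrow> 'k closed_point subscheme)) set). pair_term t p)"
    by (rule infsum_reindex_bij_betw[OF Uk_le_QJB_bij])
  also have "\<dots> = infprod (local_sum t :: 'k closed_point \<Rightarrow> complex)" by (rule pair_term_sum(3)[OF t])
  finally show "Zseries TYPE('k) L1 L2 t = infprod (local_sum t :: 'k closed_point \<Rightarrow> complex)" .
qed

lemma Zseries_euler_product:
  fixes t :: "complex ^ 4" and q :: real
  assumes t: "\<And>i. norm (t $ i) < 1" and q_def: "q = real CARD('k::{field,finite})"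
  shows "(\<Prod>i\<in>UNIV. inverse (zeta_P1 q (t $ i / of_real q))) * Zseries TYPE('k::{field,finite}) L1 L2 t =
    infprod (euler_factor euler_a euler_b euler_e t :: 'k closed_point \<Rightarrow> complex)"
    and "(\<Prod>i\<in>UNIV. zeta_P1 q (t $ i / of_real q)) \<noteq> 0"
proof -
  have q: "2 \<le> q" unfolding q_def by (rule q_ge_2)
  have r: "real CARD('k) * norm (t $ i / of_real q) < 1" for i
    using t[of i] q by (simp add: norm_divide q_def)
  have zeta: "zeta_P1 q (t $ i / of_real q) \<noteq> 0" for i
  proof -
    have "t $ i / of_real q \<noteq> 1"
    proof
      assume "t $ i / of_real q = 1"
      then have "norm (t $ i / of_real q) = 1" by simp
      then show False using r[of i] q by (simp add: q_def)
    qed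
    moreover have "of_real q * (t $ i / of_real q) \<noteq> 1"
      using t[of i] q by auto
    ultimately show ?thesis by (simp add: zeta_P1_def)
  qed
  then show "(\<Prod>i\<in>UNIV. zeta_P1 q (t $ i / of_real q)) \<noteq> 0" by simp
  have lim: "((\<lambda>A. \<Prod>c\<in>A. 1 - (t $ i / of_real q) ^ deg_pt c) \<longlongrightarrow> inverse (zeta_P1 q (t $ i / of_real q)))
      (finite_subsets_at_top (UNIV :: 'k closed_point set))" for i
  proof -
    have "((\<lambda>A. inverse (\<Prod>c\<in>A. 1 / (1 - (t $ i / of_real q) ^ deg_pt c))) \<longlongrightarrow> inverse (zeta_P1 q (t $ i / of_real q)))
      (finite_subsets_at_top (UNIV :: 'k closed_point set))"
      using zeta_euler_product[OF r, of i] zeta[of i] by (intro tendsto_inverse) (simp_all add: q_def)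
    then show ?thesis by (simp add: prod_inversef[symmetric] comp_def)
  qed
  have "((\<lambda>A. (\<Prod>c\<in>A. local_sum t c) * (\<Prod>i\<in>UNIV. \<Prod>c\<in>A. 1 - (t $ i / of_real q) ^ deg_pt c)) \<longlongrightarrow>
      infprod (local_sum t :: 'k closed_point \<Rightarrow> complex) * (\<Prod>i\<in>UNIV. inverse (zeta_P1 q (t $ i / of_real q))))
      (finite_subsets_at_top (UNIV :: 'k closed_point set))"
    by (intro tendsto_mult tendsto_prod lim tendsto_infprod pair_term_sum(2)[OF t])
  moreover have "(\<Prod>c\<in>A. local_sum t c) * (\<Prod>i\<in>UNIV. \<Prod>c\<in>A. 1 - (t $ i / of_real q) ^ deg_pt c) =
      prod (euler_factor euler_a euler_b euler_e t) A" for A :: "'k closed_point set"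
    by (subst prod.swap) (simp add: local_sum_times_zeta[OF t] prod.distrib q_def)
  ultimately have "(prod (euler_factor euler_a euler_b euler_e t) \<longlongrightarrow>
      infprod (local_sum t :: 'k closed_point \<Rightarrow> complex) * (\<Prod>i\<in>UNIV. inverse (zeta_P1 q (t $ i / of_real q))))
      (finite_subsets_at_top (UNIV :: 'k closed_point set))"
    by (simp only:)
  from infprod_eqI[OF this] show "(\<Prod>i\<in>UNIV. inverse (zeta_P1 q (t $ i / of_real q))) * Zseries TYPE('k) L1 L2 t =
    infprod (euler_factor euler_a euler_b euler_e t :: 'k closed_point \<Rightarrow> complex)"
    by (simp add: Zseries_eq(2)[OF t] mult.commute)
qed

end

lemma euler_factor_converges:
  fixes t :: "complex ^ 4"
  assumes M: "1 \<le> M" "M ^ 2 < real CARD('k::{field,finite})" and t: "\<And>i. norm (t $ i) \<le> M"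
  shows "abs_convergent_infprod (euler_factor euler_a euler_b euler_e t :: 'k closed_point \<Rightarrow> complex)"
  unfolding abs_convergent_infprod_def
proof (rule summable_on_comparison_test[OF summable_on_euler_bound[OF M]])
  have "M * 1 \<le> M ^ 2" unfolding power2_eq_square using M by (intro mult_left_mono) auto
  then have "M \<le> real CARD('k)" using M by simp
  then show "norm (euler_factor euler_a euler_b euler_e t c - 1) \<le>
      17 * (5 + real (card higher_exponents)) * ((M / real CARD('k)) ^ 2) ^ deg_pt c" for c :: "'k closed_point"
    by (intro norm_euler_factor_minus_1[OF euler_coeffs_bounded_17 M(1) _ t])
qed simp

lemma tendsto_euler_product_at_1:
  "((\<lambda>t. infprod (euler_factor euler_a euler_b euler_e t :: 'k::{field,finite} closed_point \<Rightarrow> complex)) \<longlongrightarrow>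
     infprod (limit_factor :: 'k closed_point \<Rightarrow> complex)) (at (\<chi> i. 1))"
proof -
  \<comment> \<open>any \<open>M > 1\<close> with \<open>M^2 < 2\<close> works for every \<open>q\<close>\<close>
  define M :: real where "M = 5 / 4"
  let ?q = "real CARD('k)" and ?B = "{t :: complex ^ 4. \<forall>i. norm (t $ i) \<le> M}"
  have M: "1 \<le> M" "M ^ 2 < ?q" "M \<le> ?q" using q_ge_2[where ?'k = 'k] by (auto simp: M_def power2_eq_square)
  have "((\<lambda>t. infprod (euler_factor euler_a euler_b euler_e t :: 'k closed_point \<Rightarrow> complex)) \<longlongrightarrow>
     infprod (euler_factor euler_a euler_b euler_e (\<chi> i. 1) :: 'k closed_point \<Rightarrow> complex)) (at (\<chi> i. 1) within ?B)"
  proof (rule tendsto_infprod_dominated)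
    show "(\<lambda>c :: 'k closed_point. 17 * (5 + real (card higher_exponents)) * ((M / ?q) ^ 2) ^ deg_pt c) summable_on UNIV"
      by (rule summable_on_euler_bound[OF M(1,2)])
    show "(\<chi> i. 1) \<in> ?B" using M by simp
    show "norm (euler_factor euler_a euler_b euler_e t c - 1) \<le>
      17 * (5 + real (card higher_exponents)) * ((M / ?q) ^ 2) ^ deg_pt c" if "t \<in> ?B" for t and c :: "'k closed_point"
      using that by (intro norm_euler_factor_minus_1[OF euler_coeffs_bounded_17 M(1,3)]) auto
    show "continuous_on ?B (\<lambda>t. euler_factor euler_a euler_b euler_e t c)" for c :: "'k closed_point"
      unfolding euler_factor_def by (intro continuous_intros)
  qed
  then have "((\<lambda>t. infprod (euler_factor euler_a euler_b euler_e t :: 'k closed_point \<Rightarrow> complex)) \<longlongrightarrow>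
     infprod (limit_factor :: 'k closed_point \<Rightarrow> complex)) (at (\<chi> i. 1) within ?B)"
    by (simp add: euler_factor_at_1[abs_def])
  moreover have "at (\<chi> i. 1) within ?B = at (\<chi> i. 1)"
  proof (rule at_within_nhd)
    show "(\<chi> i. 1) \<in> ball (\<chi> i. 1) (1 / 4)" by simp
    have "norm (t $ i) \<le> M" if "t \<in> ball (\<chi> i. 1) (1 / 4)" for t :: "complex ^ 4" and i
    proof -
      have "norm ((\<chi> i. 1) $ i - t $ i) \<le> norm ((\<chi> i. 1) - t)"
        using Finite_Cartesian_Product.norm_nth_le[of "(\<chi> i. 1) - t" i] by simp
      also have "\<dots> < 1 / 4" using that by (simp add: dist_norm)
      finally have "norm (1 - t $ i) < 1 / 4" by simp
      then show ?thesis using norm_triangle_ineq2[of "t $ i" 1] by (simp add: M_def norm_minus_commute)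
    qed
    then show "?B \<inter> ball (\<chi> i. 1) (1 / 4) - {\<chi> i. 1} = UNIV \<inter> ball (\<chi> i. 1) (1 / 4) - {\<chi> i. 1}" by blast
  qed simp
  ultimately show ?thesis by simp
qed

lemma zeta_P1_scaled:
  assumes "q \<noteq> 0"
  shows "zeta_P1 q (s / of_real q) = 1 / ((1 - s / of_real q) * (1 - s))"
  using assms by (simp add: zeta_P1_def)

text \<open>
  The factors \<open>1 - t\<^sub>i\<close> cancel the poles of the zeta functions at \<open>t\<^sub>i = 1\<close>.
\<close>

lemma tendsto_normalised_euler_product:
  fixes q :: real
  assumes q_def: "q = real CARD('k::{field,finite})"
  shows "((\<lambda>t. (\<Prod>i\<in>UNIV. 1 - t $ i) * ((\<Prod>i\<in>UNIV. zeta_P1 q (t $ i / of_real q)) *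
       infprod (euler_factor euler_a euler_b euler_e t :: 'k::{field,finite} closed_point \<Rightarrow> complex)))
     \<longlongrightarrow> (1 - 1 / of_real q) powi (-4) * infprod (limit_factor :: 'k closed_point \<Rightarrow> complex))
     (at (\<chi> i. 1) within {t :: complex ^ 4. \<forall>i. t $ i \<noteq> 1})"
proof -
  let ?P = "\<lambda>t. infprod (euler_factor euler_a euler_b euler_e t :: 'k closed_point \<Rightarrow> complex)"
  let ?S = "{t :: complex ^ 4. \<forall>i. t $ i \<noteq> 1}"
  have q: "2 \<le> q" unfolding q_def by (rule q_ge_2)
  have q1: "1 - 1 / complex_of_real q \<noteq> 0"
  proof
    assume "1 - 1 / complex_of_real q = 0"
    then have "complex_of_real q = of_real 1" using q by (simp add: field_simps)
    then have "q = 1" by (simp only: of_real_eq_iff)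
    then show False using q by simp
  qed
  have "((\<lambda>t :: complex ^ 4. \<Prod>i\<in>UNIV. 1 / (1 - t $ i / of_real q)) \<longlongrightarrow>
      (\<Prod>i\<in>(UNIV :: 4 set). 1 / (1 - (\<chi> i. 1) $ i / of_real q))) (at (\<chi> i. 1) within ?S)"
    by (intro tendsto_intros) (use q1 q in auto)
  also have "(\<Prod>i\<in>(UNIV :: 4 set). 1 / (1 - (\<chi> i. 1) $ i / complex_of_real q)) = (1 - 1 / of_real q) powi (-4)"
    by (simp add: power_int_def power_one_over inverse_eq_divide)
  finally have lim: "((\<lambda>t :: complex ^ 4. (\<Prod>i\<in>UNIV. 1 / (1 - t $ i / of_real q)) * ?P t) \<longlongrightarrow>
      (1 - 1 / of_real q) powi (-4) * infprod (limit_factor :: 'k closed_point \<Rightarrow> complex)) (at (\<chi> i. 1) within ?S)"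
    by (intro tendsto_mult tendsto_within_subset[OF tendsto_euler_product_at_1]) auto
  have eq: "(\<Prod>i\<in>UNIV. 1 / (1 - t $ i / of_real q)) * ?P t =
      (\<Prod>i\<in>UNIV. 1 - t $ i) * ((\<Prod>i\<in>UNIV. zeta_P1 q (t $ i / of_real q)) * ?P t)" if "t \<in> ?S" for t :: "complex ^ 4"
  proof -
    have "(\<Prod>i\<in>UNIV. 1 - t $ i) * (\<Prod>i\<in>UNIV. zeta_P1 q (t $ i / of_real q)) =
        (\<Prod>i\<in>UNIV. (1 - t $ i) * zeta_P1 q (t $ i / of_real q))" by (simp only: prod.distrib)
    also have "\<dots> = (\<Prod>i\<in>UNIV. 1 / (1 - t $ i / of_real q))"
    proof (rule prod.cong)
      fix i
      have "1 - t $ i \<noteq> 0" using that by (simp add: eq_commute[of 1])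
      then show "(1 - t $ i) * zeta_P1 q (t $ i / of_real q) = 1 / (1 - t $ i / of_real q)"
        using q by (subst zeta_P1_scaled) simp_all
    qed simp
    finally show ?thesis by (simp only: mult.assoc[symmetric])
  qed
  show ?thesis
    by (rule Lim_transform_within[OF lim zero_less_one]) (rule eq)
qed

theorem proposition9p6:
  fixes scale1 :: "'k::{field,finite} \<Rightarrow> 'v::ab_group_add \<Rightarrow> 'v"
    and scale2 :: "'k \<Rightarrow> 'w::ab_group_add \<Rightarrow> 'w"
    and L1 :: "4 \<Rightarrow> 'v set" and L2 :: "4 \<Rightarrow> 'w set"
    and q :: real
  assumes q_def: "q = real CARD('k)"
    and V1: "plane_with_four_lines scale1 L1"
    and V2: "plane_with_four_lines scale2 L2"
  shows
    \<comment> \<open>the coefficients and the series converge\<close>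
    "(\<forall>k. (Zterm L1 L2 :: (4 \<Rightarrow> 'k closed_point multiset) \<times> _ \<Rightarrow> real)
            summable_on Uk_le_QJB L1 L2 k) \<and>
     (\<forall>t. (\<forall>i. norm (t $ i) < 1) \<longrightarrow> Zmonomial TYPE('k) L1 L2 t summable_on UNIV) \<and>
     (\<exists>C a b (e :: 'k closed_point \<Rightarrow> (4 \<Rightarrow> nat) \<Rightarrow> real).
        euler_coeffs_bounded C a b e \<and>
        \<comment> \<open>the Euler product\<close>
        (\<forall>t. (\<forall>i. norm (t $ i) < 1) \<longrightarrow>
           abs_convergent_infprod (euler_factor a b e t) \<and>
           (\<Prod>i\<in>UNIV. inverse (zeta_P1 q (t $ i / of_real q))) * Zseries TYPE('k) L1 L2 t
             = infprod (euler_factor a b e t)) \<and>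
        \<comment> \<open>its domain of absolute convergence\<close>
        (\<forall>\<delta> t. 0 < \<delta> \<and> \<delta> < 1 / 2 \<and> (\<forall>i. norm (t $ i) \<le> q powr \<delta>) \<longrightarrow>
           abs_convergent_infprod (euler_factor a b e t)) \<and>
        \<comment> \<open>the limit, for the continuation of the series given by the Euler product\<close>
        ((\<lambda>t. (\<Prod>i\<in>UNIV. 1 - t $ i) *
              ((\<Prod>i\<in>UNIV. zeta_P1 q (t $ i / of_real q)) * infprod (euler_factor a b e t)))
           \<longlongrightarrow> (1 - 1 / of_real q) powi (-4) * infprod (limit_factor :: 'k closed_point \<Rightarrow> _))
          (at (\<chi> i. 1) within {t. \<forall>i. t $ i \<noteq> 1})) \<and>
     abs_convergent_infprod (limit_factor :: 'k closed_point \<Rightarrow> complex) \<and>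
     \<comment> \<open>the limit, for the series itself\<close>
     ((\<lambda>t. (\<Prod>i\<in>UNIV. 1 - t $ i) * Zseries TYPE('k) L1 L2 t)
        \<longlongrightarrow> (1 - 1 / of_real q) powi (-4) * infprod (limit_factor :: 'k closed_point \<Rightarrow> _))
       (at (\<chi> i. 1) within {t. \<forall>i. norm (t $ i) < 1})"
proof -
  interpret two_pencils L1 L2 by (rule two_pencils_of_planes[OF V1 V2])
  let ?E = "\<lambda>t. euler_factor euler_a euler_b euler_e t :: 'k closed_point \<Rightarrow> complex"
  let ?L = "(1 - 1 / of_real q) powi (-4) * infprod (limit_factor :: 'k closed_point \<Rightarrow> complex)"
  have q: "2 \<le> q" unfolding q_def by (rule q_ge_2)
  have conv: "abs_convergent_infprod (?E t)" if "1 \<le> M" "M ^ 2 < q" "\<And>i. norm (t $ i) \<le> M" for M and t :: "complex ^ 4"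
    using euler_factor_converges[of M t, where ?'k = 'k] that by (simp add: q_def)
  have conv1: "abs_convergent_infprod (?E t)" if "\<forall>i. norm (t $ i) \<le> 1" for t :: "complex ^ 4"
    by (rule conv[of 1]) (use q that in auto)
  have conv_lt: "abs_convergent_infprod (?E t)" if "\<forall>i. norm (t $ i) < 1" for t :: "complex ^ 4"
    using that by (intro conv1) (simp add: less_imp_le)
  have conv_delta: "abs_convergent_infprod (?E t)"
    if "0 < \<delta>" "\<delta> < 1 / 2" "\<forall>i. norm (t $ i) \<le> q powr \<delta>" for \<delta> and t :: "complex ^ 4"
  proof (rule conv[of "q powr \<delta>"])
    show "1 \<le> q powr \<delta>" using q that(1) by (intro ge_one_powr_ge_zero) auto
    have "(q powr \<delta>) ^ 2 = q powr (\<delta> * 2)" using q by (simp add: powr_powr[symmetric] powr_realpow)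
    also have "\<dots> < q powr 1" using q that(2) by (intro powr_less_mono) auto
    finally show "(q powr \<delta>) ^ 2 < q" using q by simp
  qed (use that(3) in blast)
  have lim: "((\<lambda>t. (\<Prod>i\<in>UNIV. 1 - t $ i) * ((\<Prod>i\<in>UNIV. zeta_P1 q (t $ i / of_real q)) * infprod (?E t))) \<longlongrightarrow> ?L)
      (at (\<chi> i. 1) within {t :: complex ^ 4. \<forall>i. t $ i \<noteq> 1})"
    by (rule tendsto_normalised_euler_product[OF q_def])
  have lim_series: "((\<lambda>t. (\<Prod>i\<in>UNIV. 1 - t $ i) * Zseries TYPE('k) L1 L2 t) \<longlongrightarrow> ?L)
      (at (\<chi> i. 1) within {t :: complex ^ 4. \<forall>i. norm (t $ i) < 1})"
  proof (rule Lim_transform_within[OF tendsto_within_subset[OF lim] zero_less_one])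
    show "{t :: complex ^ 4. \<forall>i. norm (t $ i) < 1} \<subseteq> {t. \<forall>i. t $ i \<noteq> 1}"
    proof
      fix t :: "complex ^ 4" assume t: "t \<in> {t. \<forall>i. norm (t $ i) < 1}"
      have "t $ i \<noteq> 1" for i
      proof
        assume "t $ i = 1"
        moreover have "norm (t $ i) < 1" using t by blast
        ultimately show False by simp
      qed
      then show "t \<in> {t. \<forall>i. t $ i \<noteq> 1}" by blast
    qed
    fix t :: "complex ^ 4" assume "t \<in> {t. \<forall>i. norm (t $ i) < 1}"
    then have t: "\<And>i. norm (t $ i) < 1" by blast
    show "(\<Prod>i\<in>UNIV. 1 - t $ i) * ((\<Prod>i\<in>UNIV. zeta_P1 q (t $ i / of_real q)) * infprod (?E t)) =
        (\<Prod>i\<in>UNIV. 1 - t $ i) * Zseries TYPE('k) L1 L2 t"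
    proof -
      have "(\<Prod>i\<in>UNIV. zeta_P1 q (t $ i / of_real q)) * (\<Prod>i\<in>UNIV. inverse (zeta_P1 q (t $ i / of_real q))) =
          (\<Prod>i\<in>UNIV. zeta_P1 q (t $ i / of_real q) * inverse (zeta_P1 q (t $ i / of_real q)))"
        by (simp only: prod.distrib)
      also have "\<dots> = 1" using Zseries_euler_product(2)[OF t q_def] by simp
      finally have "(\<Prod>i\<in>UNIV. zeta_P1 q (t $ i / of_real q)) * infprod (?E t) = Zseries TYPE('k) L1 L2 t"
        unfolding Zseries_euler_product(1)[OF t q_def, symmetric] mult.assoc[symmetric] by simp
      then show ?thesis by (simp only:)
    qed
  qed
  have "abs_convergent_infprod (limit_factor :: 'k closed_point \<Rightarrow> complex)"
    using conv1[of "\<chi> i. 1"] by (simp add: euler_factor_at_1[abs_def])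
  then show ?thesis
    by (intro conjI allI impI exI[of _ 17] exI[of _ euler_a] exI[of _ euler_b] exI[of _ euler_e] lim lim_series
        Zterm_summable Zseries_eq(1) euler_coeffs_bounded_17 Zseries_euler_product(1)[OF _ q_def])
      (blast intro: conv_lt conv_delta)+
qed

end
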